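(* Let $P\ne\tilde P$ be points of $\mathbb P$, $u$ a coordinate with $u(\tilde P)=0$, $u(P)=\infty$, and $\tilde u=1/u$. Under the identifications $U\mathfrak g_P/\langle U^+\mathbf g\rangle=U\mathfrak g_{P,-}$ and $U\mathfrak g_{\tilde P}/\langle U^+\mathbf g\rangle=U\mathfrak g_{\tilde P,-}$, for $\nu$ a meromorphic map $\mathbb P\to\mathbf g$ and $z\in\mathbb P\setminus\{P,\tilde P\}$ not a pole of $\nu$, one has the equalities $$\tilde\epsilon^{\nu(z)}(z)=\epsilon^{\nu(z)}(z)-\nu(z)\frac{d\tilde u_z}{\tilde u(z)}:\ U\mathfrak g_{P,\tilde P}/\langle U^+\mathbf g\rangle\to\{U\mathfrak g_{P,\tilde P}/\langle U^+\mathbf g\rangle\}\otimes K_z,$$ $$\tilde\iota^{\nu(z)}(z)=\iota^{\nu(z)}(z)+\nu(z)\frac{d\tilde u_z}{\tilde u(z)}:\ U\mathfrak g^z_{P,\tilde P}/\langle U^+\mathbf g\rangle\to\{U\mathfrak g^z_{P,\tilde P}/\langle U^+\mathbf g\rangle\}\otimes K_z .$$ In particular $\tilde j^{\nu(z)}(z)=j^{\nu(z)}(z)$.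
   Context: $\mathbb P$ is a complex projective line with canonical bundle $K$; a coordinate is a meromorphic function with exactly one pole, which is simple. $\mathbf g$ is a complex Lie algebra with a nondegenerate invariant symmetric bilinear form $(\cdot,\cdot)$. $\mathfrak g_P$ is the Lie algebra of meromorphic maps $\mathbb P\to\mathbf g$ regular at $P$, $\mathfrak g_{P,-}\subset\mathfrak g_P$ the ideal of those vanishing at $P$; $\mathbf g\subset\mathfrak g_P$ as constant maps. $\mathfrak g_{P,\tilde P}$ is the algebra of maps regular at both $P$ and $\tilde P$; a superscript $z$ means moreover regular at $z$. $U^+\mathbf g\subset U\mathbf g$ is the augmentation ideal and $\langle U^+\mathbf g\rangle$ the left ideal it generates; by PBW the inclusion induces $U\mathfrak g_{P,-}\cong U\mathfrak g_P/\langle U^+\mathbf g\rangle$ (and similarly with superscript $z$ or with $\tilde P$), and $U\mathfrak g_{P,\tilde P}/\langle U^+\mathbf g\rangle$ is a subspace of both $U\mathfrak g_P/\langle U^+\mathbf g\rangle$ and $U\mathfrak g_{\tilde P}/\langle U^+\mathbf g\rangle$. In the equalities $\nu(z)\in\mathbf g$ acts by left multiplication. For $a\in\mathbf g$ and $z\ne P$: $\epsilon^a(z):U\mathfrak g_{P,-}\to U\mathfrak g_{P,-}\otimes K_z$ is left multiplication by $\frac{a}{u-u(z)}\otimes du_z$, and $\iota^a(z):U\mathfrak g_{P,-}^z\to U\mathfrak g_{P,-}^z\otimes K_z$ is defined (simultaneously for all $a$) by $\iota^a(z)\mathbf 1=0$ and, for $\alpha\in\mathfrak g_{P,-}^z$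 acting by left multiplication, $$\iota^a(z)\circ\alpha-\alpha\circ\iota^a(z)=-[\epsilon^a(z),\alpha]-(a,d\alpha(z))+\iota^{[a,\alpha(z)]}(z)+\epsilon^{[a,\alpha(z)]}(z).$$ $j^a(z)=\epsilon^a(z)+\iota^a(z)$. The fields $\tilde\epsilon,\tilde\iota,\tilde j$ are defined in the same way with $P$ replaced by $\tilde P$ and $u$ by $\tilde u$, so $\tilde\epsilon^a(z)$ is left multiplication by $\frac{a}{\tilde u-\tilde u(z)}\otimes d\tilde u_z$. *)

theory Defs
  imports
    "HOL-Complex_Analysis.Complex_Analysis"
    "HOL-Algebra.QuotRing"
    "HOL-Algebra.Module"
    "HOL-Library.Poly_Mapping"
begin

section \<open>Complex Lie algebras\<close>

class complex_vector = ab_group_add +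
  fixes scaleC :: "complex \<Rightarrow> 'a \<Rightarrow> 'a" (infixr \<open>*\<^sub>C\<close> 75)
  assumes scaleC_add_right: "c *\<^sub>C (x + y) = c *\<^sub>C x + c *\<^sub>C y"
    and scaleC_add_left: "(c + d) *\<^sub>C x = c *\<^sub>C x + d *\<^sub>C x"
    and scaleC_scaleC: "c *\<^sub>C (d *\<^sub>C x) = (c * d) *\<^sub>C x"
    and scaleC_one: "1 *\<^sub>C x = x"

instantiation complex :: complex_vector
begin
definition scaleC_complex :: "complex \<Rightarrow> complex \<Rightarrow> complex"
  where "scaleC_complex c x = c * x"
instance by standard (simp_all add: scaleC_complex_def algebra_simps)
end

class complex_lie_algebra = complex_vector +
  fixes lie :: "'a \<Rightarrow> 'a \<Rightarrow> 'a"
  assumes lie_add_left: "lie (x + y) z = lie x z + lie y z"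
    and lie_add_right: "lie x (y + z) = lie x y + lie x z"
    and lie_scaleC_left: "lie (c *\<^sub>C x) y = c *\<^sub>C lie x y"
    and lie_scaleC_right: "lie x (c *\<^sub>C y) = c *\<^sub>C lie x y"
    and lie_self: "lie x x = 0"
    and jacobi: "lie x (lie y z) + lie y (lie z x) + lie z (lie x y) = 0"

text \<open>A complex Lie algebra (of arbitrary dimension) with a nondegenerate invariant symmetric
  bilinear form.\<close>

class quadratic_lie_algebra = complex_lie_algebra +
  fixes form :: "'a \<Rightarrow> 'a \<Rightarrow> complex"
  assumes form_add_left: "form (x + y) z = form x z + form y z"
    and form_scaleC_left: "form (c *\<^sub>C x) y = c * form x y"
    and form_sym: "form x y = form y x"
    and form_invariant: "form (lie x y) z = form x (lie y z)"
    and form_nondegenerate: "(\<forall>y. form x y = 0) \<Longrightarrow> x = 0"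


section \<open>The projective line and its meromorphic maps\<close>

datatype cp1 = Aff complex | Infty

text \<open>The standard local parametrisation of the projective line, sending 0 to the given point.\<close>

fun chart :: "cp1 \<Rightarrow> complex \<Rightarrow> cp1" where
  "chart (Aff c) w = Aff (c + w)"
| "chart Infty w = (if w = 0 then Infty else Aff (1 / w))"

definition holo_at :: "(cp1 \<Rightarrow> complex) \<Rightarrow> cp1 \<Rightarrow> bool"
  where "holo_at h x \<longleftrightarrow> (h \<circ> chart x) analytic_on {0}"

definition mero_at :: "(cp1 \<Rightarrow> complex) \<Rightarrow> cp1 \<Rightarrow> bool"
  where "mero_at h x \<longleftrightarrow> (h \<circ> chart x) meromorphic_on {0}"

text \<open>A meromorphic map is undefined at its poles, which are finite in number; so meromorphic
  maps are represented by functions up to changes at finitely many points.\<close>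

quotient_type 'a mer = "cp1 \<Rightarrow> 'a" / "\<lambda>f g. finite {x. f x \<noteq> g x}"
proof (rule equivpI)
  show "reflp (\<lambda>f g :: cp1 \<Rightarrow> 'a. finite {x. f x \<noteq> g x})"
    by (simp add: reflp_def)
  show "symp (\<lambda>f g :: cp1 \<Rightarrow> 'a. finite {x. f x \<noteq> g x})"
    by (simp add: symp_def eq_commute)
  show "transp (\<lambda>f g :: cp1 \<Rightarrow> 'a. finite {x. f x \<noteq> g x})"
  proof (rule transpI)
    fix f g h :: "cp1 \<Rightarrow> 'a"
    assume "finite {x. f x \<noteq> g x}" "finite {x. g x \<noteq> h x}"
    then have "finite ({x. f x \<noteq> g x} \<union> {x. g x \<noteq> h x})" by simp
    then show "finite {x. f x \<noteq> h x}" by (rule rev_finite_subset) auto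
  qed
qed

lemma finite_neq_binop:
  assumes "finite {x. f x \<noteq> f' x}" "finite {x. g x \<noteq> g' x}"
  shows "finite {x. k (f x) (g x) \<noteq> k (f' x) (g' x)}"
proof -
  have "finite ({x. f x \<noteq> f' x} \<union> {x. g x \<noteq> g' x})" using assms by simp
  then show ?thesis by (rule rev_finite_subset) auto
qed

lemma finite_neq_unop:
  assumes "finite {x. f x \<noteq> f' x}"
  shows "finite {x. k (f x) \<noteq> k (f' x)}"
  by (rule rev_finite_subset[OF assms]) auto

lift_definition mer_of :: "(cp1 \<Rightarrow> 'a) \<Rightarrow> 'a mer" is "\<lambda>f. f" .

lift_definition mconst :: "'a \<Rightarrow> 'a mer" is "\<lambda>a x. a" .

instantiation mer :: (ab_group_add) ab_group_add
begin
lift_definition zero_mer :: "'a mer" is "\<lambda>x. 0" .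
lift_definition plus_mer :: "'a mer \<Rightarrow> 'a mer \<Rightarrow> 'a mer" is "\<lambda>f g x. f x + g x"
  by (rule finite_neq_binop)
lift_definition minus_mer :: "'a mer \<Rightarrow> 'a mer \<Rightarrow> 'a mer" is "\<lambda>f g x. f x - g x"
  by (rule finite_neq_binop)
lift_definition uminus_mer :: "'a mer \<Rightarrow> 'a mer" is "\<lambda>f x. - f x"
  by (rule finite_neq_unop)
instance by standard (transfer; simp add: algebra_simps)+
end

instantiation mer :: (complex_vector) complex_vector
begin
lift_definition scaleC_mer :: "complex \<Rightarrow> 'a mer \<Rightarrow> 'a mer" is "\<lambda>c f x. c *\<^sub>C f x"
  by (rule finite_neq_unop)
instance by standard
  (transfer; simp add: scaleC_add_right scaleC_add_left scaleC_scaleC scaleC_one)+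
end

instantiation mer :: (complex_lie_algebra) complex_lie_algebra
begin
lift_definition lie_mer :: "'a mer \<Rightarrow> 'a mer \<Rightarrow> 'a mer" is "\<lambda>f g x. lie (f x) (g x)"
  by (rule finite_neq_binop)
instance by standard
  (transfer; simp add: lie_add_left lie_add_right lie_scaleC_left lie_scaleC_right lie_self jacobi)+
end

instantiation mer :: (inverse) inverse
begin
lift_definition inverse_mer :: "'a mer \<Rightarrow> 'a mer" is "\<lambda>f x. inverse (f x)"
  by (rule finite_neq_unop)
lift_definition divide_mer :: "'a mer \<Rightarrow> 'a mer \<Rightarrow> 'a mer" is "\<lambda>f g x. f x / g x"
  by (rule finite_neq_binop)
instance ..
end

lift_definition mscale :: "complex mer \<Rightarrow> 'a::complex_vector mer \<Rightarrow> 'a mer"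
  is "\<lambda>f g x. f x *\<^sub>C g x"
  by (rule finite_neq_binop)

text \<open>The tensor \<open>\<Sum>i<n. h i \<otimes> a i\<close> of scalar functions and vectors. For
  finite-dimensional targets every function is of this form, with the \<open>a i\<close> a basis;
  in general it expresses that the map takes values in a finite-dimensional subspace.\<close>

definition tens :: "nat \<Rightarrow> (nat \<Rightarrow> cp1 \<Rightarrow> complex) \<Rightarrow> (nat \<Rightarrow> 'a) \<Rightarrow> 'a::complex_vector mer"
  where "tens n h a = mer_of (\<lambda>x. \<Sum>i<n. h i x *\<^sub>C a i)"

definition meromorphic :: "'a::complex_vector mer \<Rightarrow> bool"
  where "meromorphic F \<longleftrightarrow> (\<exists>n h a. (\<forall>i<n. \<forall>x. mero_at (h i) x) \<and> F = tens n h a)"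

definition regular :: "'a::complex_vector mer \<Rightarrow> cp1 \<Rightarrow> bool"
  where "regular F x \<longleftrightarrow> (\<exists>n h a. (\<forall>i<n. holo_at (h i) x) \<and> F = tens n h a)"

definition mval :: "'a::complex_vector mer \<Rightarrow> cp1 \<Rightarrow> 'a"
  where "mval F x = (THE v. \<exists>n h a. (\<forall>i<n. holo_at (h i) x) \<and> F = tens n h a \<and>
                       v = (\<Sum>i<n. h i x *\<^sub>C a i))"

text \<open>The differential at \<open>x\<close>. The fibre \<open>K\<^sub>x\<close> of the canonical bundle is the
  cotangent line at \<open>x\<close>; it is identified with the complex numbers by means of the basis
  \<open>dw\<close>, where \<open>w\<close> is the local coordinate inverse to \<open>chart x\<close>. Accordingly
  \<open>V \<otimes> K\<^sub>x\<close> is written as \<open>V\<close> for any vector space \<open>V\<close>.\<close>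

definition mdiff :: "'a::complex_vector mer \<Rightarrow> cp1 \<Rightarrow> 'a"
  where "mdiff F x = (THE v. \<exists>n h a. (\<forall>i<n. holo_at (h i) x) \<and> F = tens n h a \<and>
                       v = (\<Sum>i<n. deriv (h i \<circ> chart x) 0 *\<^sub>C a i))"

definition simple_pole :: "complex mer \<Rightarrow> cp1 \<Rightarrow> bool"
  where "simple_pole u P \<longleftrightarrow>
    (\<exists>f. u = mer_of f \<and> is_pole (f \<circ> chart P) 0 \<and> zorder (f \<circ> chart P) 0 = -1)"

definition coordinate :: "complex mer \<Rightarrow> bool"
  where "coordinate u \<longleftrightarrow>
    meromorphic u \<and> (\<exists>P. simple_pole u P \<and> (\<forall>x. x \<noteq> P \<longrightarrow> regular u x))"

definition const_maps :: "'a mer set"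
  where "const_maps = range mconst"

text \<open>For \<open>A = {P}\<close>, \<open>{P, z}\<close>, \<open>{P, P'}\<close>, \<open>{P, P', z}\<close> these are the Lie algebras of
  meromorphic maps regular at \<open>P\<close>, at \<open>P\<close> and \<open>z\<close>, etc., and their ideals of maps vanishing
  at \<open>P\<close>.\<close>

definition reg_maps :: "cp1 set \<Rightarrow> 'a::complex_vector mer set"
  where "reg_maps A = {F. meromorphic F \<and> (\<forall>x\<in>A. regular F x)}"

definition van_maps :: "cp1 set \<Rightarrow> cp1 \<Rightarrow> 'a::complex_vector mer set"
  where "van_maps A P = {F \<in> reg_maps A. mval F P = 0}"


section \<open>Universal enveloping algebras\<close>

text \<open>With lists as the free monoid, \<open>'v list \<Rightarrow>\<^sub>0 complex\<close> is the free associative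
  complex algebra on the type \<open>'v\<close>.\<close>

instantiation list :: (type) monoid_add
begin
definition zero_list :: "'a list" where "zero_list = []"
definition plus_list :: "'a list \<Rightarrow> 'a list \<Rightarrow> 'a list" where "plus_list xs ys = xs @ ys"
instance by standard (simp_all add: zero_list_def plus_list_def)
end

type_synonym 'v free = "'v list \<Rightarrow>\<^sub>0 complex"

definition free_alg :: "'v set \<Rightarrow> 'v free ring"
  where "free_alg L = \<lparr>carrier = {x. Poly_Mapping.keys x \<subseteq> lists L},
           mult = (*), one = 1, zero = 0, add = (+)\<rparr>"

definition fgen :: "'v \<Rightarrow> 'v free"
  where "fgen x = Poly_Mapping.single [x] 1"

definition fconst :: "complex \<Rightarrow> 'v free"
  where "fconst c = Poly_Mapping.single [] c"

text \<open>The linear relations turn the free algebra on the set \<open>L\<close> into the tensor algebra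
  of the vector space \<open>L\<close>.\<close>

definition env_rels :: "'v::complex_lie_algebra set \<Rightarrow> 'v free set"
  where "env_rels L =
     {fgen (x + y) - fgen x - fgen y | x y. x \<in> L \<and> y \<in> L}
   \<union> {fgen (c *\<^sub>C x) - fconst c * fgen x | c x. x \<in> L}
   \<union> {fgen x * fgen y - fgen y * fgen x - fgen (lie x y) | x y. x \<in> L \<and> y \<in> L}"

definition env_ideal :: "'v::complex_lie_algebra set \<Rightarrow> 'v free set"
  where "env_ideal L = genideal (free_alg L) (env_rels L)"

text \<open>The universal enveloping algebra of a Lie subalgebra \<open>L\<close> of \<open>'v\<close>.\<close>

definition U :: "'v::complex_lie_algebra set \<Rightarrow> 'v free set ring"
  where "U L = free_alg L Quot env_ideal L"

definition ucls :: "'v::complex_lie_algebra set \<Rightarrow> 'v free \<Rightarrow> 'v free set"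
  where "ucls L x = env_ideal L +>\<^bsub>free_alg L\<^esub> x"

definition ugen :: "'v::complex_lie_algebra set \<Rightarrow> 'v \<Rightarrow> 'v free set"
  where "ugen L x = ucls L (fgen x)"

definition uconst :: "'v::complex_lie_algebra set \<Rightarrow> complex \<Rightarrow> 'v free set"
  where "uconst L c = ucls L (fconst c)"

text \<open>For \<open>M \<subseteq> L\<close> the homomorphism \<open>U M \<rightarrow> U L\<close> induced by the inclusion: it sends the class
  of \<open>x\<close> modulo \<open>env_ideal M\<close> to the class of \<open>x\<close> modulo \<open>env_ideal L\<close>.\<close>

definition uincl :: "'v::complex_lie_algebra set \<Rightarrow> 'v free set \<Rightarrow> 'v free set"
  where "uincl L X = env_ideal L <+>\<^bsub>free_alg L\<^esub> X"

text \<open>The kernel of the algebra homomorphism from \<open>U L\<close> to the complex numbers that kills \<open>L\<close>;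
  on the free algebra this homomorphism is the coefficient of the empty word.\<close>

definition aug_ideal :: "'v::complex_lie_algebra set \<Rightarrow> 'v free set set"
  where "aug_ideal L = {ucls L x | x. x \<in> carrier (free_alg L) \<and> Poly_Mapping.lookup x [] = 0}"

definition gen_left_ideal :: "('a, 'b) ring_scheme \<Rightarrow> 'a set \<Rightarrow> 'a set"
  where "gen_left_ideal R S =
    \<Inter> {J. additive_subgroup J R \<and> (\<forall>r\<in>carrier R. \<forall>x\<in>J. r \<otimes>\<^bsub>R\<^esub> x \<in> J) \<and> S \<subseteq> J}"

text \<open>The left ideal \<open>\<langle>U\<^sup>+g\<rangle>\<close> of \<open>U L\<close>, where \<open>L\<close> contains the constant maps.\<close>

definition aug_left :: "'a::complex_lie_algebra mer set \<Rightarrow> 'a mer free set set"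
  where "aug_left L = gen_left_ideal (U L) (uincl L ` aug_ideal const_maps)"

text \<open>The left \<open>U L\<close>-module \<open>U L / \<langle>U\<^sup>+g\<rangle>\<close>. The ring operations \<open>mult\<close> and \<open>one\<close>
  of the module record are not used.\<close>

definition Q :: "'a::complex_lie_algebra mer set \<Rightarrow> ('a mer free set, 'a mer free set set) module"
  where "Q L = \<lparr>carrier = a_rcosets\<^bsub>U L\<^esub> (aug_left L), mult = undefined, one = undefined,
     zero = aug_left L, add = set_add (U L),
     smult = (\<lambda>r X. aug_left L <+>\<^bsub>U L\<^esub> (r <#\<^bsub>U L\<^esub> X))\<rparr>"

text \<open>For \<open>L \<subseteq> M\<close> the map \<open>Q L \<rightarrow> Q M\<close> induced by the inclusion.\<close>

definition qincl :: "'a::complex_lie_algebra mer set \<Rightarrow> 'a mer free set set \<Rightarrow> 'a mer free set set"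
  where "qincl M X = aug_left M <+>\<^bsub>U M\<^esub> (uincl M ` X)"

text \<open>For \<open>M \<subseteq> L\<close> the map \<open>U M \<rightarrow> U L / \<langle>U\<^sup>+g\<rangle>\<close> induced by the inclusion. It is
  bijective for \<open>L = reg_maps A\<close> and \<open>M = van_maps A P\<close> with \<open>P \<in> A\<close>.\<close>

definition ident :: "'a::complex_lie_algebra mer set \<Rightarrow> 'a mer free set \<Rightarrow> 'a mer free set set"
  where "ident L X = aug_left L +>\<^bsub>U L\<^esub> uincl L X"

definition transport ::
  "'a::complex_lie_algebra mer set \<Rightarrow> 'a mer set \<Rightarrow> ('a mer free set \<Rightarrow> 'a mer free set) \<Rightarrow>
   'a mer free set set \<Rightarrow> 'a mer free set set"
  where "transport L M T Y = ident L (T (the_inv_into (carrier (U M)) (ident L) Y))"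


section \<open>The fields\<close>

text \<open>The element \<open>a / (u - u(z)) \<otimes> du\<^sub>z\<close>.\<close>

definition polar :: "complex mer \<Rightarrow> 'a::complex_vector \<Rightarrow> cp1 \<Rightarrow> 'a mer"
  where "polar u a z = mdiff u z *\<^sub>C mscale (inverse (u - mconst (mval u z))) (mconst a)"

definition eps :: "'a::complex_lie_algebra mer set \<Rightarrow> complex mer \<Rightarrow> 'a \<Rightarrow> cp1 \<Rightarrow>
    'a mer free set \<Rightarrow> 'a mer free set"
  where "eps M u a z X = ugen M (polar u a z) \<otimes>\<^bsub>U M\<^esub> X"

text \<open>The characterisation of the operators \<open>\<iota>\<^sup>a(z)\<close> on \<open>U M\<close>, where the members of \<open>M\<close>
  are regular at \<open>z\<close>. In the recursion the two summands \<open>-[\<epsilon> a, \<alpha>]\<close> and \<open>\<epsilon> [a, \<alpha>(z)]\<close> do not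
  preserve \<open>U M\<close> separately, since \<open>polar u a z\<close> has a pole at \<open>z\<close>. By definition of \<open>\<epsilon>\<close>
  their sum is left multiplication by the Lie algebra element
  \<open>- lie (polar u a z) \<alpha> + polar u (lie a (mval \<alpha> z)) z\<close>, which is regular at \<open>z\<close>.\<close>

definition is_iota :: "'a::quadratic_lie_algebra mer set \<Rightarrow> complex mer \<Rightarrow> cp1 \<Rightarrow>
    ('a \<Rightarrow> 'a mer free set \<Rightarrow> 'a mer free set) \<Rightarrow> bool"
  where "is_iota M u z I \<longleftrightarrow>
    (\<forall>a. I a \<in> carrier (U M) \<rightarrow>\<^sub>E carrier (U M) \<and>
      (\<forall>X\<in>carrier (U M). \<forall>Y\<in>carrier (U M). I a (X \<oplus>\<^bsub>U M\<^esub> Y) = I a X \<oplus>\<^bsub>U M\<^esub> I a Y) \<and>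
      (\<forall>c. \<forall>X\<in>carrier (U M). I a (uconst M c \<otimes>\<^bsub>U M\<^esub> X) = uconst M c \<otimes>\<^bsub>U M\<^esub> I a X) \<and>
      I a \<one>\<^bsub>U M\<^esub> = \<zero>\<^bsub>U M\<^esub> \<and>
      (\<forall>\<alpha>\<in>M. \<forall>X\<in>carrier (U M).
        I a (ugen M \<alpha> \<otimes>\<^bsub>U M\<^esub> X) \<ominus>\<^bsub>U M\<^esub> ugen M \<alpha> \<otimes>\<^bsub>U M\<^esub> I a X =
          ugen M (- lie (polar u a z) \<alpha> + polar u (lie a (mval \<alpha> z)) z) \<otimes>\<^bsub>U M\<^esub> X
          \<ominus>\<^bsub>U M\<^esub> uconst M (form a (mdiff \<alpha> z)) \<otimes>\<^bsub>U M\<^esub> X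
          \<oplus>\<^bsub>U M\<^esub> I (lie a (mval \<alpha> z)) X))"

definition iota :: "'a::quadratic_lie_algebra mer set \<Rightarrow> complex mer \<Rightarrow> 'a \<Rightarrow> cp1 \<Rightarrow>
    'a mer free set \<Rightarrow> 'a mer free set"
  where "iota M u a z = (THE I. is_iota M u z I) a"

text \<open>The same operators on \<open>U L / \<langle>U\<^sup>+g\<rangle>\<close> for \<open>L = reg_maps A\<close>, by means of the
  identification with \<open>U (van_maps A P)\<close>. Here \<open>P \<in> A\<close> is the pole of \<open>u\<close>, and
  \<open>z \<notin> A\<close> for \<open>\<epsilon>\<close>, \<open>z \<in> A\<close> for \<open>\<iota>\<close>.\<close>

definition epsQ :: "cp1 set \<Rightarrow> cp1 \<Rightarrow> complex mer \<Rightarrow> 'a::quadratic_lie_algebra \<Rightarrow> cp1 \<Rightarrow>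
    'a mer free set set \<Rightarrow> 'a mer free set set"
  where "epsQ A P u a z = transport (reg_maps A) (van_maps A P) (eps (van_maps A P) u a z)"

definition iotaQ :: "cp1 set \<Rightarrow> cp1 \<Rightarrow> complex mer \<Rightarrow> 'a::quadratic_lie_algebra \<Rightarrow> cp1 \<Rightarrow>
    'a mer free set set \<Rightarrow> 'a mer free set set"
  where "iotaQ A P u a z = transport (reg_maps A) (van_maps A P) (iota (van_maps A P) u a z)"

text \<open>The sum \<open>j = \<epsilon> + \<iota>\<close>, from \<open>Q (reg_maps (insert z A))\<close> to \<open>Q (reg_maps A)\<close>.\<close>

definition jQ :: "cp1 set \<Rightarrow> cp1 \<Rightarrow> complex mer \<Rightarrow> 'a::quadratic_lie_algebra \<Rightarrow> cp1 \<Rightarrow>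
    'a mer free set set \<Rightarrow> 'a mer free set set"
  where "jQ A P u a z X =
    epsQ A P u a z (qincl (reg_maps A) X)
      \<oplus>\<^bsub>Q (reg_maps A)\<^esub> qincl (reg_maps A) (iotaQ (insert z A) P u a z X)"

text \<open>An operator \<open>T\<close> on \<open>Q L\<close> is the restriction of the operator \<open>T'\<close> on \<open>Q L'\<close> along the
  map induced by the inclusion of \<open>L\<close> in \<open>L'\<close>.\<close>

definition restricts_to :: "'a::complex_lie_algebra mer set \<Rightarrow> 'a mer set \<Rightarrow>
    ('a mer free set set \<Rightarrow> 'a mer free set set) \<Rightarrow>
    ('a mer free set set \<Rightarrow> 'a mer free set set) \<Rightarrow> bool"
  where "restricts_to L L' T' T \<longleftrightarrow>
    T \<in> carrier (Q L) \<rightarrow> carrier (Q L) \<and> (\<forall>X\<in>carrier (Q L). qincl L' (T X) = T' (qincl L' X))"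

end

theory Submission
  imports Defs
begin

text \<open>All operators are lifted to the free algebra. The recursion for \<open>\<iota>\<close> makes sense for every map
  that is regular at \<open>z\<close>, not only for those vanishing at \<open>P\<close>; it respects the relations of the
  enveloping algebra and kills the constants, so that it descends to \<open>Q L\<close> and is given there by the
  same formula for every \<open>L\<close>. Likewise \<open>\<epsilon>\<close> is left multiplication on \<open>Q L\<close>. This needs the
  identification of \<open>U M\<close> with \<open>Q L\<close>, which follows without the PBW theorem because \<open>L\<close> is the
  semidirect product of \<open>M\<close> and the constants.

  A coordinate is a Moebius transformation, by Liouville's theorem, whence
  \<open>a / (u' - u'(z)) du' = a / (u - u(z)) du - \<theta> a\<close>. This is the first equality. Inserting it in the
  recursion for \<open>\<iota>\<close> shows that \<open>\<iota> + \<theta> a\<close> satisfies the recursion for \<open>u'\<close>; both operators vanish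
  on the vacuum of \<open>Q L\<close>, since constants do, and so they agree.\<close>

lemma fconst_0 [simp]: "fconst 0 = (0 :: 'v free)"
  by (simp add: fconst_def)

lemma fconst_1 [simp]: "fconst 1 = (1 :: 'v free)"
  by (simp add: fconst_def flip: zero_list_def)

lemma fconst_add: "fconst (a + b) = (fconst a + fconst b :: 'v free)"
  by (simp add: fconst_def single_add)

lemma fconst_minus: "fconst (- a) = (- fconst a :: 'v free)"
  by (simp add: fconst_def single_uminus)

lemma fconst_mult: "fconst (a * b) = (fconst a * fconst b :: 'v free)"
  by (simp add: fconst_def mult_single plus_list_def)

lemma poly_mapping_sum_single: "(\<Sum>k\<in>Poly_Mapping.keys x. Poly_Mapping.single k (Poly_Mapping.lookup x k)) = x"
  by (rule poly_mapping_eqI)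
    (auto simp: lookup_sum lookup_single when_def not_in_keys_iff_lookup_eq_zero sum.delta')

lemma fconst_times_single: "fconst c * Poly_Mapping.single w d = (Poly_Mapping.single w (c * d) :: 'v free)"
  by (simp add: fconst_def mult_single plus_list_def)

lemma fgen_times_single: "fgen v * Poly_Mapping.single w d = (Poly_Mapping.single (v # w) d :: 'v free)"
  by (simp add: fgen_def mult_single plus_list_def)

lemma fconst_commute: "x * fconst c = fconst c * (x :: 'v free)"
proof -
  have "(\<Sum>k\<in>Poly_Mapping.keys x. Poly_Mapping.single k (Poly_Mapping.lookup x k)) * fconst c
    = fconst c * (\<Sum>k\<in>Poly_Mapping.keys x. Poly_Mapping.single k (Poly_Mapping.lookup x k))"
    unfolding sum_distrib_left sum_distrib_right
    by (rule sum.cong) (simp_all add: fconst_def mult_single plus_list_def mult.commute)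
  then show ?thesis by (simp only: poly_mapping_sum_single)
qed

section \<open>The free algebra on a set\<close>

abbreviation free_carrier :: "'v set \<Rightarrow> 'v free set"
  where "free_carrier L \<equiv> carrier (free_alg L)"

lemma free_carrier_iff: "x \<in> free_carrier L \<longleftrightarrow> Poly_Mapping.keys x \<subseteq> lists L"
  by (simp add: free_alg_def)

lemma free_alg_simps [simp]:
  "mult (free_alg L) = (*)" "one (free_alg L) = 1" "zero (free_alg L) = 0" "add (free_alg L) = (+)"
  by (simp_all add: free_alg_def)

lemma free_carrier_zero [simp, intro]: "0 \<in> free_carrier L"
  by (simp add: free_carrier_iff)

lemma free_carrier_one [simp, intro]: "1 \<in> free_carrier L"
  by (simp add: free_carrier_iff zero_list_def)

lemma free_carrier_add [simp, intro]: "x \<in> free_carrier L \<Longrightarrow> y \<in> free_carrier L \<Longrightarrow> x + y \<in> free_carrier L"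
  using keys_add[of x y] by (auto simp: free_carrier_iff)

lemma free_carrier_uminus [simp, intro]: "x \<in> free_carrier L \<Longrightarrow> - x \<in> free_carrier L"
  by (simp add: free_carrier_iff in_keys_iff subset_eq)

lemma free_carrier_diff [simp, intro]: "x \<in> free_carrier L \<Longrightarrow> y \<in> free_carrier L \<Longrightarrow> x - y \<in> free_carrier L"
  using free_carrier_add[of x L "- y"] by simp

lemma free_carrier_times [simp, intro]: "x \<in> free_carrier L \<Longrightarrow> y \<in> free_carrier L \<Longrightarrow> x * y \<in> free_carrier L"
  using keys_mult[of x y] by (fastforce simp: free_carrier_iff plus_list_def)

lemma free_carrier_fconst [simp, intro]: "fconst c \<in> free_carrier L"
  by (simp add: free_carrier_iff fconst_def)

lemma free_carrier_fgen [simp, intro]: "v \<in> L \<Longrightarrow> fgen v \<in> free_carrier L"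
  by (simp add: free_carrier_iff fgen_def)

lemma free_carrier_mono: "M \<subseteq> L \<Longrightarrow> free_carrier M \<subseteq> free_carrier L"
  using lists_mono[of M L] by (auto simp: free_carrier_iff)

lemma free_carrier_induct [consumes 1, case_names one add scale gen]:
  assumes x: "x \<in> free_carrier L"
    and one: "P 1"
    and add: "\<And>x y. x \<in> free_carrier L \<Longrightarrow> y \<in> free_carrier L \<Longrightarrow> P x \<Longrightarrow> P y \<Longrightarrow> P (x + y)"
    and scale: "\<And>c x. x \<in> free_carrier L \<Longrightarrow> P x \<Longrightarrow> P (fconst c * x)"
    and gen: "\<And>v x. v \<in> L \<Longrightarrow> x \<in> free_carrier L \<Longrightarrow> P x \<Longrightarrow> P (fgen v * x)"
  shows "P x"
proof -
  have word: "P (Poly_Mapping.single w 1) \<and> Poly_Mapping.single w 1 \<in> free_carrier L" if "w \<in> lists L" for w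
    using that
  proof (induction w)
    case Nil
    show ?case using one by (simp flip: zero_list_def)
  next
    case (Cons v w)
    then show ?case
      using gen[of v "Poly_Mapping.single w 1"] free_carrier_times[of "fgen v" L "Poly_Mapping.single w 1"]
      by (simp add: fgen_times_single)
  qed
  have mono: "P (Poly_Mapping.single w c) \<and> Poly_Mapping.single w c \<in> free_carrier L" if "w \<in> lists L" for w c
    using word[OF that] scale[of "Poly_Mapping.single w 1" c]
      free_carrier_times[of "fconst c" L "Poly_Mapping.single w 1"]
    by (simp add: fconst_times_single)
  have "P 0" using scale[of 1 0] one by simp
  have "P (\<Sum>k\<in>K. Poly_Mapping.single k (g k)) \<and> (\<Sum>k\<in>K. Poly_Mapping.single k (g k)) \<in> free_carrier L"
    if "finite K" "K \<subseteq> lists L" for K and g :: "'a list \<Rightarrow> complex"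
    using that
  proof (induction K)
    case empty
    show ?case using \<open>P 0\<close> by simp
  next
    case (insert k K)
    then show ?case using mono[of k "g k"] add by simp
  qed
  from this[of "Poly_Mapping.keys x" "Poly_Mapping.lookup x"] show ?thesis
    using x by (simp add: free_carrier_iff poly_mapping_sum_single)
qed

lemma ring_free_alg: "ring (free_alg L)"
proof (rule ringI)
  show "abelian_group (free_alg L)"
  proof (rule abelian_groupI)
    fix x assume "x \<in> free_carrier L"
    then show "\<exists>y\<in>free_carrier L. y \<oplus>\<^bsub>free_alg L\<^esub> x = \<zero>\<^bsub>free_alg L\<^esub>"
      by (intro bexI[of _ "- x"]) auto
  qed (auto simp: add_ac)
  show "monoid (free_alg L)"
    by unfold_locales (auto simp: mult.assoc)
qed (auto simp: algebra_simps)

lemma free_alg_minus: "x \<in> free_carrier L \<Longrightarrow> \<ominus>\<^bsub>free_alg L\<^esub> x = - x"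
  by (rule abelian_group.minus_equality[OF ring.is_abelian_group[OF ring_free_alg]]) auto

section \<open>Linear extension of maps on words\<close>

definition lin :: "('v list \<Rightarrow> 'w free) \<Rightarrow> 'v free \<Rightarrow> 'w free"
  where "lin g x = (\<Sum>k\<in>Poly_Mapping.keys x. fconst (Poly_Mapping.lookup x k) * g k)"

lemma lin_superset:
  "finite K \<Longrightarrow> Poly_Mapping.keys x \<subseteq> K \<Longrightarrow> lin g x = (\<Sum>k\<in>K. fconst (Poly_Mapping.lookup x k) * g k)"
  unfolding lin_def by (rule sum.mono_neutral_left) (auto simp: in_keys_iff)

lemma lin_add: "lin g (x + y) = lin g x + lin g y"
proof -
  let ?K = "Poly_Mapping.keys x \<union> Poly_Mapping.keys y"
  have "lin g (x + y) = (\<Sum>k\<in>?K. fconst (Poly_Mapping.lookup (x + y) k) * g k)"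
    by (rule lin_superset) (auto simp: keys_add)
  also have "\<dots> = lin g x + lin g y"
    by (simp add: lin_superset[of ?K x] lin_superset[of ?K y] lookup_add fconst_add distrib_right sum.distrib)
  finally show ?thesis .
qed

lemma lin_single: "lin g (Poly_Mapping.single w c) = fconst c * g w"
  by (cases "c = 0") (simp_all add: lin_def)

lemma lin_0 [simp]: "lin g 0 = 0"
  by (simp add: lin_def)

lemma lin_1 [simp]: "lin g 1 = g []"
  using lin_single[of g "[]" 1] by (simp flip: zero_list_def)

lemma free_induct [case_names add single]:
  fixes x :: "'v free"
  assumes "\<And>x y. P x \<Longrightarrow> P y \<Longrightarrow> P (x + y)" "\<And>w c. P (Poly_Mapping.single w c)"
  shows "P x"
proof -
  have "P 0" using assms(2)[of "[]" 0] by simp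
  have "P (\<Sum>k\<in>K. Poly_Mapping.single k (g k))" if "finite K" for K and g :: "'v list \<Rightarrow> complex"
    using that by (induction K) (auto intro: assms \<open>P 0\<close>)
  from this[of "Poly_Mapping.keys x" "Poly_Mapping.lookup x"] show ?thesis
    by (simp add: poly_mapping_sum_single)
qed

lemma lin_fconst: "lin g (fconst c * x) = fconst c * lin g x"
  by (induction x rule: free_induct)
    (simp_all add: distrib_left lin_add fconst_times_single lin_single fconst_mult mult.assoc)

lemma lin_fgen: "lin g (fgen v * x) = lin (\<lambda>w. g (v # w)) x"
  by (induction x rule: free_induct)
    (simp_all add: distrib_left lin_add fgen_times_single lin_single)

lemma lin_fun_add: "lin (\<lambda>w. g w + h w) x = lin g x + lin h x"
  by (simp add: lin_def distrib_left sum.distrib)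

lemma lin_fun_times: "lin (\<lambda>w. a * g w) x = a * lin g x"
proof -
  have "fconst c * (a * b) = a * (fconst c * b)" for c b
    by (metis fconst_commute mult.assoc)
  then show ?thesis by (simp add: lin_def sum_distrib_left)
qed

lemma lin_word: "lin (\<lambda>w. Poly_Mapping.single w 1) x = x"
  by (simp add: lin_def fconst_times_single poly_mapping_sum_single)

lemma lin_comp:
  assumes "\<And>x y. T (x + y) = T x + T y" "\<And>c x. T (fconst c * x) = fconst c * T x"
  shows "lin (\<lambda>w. T (g w)) x = T (lin g x)"
  by (induction x rule: free_induct) (simp_all add: lin_add lin_single assms)

section \<open>The defining ideal of the enveloping algebra\<close>

locale lie_subalgebra =
  fixes L :: "'v::complex_lie_algebra set"
  assumes zero_mem [simp, intro]: "0 \<in> L"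
    and add_mem [simp, intro]: "x \<in> L \<Longrightarrow> y \<in> L \<Longrightarrow> x + y \<in> L"
    and scaleC_mem [simp, intro]: "x \<in> L \<Longrightarrow> c *\<^sub>C x \<in> L"
    and lie_mem [simp, intro]: "x \<in> L \<Longrightarrow> y \<in> L \<Longrightarrow> lie x y \<in> L"
begin

lemma env_rels_subset: "env_rels L \<subseteq> free_carrier L"
  by (auto simp: env_rels_def)

lemma ideal_env_ideal: "ideal (env_ideal L) (free_alg L)"
  unfolding env_ideal_def by (rule ring.genideal_ideal[OF ring_free_alg env_rels_subset])

lemma J_subset: "x \<in> env_ideal L \<Longrightarrow> x \<in> free_carrier L"
  using additive_subgroup.a_subset[OF ideal.axioms(1)[OF ideal_env_ideal]] by auto

lemma J_zero [simp, intro]: "0 \<in> env_ideal L"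
  using additive_subgroup.zero_closed[OF ideal.axioms(1)[OF ideal_env_ideal]] by simp

lemma J_add [intro]: "x \<in> env_ideal L \<Longrightarrow> y \<in> env_ideal L \<Longrightarrow> x + y \<in> env_ideal L"
  using additive_subgroup.a_closed[OF ideal.axioms(1)[OF ideal_env_ideal]] by simp

lemma J_left [intro]: "a \<in> free_carrier L \<Longrightarrow> x \<in> env_ideal L \<Longrightarrow> a * x \<in> env_ideal L"
  using ideal.I_l_closed[OF ideal_env_ideal] by simp

lemma J_right [intro]: "a \<in> free_carrier L \<Longrightarrow> x \<in> env_ideal L \<Longrightarrow> x * a \<in> env_ideal L"
  using ideal.I_r_closed[OF ideal_env_ideal] by simp

lemma J_uminus [intro]: "x \<in> env_ideal L \<Longrightarrow> - x \<in> env_ideal L"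
  using J_left[of "fconst (-1)" x] by (simp add: fconst_minus)

lemma J_diff [intro]: "x \<in> env_ideal L \<Longrightarrow> y \<in> env_ideal L \<Longrightarrow> x - y \<in> env_ideal L"
  using J_add[of x "- y"] by auto

lemma J_rel: "r \<in> env_rels L \<Longrightarrow> r \<in> env_ideal L"
  unfolding env_ideal_def using ring.genideal_self[OF ring_free_alg env_rels_subset] by auto

lemma J_gen_add: "x \<in> L \<Longrightarrow> y \<in> L \<Longrightarrow> fgen (x + y) - fgen x - fgen y \<in> env_ideal L"
  by (rule J_rel, unfold env_rels_def, blast)

lemma J_gen_scaleC: "x \<in> L \<Longrightarrow> fgen (c *\<^sub>C x) - fconst c * fgen x \<in> env_ideal L"
  by (rule J_rel, unfold env_rels_def, blast)

lemma J_gen_lie: "x \<in> L \<Longrightarrow> y \<in> L \<Longrightarrow> fgen x * fgen y - fgen y * fgen x - fgen (lie x y) \<in> env_ideal L"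
  by (rule J_rel, unfold env_rels_def, blast)

lemma J_gen_zero: "fgen 0 \<in> env_ideal L"
  using J_uminus[OF J_gen_add[of 0 0]] by simp

lemma env_ideal_induct [consumes 1, case_names add rel]:
  assumes x: "x \<in> env_ideal L"
    and add: "\<And>x y. P x \<Longrightarrow> P y \<Longrightarrow> P (x + y)"
    and rel: "\<And>a b r. a \<in> free_carrier L \<Longrightarrow> b \<in> free_carrier L \<Longrightarrow> r \<in> env_rels L \<Longrightarrow> P (a * r * b)"
  shows "P x"
proof -
  let ?S = "{x \<in> free_carrier L. \<forall>a\<in>free_carrier L. \<forall>b\<in>free_carrier L. P (a * x * b)}"
  have "fgen (0 + 0) - fgen 0 - fgen 0 \<in> env_rels L"
    unfolding env_rels_def using zero_mem by blast
  then have P0: "P 0" using rel[of 0 0] by force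
  have "ideal ?S (free_alg L)"
  proof (rule idealI[OF ring_free_alg])
    show "subgroup ?S (add_monoid (free_alg L))"
    proof (rule group.subgroupI)
      show "Group.group (add_monoid (free_alg L))"
        by (rule abelian_group.a_group[OF ring.is_abelian_group[OF ring_free_alg]])
      show "?S \<noteq> {}" using P0 by (auto intro!: exI[of _ 0])
    next
      fix x assume x: "x \<in> ?S"
      have "P (a * (- x) * b)" if "a \<in> free_carrier L" "b \<in> free_carrier L" for a b
      proof -
        have "P ((- a) * x * b)" using x that free_carrier_uminus[of a L] by blast
        then show ?thesis by simp
      qed
      then show "inv\<^bsub>add_monoid (free_alg L)\<^esub> x \<in> ?S"
        using x free_alg_minus[of x L] by (simp add: a_inv_def)
    next
      fix x y assume "x \<in> ?S" "y \<in> ?S"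
      then show "x \<otimes>\<^bsub>add_monoid (free_alg L)\<^esub> y \<in> ?S"
        by (auto simp: distrib_left distrib_right intro: add)
    qed auto
  next
    fix x a assume "x \<in> ?S" "a \<in> free_carrier L"
    moreover from this have "P ((b * a) * x * c)" "P (b * x * (a * c))"
      if "b \<in> free_carrier L" "c \<in> free_carrier L" for b c
      using that free_carrier_times by blast+
    ultimately show "a \<otimes>\<^bsub>free_alg L\<^esub> x \<in> ?S" "x \<otimes>\<^bsub>free_alg L\<^esub> a \<in> ?S"
      by (auto simp: mult.assoc)
  qed
  moreover have "env_rels L \<subseteq> ?S" using env_rels_subset rel by auto
  ultimately have "env_ideal L \<subseteq> ?S"
    unfolding env_ideal_def by (rule ring.genideal_minimal[OF ring_free_alg])
  then have "P (1 * x * 1)" using x free_carrier_one by blast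
  then show ?thesis by simp
qed

lemma env_rels_cases [consumes 1, case_names add scaleC lie]:
  assumes "r \<in> env_rels L"
  obtains x y where "x \<in> L" "y \<in> L" "r = fgen (x + y) - fgen x - fgen y"
  | c x where "x \<in> L" "r = fgen (c *\<^sub>C x) - fconst c * fgen x"
  | x y where "x \<in> L" "y \<in> L" "r = fgen x * fgen y - fgen y * fgen x - fgen (lie x y)"
  using assms unfolding env_rels_def by blast

end

lemma env_ideal_mono:
  assumes "lie_subalgebra M" "lie_subalgebra L" "M \<subseteq> L"
  shows "env_ideal M \<subseteq> env_ideal L"
proof
  interpret M: lie_subalgebra M by fact
  interpret L: lie_subalgebra L by fact
  fix x assume "x \<in> env_ideal M"
  then show "x \<in> env_ideal L"
  proof (induction rule: M.env_ideal_induct)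
    case (rel a b r)
    have "r \<in> env_rels L" using rel(3) \<open>M \<subseteq> L\<close> unfolding env_rels_def by blast
    then show ?case using rel free_carrier_mono[OF \<open>M \<subseteq> L\<close>] by (blast intro: L.J_rel)
  qed auto
qed

section \<open>Twisted derivations\<close>

text \<open>The operators \<open>D a\<close> with \<open>D a 1 = 0\<close> and \<open>[D a, v] = E a v + f a v + D (m a v)\<close>. With \<open>m = 0\<close>
  and \<open>f = 0\<close> they are derivations; the recursion for \<open>\<iota>\<close> is another instance. The conditions
  \<open>E_lie\<close>, \<open>f_lie\<close> and \<open>m_lie\<close> below express that both sides of the recursion are compatible with
  the relation \<open>v w - w v = lie v w\<close>.\<close>

primrec twisted_word :: "('a \<Rightarrow> 'v \<Rightarrow> 'v) \<Rightarrow> ('a \<Rightarrow> 'v \<Rightarrow> complex) \<Rightarrow> ('a \<Rightarrow> 'v \<Rightarrow> 'a) \<Rightarrow>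
    'v list \<Rightarrow> 'a \<Rightarrow> 'v free"
  where "twisted_word E f m [] = (\<lambda>a. 0)"
  | "twisted_word E f m (v # w) = (\<lambda>a. fgen v * twisted_word E f m w a
      + (fgen (E a v) + fconst (f a v)) * Poly_Mapping.single w 1 + twisted_word E f m w (m a v))"

definition twisted :: "('a \<Rightarrow> 'v \<Rightarrow> 'v) \<Rightarrow> ('a \<Rightarrow> 'v \<Rightarrow> complex) \<Rightarrow> ('a \<Rightarrow> 'v \<Rightarrow> 'a) \<Rightarrow>
    'a \<Rightarrow> 'v free \<Rightarrow> 'v free"
  where "twisted E f m a = lin (\<lambda>w. twisted_word E f m w a)"

lemma twisted_one [simp]: "twisted E f m a 1 = 0"
  and twisted_zero [simp]: "twisted E f m a 0 = 0"
  and twisted_add: "twisted E f m a (x + y) = twisted E f m a x + twisted E f m a y"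
  and twisted_fconst: "twisted E f m a (fconst c * x) = fconst c * twisted E f m a x"
  by (simp_all add: twisted_def lin_add lin_fconst)

lemma twisted_gen: "twisted E f m a (fgen v * x) =
    fgen v * twisted E f m a x + fgen (E a v) * x + fconst (f a v) * x + twisted E f m (m a v) x"
  by (simp add: twisted_def lin_fgen lin_fun_add lin_fun_times lin_word distrib_right add.assoc)

lemma twisted_diff: "twisted E f m a (x - y) = twisted E f m a x - twisted E f m a y"
  using twisted_add[of E f m a "x - y" y] by simp

locale twisted_derivation = lie_subalgebra L for L :: "'v::complex_lie_algebra set" +
  fixes E :: "'a::complex_lie_algebra \<Rightarrow> 'v \<Rightarrow> 'v" and f :: "'a \<Rightarrow> 'v \<Rightarrow> complex" and m :: "'a \<Rightarrow> 'v \<Rightarrow> 'a"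
  assumes E_mem: "v \<in> L \<Longrightarrow> E a v \<in> L"
    and E_add: "v \<in> L \<Longrightarrow> w \<in> L \<Longrightarrow> E a (v + w) = E a v + E a w"
    and f_add: "v \<in> L \<Longrightarrow> w \<in> L \<Longrightarrow> f a (v + w) = f a v + f a w"
    and m_add: "v \<in> L \<Longrightarrow> w \<in> L \<Longrightarrow> m a (v + w) = m a v + m a w"
    and E_scaleC: "v \<in> L \<Longrightarrow> E a (c *\<^sub>C v) = c *\<^sub>C E a v"
    and f_scaleC: "v \<in> L \<Longrightarrow> f a (c *\<^sub>C v) = c * f a v"
    and m_scaleC: "v \<in> L \<Longrightarrow> m a (c *\<^sub>C v) = c *\<^sub>C m a v"
    and E_add_left: "v \<in> L \<Longrightarrow> E (a + b) v = E a v + E b v"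
    and f_add_left: "v \<in> L \<Longrightarrow> f (a + b) v = f a v + f b v"
    and m_add_left: "v \<in> L \<Longrightarrow> m (a + b) v = m a v + m b v"
    and E_scaleC_left: "v \<in> L \<Longrightarrow> E (c *\<^sub>C a) v = c *\<^sub>C E a v"
    and f_scaleC_left: "v \<in> L \<Longrightarrow> f (c *\<^sub>C a) v = c * f a v"
    and m_scaleC_left: "v \<in> L \<Longrightarrow> m (c *\<^sub>C a) v = c *\<^sub>C m a v"
    and E_lie: "v \<in> L \<Longrightarrow> w \<in> L \<Longrightarrow>
      E a (lie v w) + E (m a w) v = lie (E a v) w + lie v (E a w) + E (m a v) w"
    and f_lie: "v \<in> L \<Longrightarrow> w \<in> L \<Longrightarrow> f a (lie v w) = f (m a v) w - f (m a w) v"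
    and m_lie: "v \<in> L \<Longrightarrow> w \<in> L \<Longrightarrow> m a (lie v w) + m (m a w) v = m (m a v) w"
begin

abbreviation D where "D \<equiv> twisted E f m"

lemma D_mem [simp]: "x \<in> free_carrier L \<Longrightarrow> D a x \<in> free_carrier L"
  by (induction x arbitrary: a rule: free_carrier_induct)
    (auto simp: twisted_add twisted_fconst twisted_gen E_mem)

lemma D_add_left: "x \<in> free_carrier L \<Longrightarrow> D (a + b) x - D a x - D b x \<in> env_ideal L"
proof (induction x arbitrary: a b rule: free_carrier_induct)
  case one
  show ?case by simp
next
  case (add x y)
  have "D (a + b) (x + y) - D a (x + y) - D b (x + y)
    = (D (a + b) x - D a x - D b x) + (D (a + b) y - D a y - D b y)"
    by (simp add: twisted_add)
  then show ?case using add by auto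
next
  case (scale c x)
  have "D (a + b) (fconst c * x) - D a (fconst c * x) - D b (fconst c * x)
    = fconst c * (D (a + b) x - D a x - D b x)"
    by (simp add: twisted_fconst algebra_simps)
  then show ?case using scale by auto
next
  case (gen v x)
  have "D (a + b) (fgen v * x) - D a (fgen v * x) - D b (fgen v * x)
    = fgen v * (D (a + b) x - D a x - D b x) + (fgen (E a v + E b v) - fgen (E a v) - fgen (E b v)) * x
      + (D (m a v + m b v) x - D (m a v) x - D (m b v) x)"
    by (simp add: twisted_gen E_add_left f_add_left m_add_left gen fconst_add algebra_simps)
  moreover have "\<dots> \<in> env_ideal L"
    using gen by (intro J_add J_left J_right J_gen_add E_mem) auto
  ultimately show ?case by simp
qed

lemma D_scaleC_left: "x \<in> free_carrier L \<Longrightarrow> D (c *\<^sub>C a) x - fconst c * D a x \<in> env_ideal L"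
proof (induction x arbitrary: a rule: free_carrier_induct)
  case one
  show ?case by simp
next
  case (add x y)
  have "D (c *\<^sub>C a) (x + y) - fconst c * D a (x + y)
    = (D (c *\<^sub>C a) x - fconst c * D a x) + (D (c *\<^sub>C a) y - fconst c * D a y)"
    by (simp add: twisted_add algebra_simps)
  then show ?case using add by auto
next
  case (scale d x)
  have "D (c *\<^sub>C a) (fconst d * x) - fconst c * D a (fconst d * x)
    = fconst d * (D (c *\<^sub>C a) x - fconst c * D a x)"
    by (simp add: twisted_fconst right_diff_distrib flip: mult.assoc)
      (simp add: fconst_mult[symmetric] mult.commute)
  then show ?case using scale by auto
next
  case (gen v x)
  have "fgen v * (fconst c * y) = fconst c * (fgen v * y)" for y :: "'v free"
    by (metis fconst_commute mult.assoc)
  then have "D (c *\<^sub>C a) (fgen v * x) - fconst c * D a (fgen v * x)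
    = fgen v * (D (c *\<^sub>C a) x - fconst c * D a x) + (fgen (c *\<^sub>C E a v) - fconst c * fgen (E a v)) * x
      + (D (c *\<^sub>C m a v) x - fconst c * D (m a v) x)"
    by (simp add: twisted_gen E_scaleC_left f_scaleC_left m_scaleC_left gen fconst_mult algebra_simps)
  moreover have "\<dots> \<in> env_ideal L"
    using gen by (intro J_add J_left J_right J_gen_scaleC E_mem) auto
  ultimately show ?case by simp
qed

lemma D_rel:
  assumes "r \<in> env_rels L" and y: "y \<in> free_carrier L"
  shows "D a (r * y) \<in> env_ideal L"
  using assms(1)
proof (cases rule: env_rels_cases)
  case (add v w)
  have "D a (r * y) = r * D a y + (fgen (E a v + E a w) - fgen (E a v) - fgen (E a w)) * y
      + (D (m a v + m a w) y - D (m a v) y - D (m a w) y)"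
    unfolding add(3) using add(1,2)
    by (simp add: left_diff_distrib twisted_diff twisted_add twisted_gen E_add f_add m_add fconst_add algebra_simps)
  moreover have "\<dots> \<in> env_ideal L"
    using add assms by (intro J_add J_right J_gen_add E_mem D_add_left J_rel) auto
  ultimately show ?thesis by simp
next
  case (scaleC c v)
  have comm: "fgen v * (fconst c * y) = fconst c * (fgen v * y)" for y :: "'v free"
    by (metis fconst_commute mult.assoc)
  have "D a (r * y) = r * D a y + (fgen (c *\<^sub>C E a v) - fconst c * fgen (E a v)) * y
      + (D (c *\<^sub>C m a v) y - fconst c * D (m a v) y)"
    unfolding scaleC(2) using scaleC(1)
    by (simp add: left_diff_distrib mult.assoc twisted_diff twisted_fconst twisted_gen
        E_scaleC f_scaleC m_scaleC fconst_mult algebra_simps comm)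
  moreover have "\<dots> \<in> env_ideal L"
    using scaleC assms by (intro J_add J_right J_gen_scaleC E_mem D_scaleC_left J_rel) auto
  ultimately show ?thesis by simp
next
  case (lie v w)
  have comm: "fgen v * (fconst c * y) = fconst c * (fgen v * y)" for v c and y :: "'v free"
    by (metis fconst_commute mult.assoc)
  define S where "S = E a (lie v w) + E (m a w) v"
  note mem = E_mem[of v] E_mem[of w] E_mem[OF lie_mem, of v w]
  have comb: "\<lbrakk>s1 \<in> env_ideal L; s2 \<in> env_ideal L; s3 \<in> env_ideal L; l1 \<in> env_ideal L; l2 \<in> env_ideal L;
      d \<in> env_ideal L; e \<in> env_ideal L\<rbrakk> \<Longrightarrow> e + (s1 - s2 - s3 + l1 + l2) * y + d \<in> env_ideal L"
    for s1 s2 s3 l1 l2 d e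
    using y by (intro J_add J_diff J_right)
  have "fgen S - fgen (E a (lie v w)) - fgen (E (m a w) v) \<in> env_ideal L" (is "?s1 \<in> _")
    unfolding S_def using lie mem by (intro J_gen_add) auto
  moreover have "fgen S - fgen (lie (E a v) w + lie v (E a w)) - fgen (E (m a v) w) \<in> env_ideal L" (is "?s2 \<in> _")
    unfolding S_def E_lie[OF lie(1,2)] using lie mem by (intro J_gen_add) auto
  moreover have "fgen (lie (E a v) w + lie v (E a w)) - fgen (lie (E a v) w) - fgen (lie v (E a w)) \<in> env_ideal L" (is "?s3 \<in> _")
    using lie mem by (intro J_gen_add) auto
  moreover have "fgen (E a v) * fgen w - fgen w * fgen (E a v) - fgen (lie (E a v) w) \<in> env_ideal L" (is "?l1 \<in> _")
    using lie mem by (intro J_gen_lie) auto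
  moreover have "fgen v * fgen (E a w) - fgen (E a w) * fgen v - fgen (lie v (E a w)) \<in> env_ideal L" (is "?l2 \<in> _")
    using lie mem by (intro J_gen_lie) auto
  moreover have "D (m a (lie v w) + m (m a w) v) y - D (m a (lie v w)) y - D (m (m a w) v) y \<in> env_ideal L" (is "?d \<in> _")
    by (rule D_add_left[OF y])
  moreover have "r * D a y \<in> env_ideal L" using assms by (blast intro: J_rel D_mem J_right)
  ultimately have *: "r * D a y + (?s1 - ?s2 - ?s3 + ?l1 + ?l2) * y + ?d \<in> env_ideal L"
    by (rule comb)
  have f: "fconst (f a (lie v w)) = fconst (f (m a v) w) - (fconst (f (m a w) v) :: 'v free)"
    using f_lie[OF lie(1,2), of a] fconst_add[of "f (m a v) w" "- f (m a w) v"] by (simp add: fconst_minus)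
  have "D a (r * y) = r * D a y + (?s1 - ?s2 - ?s3 + ?l1 + ?l2) * y + ?d"
    unfolding m_lie[OF lie(1,2)]
    by (simp add: lie(3) left_diff_distrib mult.assoc twisted_diff twisted_gen twisted_add twisted_fconst f comm algebra_simps)
  then show ?thesis using * by simp
qed

lemma D_J: "x \<in> env_ideal L \<Longrightarrow> D a x \<in> env_ideal L"
proof (induction x arbitrary: a rule: env_ideal_induct)
  case (add x y)
  then show ?case by (auto simp: twisted_add)
next
  case (rel x b r)
  have "x \<in> free_carrier L \<Longrightarrow> D a (x * (r * b)) \<in> env_ideal L" for a
  proof (induction x arbitrary: a rule: free_carrier_induct)
    case one
    then show ?case using rel D_rel by simp
  next
    case (gen v x)
    define y where "y = x * (r * b)"
    have "y \<in> env_ideal L" unfolding y_def using rel gen by (blast intro: J_rel J_right J_left)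
    moreover have "D a y \<in> env_ideal L" for a unfolding y_def using gen by blast
    ultimately have "D a (fgen v * y) \<in> env_ideal L"
      using gen E_mem[of v] unfolding twisted_gen by (intro J_add J_left) auto
    then show ?case by (simp add: y_def mult.assoc)
  qed (auto simp: distrib_right twisted_add mult.assoc twisted_fconst)
  then show ?case using rel by (simp add: mult.assoc)
qed

end

section \<open>Enveloping algebras and their quotients by the constants\<close>

context lie_subalgebra
begin

lemma ucls_eq: "ucls L x = {y. y - x \<in> env_ideal L}"
proof -
  have "y \<in> ucls L x \<longleftrightarrow> y - x \<in> env_ideal L" for y
    unfolding ucls_def a_r_coset_def' by (auto simp: algebra_simps intro!: bexI[of _ "y - x"])
  then show ?thesis by auto
qed

lemma ucls_eq_iff: "ucls L x = ucls L y \<longleftrightarrow> x - y \<in> env_ideal L"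
proof
  assume "ucls L x = ucls L y"
  moreover have "x \<in> ucls L x" by (simp add: ucls_eq)
  ultimately show "x - y \<in> env_ideal L" by (simp add: ucls_eq)
next
  assume *: "x - y \<in> env_ideal L"
  show "ucls L x = ucls L y"
    unfolding ucls_eq
    using J_add[OF _ *] J_diff[OF _ *] by (fastforce simp: algebra_simps)
qed

lemma ring_U: "ring (U L)"
  unfolding U_def by (rule ideal.quotient_is_ring[OF ideal_env_ideal])

lemma ucls_hom: "ucls L \<in> ring_hom (free_alg L) (U L)"
  using ideal.rcos_ring_hom[OF ideal_env_ideal] by (simp add: U_def ucls_def[abs_def])

lemma ucls_closed [simp, intro]: "x \<in> free_carrier L \<Longrightarrow> ucls L x \<in> carrier (U L)"
  using ring_hom_closed[OF ucls_hom] .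

lemma ucls_mult [simp]: "x \<in> free_carrier L \<Longrightarrow> y \<in> free_carrier L \<Longrightarrow>
    ucls L x \<otimes>\<^bsub>U L\<^esub> ucls L y = ucls L (x * y)"
  using ring_hom_mult[OF ucls_hom] by simp

lemma ucls_add [simp]: "x \<in> free_carrier L \<Longrightarrow> y \<in> free_carrier L \<Longrightarrow>
    ucls L x \<oplus>\<^bsub>U L\<^esub> ucls L y = ucls L (x + y)"
  using ring_hom_add[OF ucls_hom] by simp

lemma one_U: "\<one>\<^bsub>U L\<^esub> = ucls L 1"
  using ring_hom_one[OF ucls_hom] by simp

lemma zero_U: "\<zero>\<^bsub>U L\<^esub> = ucls L 0"
  using ring_hom_zero[OF ucls_hom ring_free_alg ring_U] by simp

lemma ucls_uminus [simp]: "x \<in> free_carrier L \<Longrightarrow> \<ominus>\<^bsub>U L\<^esub> ucls L x = ucls L (- x)"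
  by (rule abelian_group.minus_equality[OF ring.is_abelian_group[OF ring_U]]) (auto simp: zero_U)

lemma ucls_minus [simp]: "x \<in> free_carrier L \<Longrightarrow> y \<in> free_carrier L \<Longrightarrow>
    ucls L x \<ominus>\<^bsub>U L\<^esub> ucls L y = ucls L (x - y)"
  by (simp add: a_minus_def)

lemma carrier_U: "carrier (U L) = ucls L ` free_carrier L"
  unfolding U_def ucls_def by (auto simp: FactRing_def A_RCOSETS_def')

lemma uincl_ucls:
  assumes "lie_subalgebra M" "M \<subseteq> L"
  shows "uincl L (ucls M x) = ucls L x"
proof -
  interpret M: lie_subalgebra M by fact
  have *: "env_ideal M \<subseteq> env_ideal L" by (rule env_ideal_mono[OF assms(1) lie_subalgebra_axioms assms(2)])
  have "y \<in> uincl L (ucls M x) \<longleftrightarrow> y - x \<in> env_ideal L" for y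
  proof
    assume "y \<in> uincl L (ucls M x)"
    then obtain j k where "j \<in> env_ideal L" "k - x \<in> env_ideal M" "y = j + k"
      by (auto simp: uincl_def set_add_def' M.ucls_eq)
    then have "j + (k - x) \<in> env_ideal L" using * by blast
    then show "y - x \<in> env_ideal L" using \<open>y = j + k\<close> by (simp add: algebra_simps)
  next
    assume "y - x \<in> env_ideal L"
    then show "y \<in> uincl L (ucls M x)"
      by (auto simp: uincl_def set_add_def' M.ucls_eq intro!: bexI[of _ "y - x"] exI[of _ x])
  qed
  then show ?thesis by (auto simp: ucls_eq)
qed

end

lemma lie_subalgebra_const_maps: "lie_subalgebra (const_maps :: 'a::complex_lie_algebra mer set)"
proof
  show "0 \<in> (const_maps :: 'a mer set)"
    unfolding const_maps_def by (rule range_eqI[of _ _ 0]) (transfer, simp)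
  fix x y :: "'a mer" and c
  assume "x \<in> const_maps" "y \<in> const_maps"
  then obtain a b where ab: "x = mconst a" "y = mconst b" by (auto simp: const_maps_def)
  show "x + y \<in> const_maps"
    unfolding ab const_maps_def by (rule range_eqI[of _ _ "a + b"]) (transfer, simp)
  show "lie x y \<in> const_maps"
    unfolding ab const_maps_def by (rule range_eqI[of _ _ "lie a b"]) (transfer, simp)
  show "c *\<^sub>C x \<in> const_maps"
    unfolding ab const_maps_def by (rule range_eqI[of _ _ "c *\<^sub>C a"]) (transfer, simp)
qed

definition aug_null :: "'a::complex_lie_algebra mer set \<Rightarrow> 'a mer free set"
  where "aug_null L = {x \<in> free_carrier L. ucls L x \<in> aug_left L}"

definition qcls :: "'a::complex_lie_algebra mer set \<Rightarrow> 'a mer free \<Rightarrow> 'a mer free set set"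
  where "qcls L x = aug_left L +>\<^bsub>U L\<^esub> ucls L x"

locale const_subalgebra = lie_subalgebra L for L :: "'a::complex_lie_algebra mer set" +
  assumes const_subset: "const_maps \<subseteq> L"
begin

lemma mconst_mem [simp, intro]: "mconst c \<in> L"
  using const_subset by (auto simp: const_maps_def)

lemma uincl_aug_subset: "uincl L ` aug_ideal const_maps \<subseteq> carrier (U L)"
  using free_carrier_mono[OF const_subset]
  by (auto simp: aug_ideal_def uincl_ucls[OF lie_subalgebra_const_maps const_subset])

lemma aug_left_least:
  assumes "additive_subgroup S (U L)" "\<And>r x. r \<in> carrier (U L) \<Longrightarrow> x \<in> S \<Longrightarrow> r \<otimes>\<^bsub>U L\<^esub> x \<in> S"
    "uincl L ` aug_ideal const_maps \<subseteq> S"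
  shows "aug_left L \<subseteq> S"
  unfolding aug_left_def gen_left_ideal_def using assms by blast

lemma carrier_additive_subgroup: "additive_subgroup (carrier (U L)) (U L)"
  by (rule ideal.axioms(1)[OF ring.oneideal[OF ring_U]])

lemma aug_left_subset: "aug_left L \<subseteq> carrier (U L)"
  by (rule aug_left_least)
    (use carrier_additive_subgroup uincl_aug_subset ring.ring_simprules(5)[OF ring_U] in auto)

lemma aug_left_mult: "r \<in> carrier (U L) \<Longrightarrow> x \<in> aug_left L \<Longrightarrow> r \<otimes>\<^bsub>U L\<^esub> x \<in> aug_left L"
  unfolding aug_left_def gen_left_ideal_def by blast

lemma aug_left_gen: "uincl L ` aug_ideal const_maps \<subseteq> aug_left L"
  unfolding aug_left_def gen_left_ideal_def by blast

lemma aug_left_add: "x \<in> aug_left L \<Longrightarrow> y \<in> aug_left L \<Longrightarrow> x \<oplus>\<^bsub>U L\<^esub> y \<in> aug_left L"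
  unfolding aug_left_def gen_left_ideal_def by (auto intro: additive_subgroup.a_closed)

lemma aug_left_zero: "\<zero>\<^bsub>U L\<^esub> \<in> aug_left L"
  unfolding aug_left_def gen_left_ideal_def by (auto intro: additive_subgroup.zero_closed)

abbreviation N where "N \<equiv> aug_null L"

lemma N_subset: "x \<in> N \<Longrightarrow> x \<in> free_carrier L"
  by (simp add: aug_null_def)

lemma N_add [intro]: "x \<in> N \<Longrightarrow> y \<in> N \<Longrightarrow> x + y \<in> N"
  using aug_left_add by (fastforce simp: aug_null_def)

lemma N_left [intro]: "a \<in> free_carrier L \<Longrightarrow> x \<in> N \<Longrightarrow> a * x \<in> N"
  using aug_left_mult by (fastforce simp: aug_null_def)

lemma N_uminus [intro]: "x \<in> N \<Longrightarrow> - x \<in> N"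
  using N_left[of "fconst (-1)" x] by (simp add: fconst_minus)

lemma N_diff [intro]: "x \<in> N \<Longrightarrow> y \<in> N \<Longrightarrow> x - y \<in> N"
  using N_add[of x "- y"] by auto

lemma N_J: "x \<in> env_ideal L \<Longrightarrow> x \<in> N"
  using aug_left_zero ucls_eq_iff[of x 0] by (auto simp: aug_null_def zero_U J_subset)

lemma N_zero [simp, intro]: "0 \<in> N"
  by (simp add: N_J)

lemma N_const: "fgen (mconst c) \<in> N"
proof -
  have "fgen (mconst c) \<in> free_carrier const_maps" by (auto simp: const_maps_def)
  moreover have "Poly_Mapping.lookup (fgen (mconst c)) [] = 0" by (simp add: fgen_def lookup_single)
  ultimately have "ucls const_maps (fgen (mconst c)) \<in> aug_ideal const_maps"
    unfolding aug_ideal_def by blast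
  then have "ucls L (fgen (mconst c)) \<in> aug_left L"
    using aug_left_gen uincl_ucls[OF lie_subalgebra_const_maps const_subset] by force
  then show ?thesis by (auto simp: aug_null_def)
qed

lemma aug_null_induct [consumes 1, case_names add ideal const]:
  assumes x: "x \<in> N"
    and add: "\<And>x y. x \<in> free_carrier L \<Longrightarrow> y \<in> free_carrier L \<Longrightarrow> P x \<Longrightarrow> P y \<Longrightarrow> P (x + y)"
    and ideal: "\<And>x. x \<in> env_ideal L \<Longrightarrow> P x"
    and const: "\<And>a c. a \<in> free_carrier L \<Longrightarrow> P (a * fgen (mconst c))"
  shows "P x"
proof -
  define K where "K = {x \<in> free_carrier L. \<forall>a\<in>free_carrier L. P (a * x)}"
  have KF: "K \<subseteq> free_carrier L" by (auto simp: K_def)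
  have K_J: "x \<in> K" if "x \<in> env_ideal L" for x
    using that J_left ideal by (auto simp: K_def J_subset)
  have K_add: "x + y \<in> K" if "x \<in> K" "y \<in> K" for x y
    using that by (auto simp: K_def distrib_left intro!: add)
  have K_left: "a * x \<in> K" if "a \<in> free_carrier L" "x \<in> K" for a x
    using that by (auto simp: K_def simp flip: mult.assoc)
  have "additive_subgroup (ucls L ` K) (U L)"
  proof (rule additive_subgroup.intro, rule group.subgroupI)
    show "Group.group (add_monoid (U L))"
      by (rule abelian_group.a_group[OF ring.is_abelian_group[OF ring_U]])
    show "ucls L ` K \<noteq> {}" using K_J[OF J_zero] by blast
  next
    fix X assume "X \<in> ucls L ` K"
    then obtain x where x: "x \<in> K" "X = ucls L x" by blast
    then have "\<ominus>\<^bsub>U L\<^esub> X = ucls L (fconst (-1) * x)"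
      using KF by (auto simp: fconst_minus)
    then show "inv\<^bsub>add_monoid (U L)\<^esub> X \<in> ucls L ` K"
      using K_left[of "fconst (-1)" x] x(1) by (auto simp: a_inv_def)
  next
    fix X Y assume "X \<in> ucls L ` K" "Y \<in> ucls L ` K"
    then show "X \<otimes>\<^bsub>add_monoid (U L)\<^esub> Y \<in> ucls L ` K"
      using KF K_add by (auto simp: subset_eq)
  qed (use KF in auto)
  moreover have "r \<otimes>\<^bsub>U L\<^esub> X \<in> ucls L ` K" if "r \<in> carrier (U L)" "X \<in> ucls L ` K" for r X
    using that KF K_left by (auto simp: carrier_U subset_eq)
  moreover have "uincl L ` aug_ideal const_maps \<subseteq> ucls L ` K"
  proof
    fix X assume "X \<in> uincl L ` aug_ideal const_maps"
    then obtain x where x: "x \<in> free_carrier const_maps" "Poly_Mapping.lookup x [] = 0" "X = ucls L x"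
      by (auto simp: aug_ideal_def uincl_ucls[OF lie_subalgebra_const_maps const_subset])
    have K_single: "Poly_Mapping.single k c \<in> K" if *: "k \<in> lists const_maps" "k \<noteq> []" for k c
    proof -
      obtain w v where k: "k = w @ [v]" using *(2) by (cases k rule: rev_cases) auto
      with * obtain b where b: "v = mconst b" "w \<in> lists const_maps" by (auto simp: const_maps_def)
      have "Poly_Mapping.single w c \<in> free_carrier L"
        using b(2) lists_mono[OF const_subset] by (auto simp: free_carrier_iff)
      moreover have "fgen (mconst b) \<in> K"
        using const by (auto simp: K_def)
      ultimately have "Poly_Mapping.single w c * fgen (mconst b) \<in> K"
        by (rule K_left)
      then show ?thesis by (simp add: k b fgen_def mult_single plus_list_def)
    qed
    have keys_x: "Poly_Mapping.keys x \<subseteq> lists const_maps - {[]}"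
      using x by (auto simp: free_carrier_iff in_keys_iff)
    have "(\<Sum>k\<in>A. Poly_Mapping.single k (Poly_Mapping.lookup x k)) \<in> K"
      if "finite A" "A \<subseteq> Poly_Mapping.keys x" for A
      using that
    proof (induction A)
      case (insert k A)
      then show ?case using K_single[of k] keys_x K_add by auto
    qed (simp add: K_J)
    then have "x \<in> K"
      using poly_mapping_sum_single[of x] by (metis finite_keys order_refl)
    then show "X \<in> ucls L ` K" using x(3) by blast
  qed
  ultimately have "aug_left L \<subseteq> ucls L ` K" by (rule aug_left_least)
  then obtain y where y: "y \<in> K" "ucls L x = ucls L y"
    using x by (auto simp: aug_null_def)
  then have "(x - y) + y \<in> K" using ucls_eq_iff K_J K_add by blast
  then have "P (1 * x)" unfolding K_def using free_carrier_one by (metis (lifting) diff_add_cancel mem_Collect_eq)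
  then show ?thesis by simp
qed

lemma aug_left_eq: "aug_left L = ucls L ` N"
  using aug_left_subset by (auto simp: aug_null_def carrier_U)

lemma abelian_subgroup_aug_left: "abelian_subgroup (aug_left L) (U L)"
proof (rule abelian_subgroupI3)
  show "abelian_group (U L)" by (rule ring.is_abelian_group[OF ring_U])
  show "additive_subgroup (aug_left L) (U L)"
  proof (rule additive_subgroup.intro, rule group.subgroupI)
    show "Group.group (add_monoid (U L))"
      by (rule abelian_group.a_group[OF ring.is_abelian_group[OF ring_U]])
    show "aug_left L \<noteq> {}" using aug_left_zero by blast
    fix X assume "X \<in> aug_left L"
    then obtain x where x: "x \<in> N" "X = ucls L x" by (auto simp: aug_left_eq)
    then have "\<ominus>\<^bsub>U L\<^esub> X = ucls L (- x)" by (simp add: N_subset)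
    then show "inv\<^bsub>add_monoid (U L)\<^esub> X \<in> aug_left L"
      using N_uminus[OF x(1)] by (auto simp: a_inv_def aug_left_eq)
  qed (use aug_left_subset aug_left_add in auto)
qed

lemma qcls_alt: "y \<in> free_carrier L \<Longrightarrow> qcls L y = (\<lambda>n. ucls L (n + y)) ` N"
  unfolding qcls_def a_r_coset_def' by (auto simp: aug_left_eq N_subset)

lemma qcls_eq_iff:
  assumes "x \<in> free_carrier L" "y \<in> free_carrier L"
  shows "qcls L x = qcls L y \<longleftrightarrow> x - y \<in> N"
proof
  assume "qcls L x = qcls L y"
  moreover have "ucls L (0 + x) \<in> qcls L x" using assms by (auto simp only: qcls_alt)
  ultimately obtain n where "n \<in> N" "ucls L (0 + x) = ucls L (n + y)" using assms by (auto simp: qcls_alt)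
  then have "x - (n + y) \<in> N" using N_J by (auto simp: ucls_eq_iff)
  with \<open>n \<in> N\<close> have "n + (x - (n + y)) \<in> N" by (rule N_add)
  then show "x - y \<in> N" by simp
next
  assume *: "x - y \<in> N"
  have "ucls L (n + x) \<in> qcls L y" if "n \<in> N" for n
    using that * assms by (auto simp: qcls_alt intro!: image_eqI[of _ _ "n + (x - y)"])
  moreover have "ucls L (n + y) \<in> qcls L x" if "n \<in> N" for n
    using that * assms by (auto simp: qcls_alt intro!: image_eqI[of _ _ "n - (x - y)"])
  ultimately show "qcls L x = qcls L y" using assms by (auto simp: qcls_alt)
qed

lemma carrier_Q: "carrier (Q L) = qcls L ` free_carrier L"
  by (auto simp: Q_def A_RCOSETS_def' carrier_U qcls_def)

lemma qcls_closed [simp, intro]: "x \<in> free_carrier L \<Longrightarrow> qcls L x \<in> carrier (Q L)"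
  by (simp add: carrier_Q)

lemma qcls_add [simp]: "x \<in> free_carrier L \<Longrightarrow> y \<in> free_carrier L \<Longrightarrow>
    qcls L x \<oplus>\<^bsub>Q L\<^esub> qcls L y = qcls L (x + y)"
  using abelian_subgroup.a_rcos_sum[OF abelian_subgroup_aug_left, of "ucls L x" "ucls L y"]
  by (simp add: Q_def qcls_def)

lemma zero_Q: "\<zero>\<^bsub>Q L\<^esub> = qcls L 0"
  by (simp add: Q_def qcls_alt aug_left_eq)

lemma abelian_group_Q: "abelian_group (Q L)"
proof (rule abelian_groupI)
  fix X assume "X \<in> carrier (Q L)"
  then obtain x where "x \<in> free_carrier L" "X = qcls L x" by (auto simp: carrier_Q)
  then show "\<exists>Y\<in>carrier (Q L). Y \<oplus>\<^bsub>Q L\<^esub> X = \<zero>\<^bsub>Q L\<^esub>"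
    by (intro bexI[of _ "qcls L (- x)"]) (auto simp: zero_Q)
qed (auto simp: carrier_Q zero_Q add_ac)

lemma qcls_uminus [simp]: "x \<in> free_carrier L \<Longrightarrow> \<ominus>\<^bsub>Q L\<^esub> qcls L x = qcls L (- x)"
  by (rule abelian_group.minus_equality[OF abelian_group_Q]) (auto simp: zero_Q)

lemma qcls_minus [simp]: "x \<in> free_carrier L \<Longrightarrow> y \<in> free_carrier L \<Longrightarrow>
    qcls L x \<ominus>\<^bsub>Q L\<^esub> qcls L y = qcls L (x - y)"
  by (simp add: a_minus_def)

lemma qcls_smult [simp]:
  assumes "a \<in> free_carrier L" "y \<in> free_carrier L"
  shows "ucls L a \<odot>\<^bsub>Q L\<^esub> qcls L y = qcls L (a * y)"
proof -
  have "ucls L a \<odot>\<^bsub>Q L\<^esub> qcls L y = (\<Union>n\<in>N. \<Union>k\<in>N. {ucls L (n + a * (k + y))})"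
    using assms by (auto simp: Q_def set_add_def' l_coset_def qcls_alt aug_left_eq N_subset)
  also have "\<dots> = qcls L (a * y)"
  proof -
    have "ucls L (n + a * (k + y)) \<in> qcls L (a * y)" if "n \<in> N" "k \<in> N" for n k
      using that assms by (auto simp: qcls_alt algebra_simps intro!: image_eqI[of _ _ "n + a * k"])
    moreover have "ucls L (n + a * y) \<in> (\<Union>n\<in>N. \<Union>k\<in>N. {ucls L (n + a * (k + y))})" if "n \<in> N" for n
      using that by (intro UN_I[of n] UN_I[of 0]) auto
    ultimately show ?thesis using assms by (auto simp: qcls_alt)
  qed
  finally show ?thesis .
qed

lemma aug_null_mono:
  assumes "const_subalgebra K" "K \<subseteq> L"
  shows "aug_null K \<subseteq> N"
proof
  interpret K: const_subalgebra K by fact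
  fix x assume "x \<in> aug_null K"
  then show "x \<in> N"
  proof (induction rule: K.aug_null_induct)
    case (ideal x)
    then show ?case
      using env_ideal_mono[of K L] assms K.lie_subalgebra_axioms lie_subalgebra_axioms N_J by blast
  next
    case (const a c)
    then show ?case using N_const free_carrier_mono[OF assms(2)] by blast
  qed auto
qed

lemma qincl_qcls [simp]:
  assumes "const_subalgebra K" "K \<subseteq> L" and y: "y \<in> free_carrier K"
  shows "qincl L (qcls K y) = qcls L y"
proof -
  interpret K: const_subalgebra K by fact
  have sub: "k \<in> N" if "k \<in> aug_null K" for k using aug_null_mono[OF assms(1,2)] that by blast
  have y': "y \<in> free_carrier L" using free_carrier_mono[OF assms(2)] y by blast
  have "uincl L ` qcls K y = (\<lambda>k. ucls L (k + y)) ` aug_null K"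
    using y by (simp add: K.qcls_alt image_image uincl_ucls[OF K.lie_subalgebra_axioms assms(2)])
  then have "qincl L (qcls K y) = (\<Union>n\<in>N. \<Union>k\<in>aug_null K. {ucls L (n + (k + y))})"
    using y' sub by (auto simp: qincl_def set_add_def' aug_left_eq N_subset)
  also have "\<dots> = qcls L y"
  proof -
    have "ucls L (n + (k + y)) \<in> qcls L y" if "n \<in> N" "k \<in> aug_null K" for n k
      using that sub y' by (auto simp: qcls_alt algebra_simps intro!: image_eqI[of _ _ "n + k"])
    moreover have "ucls L (n + y) \<in> (\<Union>n\<in>N. \<Union>k\<in>aug_null K. {ucls L (n + (k + y))})" if "n \<in> N" for n
      using that by (intro UN_I[of n] UN_I[of 0]) auto
    ultimately show ?thesis using y' by (auto simp: qcls_alt)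
  qed
  finally show ?thesis .
qed

lemma ident_ucls:
  assumes "lie_subalgebra M" "M \<subseteq> L"
  shows "ident L (ucls M x) = qcls L x"
  by (simp add: ident_def qcls_def uincl_ucls assms)

end

section \<open>Complex Lie algebras\<close>

lemma scaleC_0_right [simp]: "c *\<^sub>C (0 :: 'b::complex_vector) = 0"
  using scaleC_add_right[of c 0 "0 :: 'b"] by simp

lemma scaleC_0_left: "0 *\<^sub>C (x :: 'b::complex_vector) = 0"
  using scaleC_add_left[of 0 0 x] by simp

lemma lie_0_left [simp]: "lie 0 (x :: 'b::complex_lie_algebra) = 0"
  using lie_add_left[of 0 0 x] by simp

lemma lie_0_right [simp]: "lie (x :: 'b::complex_lie_algebra) 0 = 0"
  using lie_add_right[of x 0 0] by simp

lemma scaleC_minus1: "(-1) *\<^sub>C (x :: 'b::complex_vector) = - x"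
  using scaleC_add_left[of "-1" 1 x] scaleC_add_left[of 0 0 x]
  by (simp add: scaleC_one eq_neg_iff_add_eq_0)

lemma mconst_add: "mconst (a + b) = mconst a + (mconst b :: 'b::ab_group_add mer)"
  by transfer simp

lemma mconst_scaleC: "mconst (c *\<^sub>C a) = c *\<^sub>C (mconst a :: 'b::complex_vector mer)"
  by transfer simp

lemma mconst_lie: "mconst (lie a b) = lie (mconst a) (mconst b :: 'b::complex_lie_algebra mer)"
  by transfer simp

lemma mconst_zero [simp]: "mconst 0 = (0 :: 'b::ab_group_add mer)"
  by transfer simp

lemma scaleC_diff_right: "c *\<^sub>C (x - y) = c *\<^sub>C x - c *\<^sub>C (y :: 'b::complex_vector)"
  using scaleC_add_right[of c "x - y" y] by simp

lemma scaleC_minus_right: "c *\<^sub>C - y = - (c *\<^sub>C (y :: 'b::complex_vector))"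
  using scaleC_diff_right[of c 0 y] by simp

lemma scaleC_diff_left: "(c - d) *\<^sub>C y = c *\<^sub>C y - d *\<^sub>C (y :: 'b::complex_vector)"
  using scaleC_add_left[of "c - d" d y] by simp

lemma lie_diff_left: "lie (x - y) z = lie x z - lie y (z :: 'b::complex_lie_algebra)"
  using lie_add_left[of "x - y" y z] by simp

lemma lie_diff_right: "lie x (y - z) = lie x y - lie x (z :: 'b::complex_lie_algebra)"
  using lie_add_right[of x "y - z" z] by simp

lemma lie_minus_left: "lie (- y) z = - lie y (z :: 'b::complex_lie_algebra)"
  using lie_diff_left[of 0 y z] by simp

lemma lie_minus_right: "lie y (- z) = - lie y (z :: 'b::complex_lie_algebra)"
  using lie_diff_right[of y 0 z] by simp

lemma lie_antisym: "lie x y = - lie y (x :: 'b::complex_lie_algebra)"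
  using lie_self[of "x + y"] unfolding lie_add_left lie_add_right lie_self[of x] lie_self[of y]
  by (simp add: eq_neg_iff_add_eq_0 add.commute)

lemma lie_lie: "lie x (lie y z) = lie (lie x y) z + lie y (lie x (z :: 'b::complex_lie_algebra))"
  using jacobi[of x y z] lie_antisym[of z "lie x y"] lie_antisym[of z x]
  by (simp add: lie_minus_right eq_neg_iff_add_eq_0 algebra_simps)

lemma form_add_right: "form x (y + w) = form x y + form x (w :: 'g::quadratic_lie_algebra)"
  using form_add_left[of y w x] by (simp add: form_sym)

lemma form_scaleC_right: "form x (k *\<^sub>C y) = k * form x (y :: 'g::quadratic_lie_algebra)"
  using form_scaleC_left[of k y x] by (simp add: form_sym)

lemma form_minus_right: "form x (- y) = - form x (y :: 'g::quadratic_lie_algebra)"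
  using form_scaleC_right[of x "-1" y] by (simp add: scaleC_minus1)

lemma form_diff_right: "form x (y - w) = form x y - form x (w :: 'g::quadratic_lie_algebra)"
  using form_add_right[of x "y - w" w] by simp

section \<open>Splitting off the constants\<close>

locale split_algebra = const_subalgebra L for L :: "'a::complex_lie_algebra mer set" +
  fixes ev :: "'a mer \<Rightarrow> 'a"
  assumes ev_add: "v \<in> L \<Longrightarrow> w \<in> L \<Longrightarrow> ev (v + w) = ev v + ev w"
    and ev_scaleC: "v \<in> L \<Longrightarrow> ev (c *\<^sub>C v) = c *\<^sub>C ev v"
    and ev_lie: "v \<in> L \<Longrightarrow> w \<in> L \<Longrightarrow> ev (lie v w) = lie (ev v) (ev w)"
    and ev_mconst: "ev (mconst a) = a"
begin

definition M where "M = {v \<in> L. ev v = 0}"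

lemma M_subset: "M \<subseteq> L"
  by (auto simp: M_def)

lemma M_L: "v \<in> M \<Longrightarrow> v \<in> L"
  by (simp add: M_def)

lemma ev_zero [simp]: "ev 0 = 0"
  using ev_add[of 0 0] by simp

lemma uminus_mem [simp, intro]: "v \<in> L \<Longrightarrow> - v \<in> L"
  using scaleC_mem[of v "-1"] by (simp add: scaleC_minus1)

lemma diff_mem [simp, intro]: "v \<in> L \<Longrightarrow> w \<in> L \<Longrightarrow> v - w \<in> L"
  using add_mem[of v "- w"] by simp

lemma ev_diff: "v \<in> L \<Longrightarrow> w \<in> L \<Longrightarrow> ev (v - w) = ev v - ev w"
  using ev_add[of "v - w" w] by (simp add: algebra_simps)

lemma lie_M_right: "v \<in> L \<Longrightarrow> w \<in> M \<Longrightarrow> lie v w \<in> M"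
  by (simp add: M_def ev_lie)

sublocale M: lie_subalgebra M
  by unfold_locales (auto simp: M_def ev_add ev_scaleC ev_lie)

definition pg :: "'a mer \<Rightarrow> 'a mer" where "pg v = mconst (ev v)"
definition pm :: "'a mer \<Rightarrow> 'a mer" where "pm v = v - pg v"

lemma pg_add_pm: "pm v + pg v = v"
  by (simp add: pm_def)

lemma pg_mem [simp, intro]: "pg v \<in> L"
  by (simp add: pg_def)

lemma pm_mem [simp, intro]: "v \<in> L \<Longrightarrow> pm v \<in> M"
  by (simp add: pm_def M_def ev_diff) (simp add: pg_def ev_mconst)

lemma pg_add: "v \<in> L \<Longrightarrow> w \<in> L \<Longrightarrow> pg (v + w) = pg v + pg w"
  and pg_scaleC: "v \<in> L \<Longrightarrow> pg (c *\<^sub>C v) = c *\<^sub>C pg v"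
  and pg_lie: "v \<in> L \<Longrightarrow> w \<in> L \<Longrightarrow> pg (lie v w) = lie (pg v) (pg w)"
  by (simp_all add: pg_def ev_add ev_scaleC ev_lie mconst_add mconst_scaleC mconst_lie)

lemma pm_add: "v \<in> L \<Longrightarrow> w \<in> L \<Longrightarrow> pm (v + w) = pm v + pm w"
  by (simp add: pm_def pg_add)

lemma pm_scaleC: "v \<in> L \<Longrightarrow> pm (c *\<^sub>C v) = c *\<^sub>C pm v"
  by (simp add: pm_def pg_scaleC scaleC_diff_right)

lemma pm_lie: "v \<in> L \<Longrightarrow> w \<in> L \<Longrightarrow>
    pm (lie v w) + lie (pg w) (pm v) = lie (pm v) (pm w) + lie (pg v) (pm w)"
  using lie_antisym[of "pg w" "pm v"]
  by (simp add: pm_def pg_lie lie_diff_left lie_diff_right)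

lemma lie_mconst_lie:
  "lie (mconst a) (lie v w) = lie (lie (mconst a) v) w + lie v (lie (mconst a) (w :: 'a mer))"
  by (rule lie_lie)

sublocale adj: twisted_derivation M "\<lambda>c :: 'a. lie (mconst c)" "\<lambda>_ _. 0" "\<lambda>_ _. 0"
  by unfold_locales (simp_all add: lie_M_right lie_add_right lie_add_left lie_scaleC_left
      lie_scaleC_right mconst_add mconst_scaleC lie_mconst_lie)

abbreviation ad :: "'a \<Rightarrow> 'a mer free \<Rightarrow> 'a mer free"
  where "ad \<equiv> adj.D"

lemma ad_0: "x \<in> free_carrier M \<Longrightarrow> ad 0 x \<in> env_ideal M"
  using M.J_uminus[OF adj.D_add_left[of x 0 0]] by simp

lemma ad_gen: "x \<in> free_carrier M \<Longrightarrow>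
    ad c (fgen v * x) - (fgen v * ad c x + fgen (lie (mconst c) v) * x) \<in> env_ideal M"
  using ad_0[of x] by (simp add: twisted_gen)

lemma ad_ad_gen:
  assumes "v \<in> M" "x \<in> free_carrier M"
  shows "ad c (ad d (fgen v * x)) - (fgen v * ad c (ad d x) + fgen (lie (mconst c) v) * ad d x
    + fgen (lie (mconst d) v) * ad c x + fgen (lie (mconst c) (lie (mconst d) v)) * x) \<in> env_ideal M"
proof -
  let ?j1 = "ad d (fgen v * x) - (fgen v * ad d x + fgen (lie (mconst d) v) * x)"
  let ?j2 = "ad c (fgen v * ad d x) - (fgen v * ad c (ad d x) + fgen (lie (mconst c) v) * ad d x)"
  let ?j3 = "ad c (fgen (lie (mconst d) v) * x) - (fgen (lie (mconst d) v) * ad c x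
    + fgen (lie (mconst c) (lie (mconst d) v)) * x)"
  have "ad c ?j1 + ?j2 + ?j3 \<in> env_ideal M"
    by (intro M.J_add adj.D_J ad_gen adj.D_mem assms)
  then show ?thesis
    by (simp add: twisted_diff twisted_add algebra_simps)
qed

lemma ad_commutator: "x \<in> free_carrier M \<Longrightarrow> ad c (ad d x) - ad d (ad c x) - ad (lie c d) x \<in> env_ideal M"
proof (induction x rule: free_carrier_induct)
  case (add x y)
  from M.J_add[OF add(3,4)] show ?case by (simp add: twisted_add algebra_simps)
next
  case (scale k x)
  from M.J_left[OF _ scale(2), of "fconst k"] show ?case by (simp add: twisted_fconst algebra_simps)
next
  case (gen v x)
  let ?j1 = "ad c (ad d (fgen v * x)) - (fgen v * ad c (ad d x) + fgen (lie (mconst c) v) * ad d x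
    + fgen (lie (mconst d) v) * ad c x + fgen (lie (mconst c) (lie (mconst d) v)) * x)"
  let ?j2 = "ad d (ad c (fgen v * x)) - (fgen v * ad d (ad c x) + fgen (lie (mconst d) v) * ad c x
    + fgen (lie (mconst c) v) * ad d x + fgen (lie (mconst d) (lie (mconst c) v)) * x)"
  let ?j3 = "ad (lie c d) (fgen v * x) - (fgen v * ad (lie c d) x + fgen (lie (mconst (lie c d)) v) * x)"
  let ?j4 = "fgen v * (ad c (ad d x) - ad d (ad c x) - ad (lie c d) x)"
  let ?j5 = "fgen (lie (mconst c) (lie (mconst d) v)) - fgen (lie (mconst (lie c d)) v)
    - fgen (lie (mconst d) (lie (mconst c) v))"
  have "?j5 \<in> env_ideal M"
    using M.J_gen_add[of "lie (mconst (lie c d)) v" "lie (mconst d) (lie (mconst c) v)"] gen(1)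
    by (simp add: mconst_lie lie_M_right lie_lie[of "mconst c" "mconst d" v])
  then have j5: "?j5 * x \<in> env_ideal M" using gen by blast
  have j4: "?j4 \<in> env_ideal M" using gen by blast
  have comb: "\<lbrakk>j1 \<in> env_ideal M; j2 \<in> env_ideal M; j3 \<in> env_ideal M; j4 \<in> env_ideal M; j5 \<in> env_ideal M\<rbrakk>
    \<Longrightarrow> j1 - j2 - j3 + j4 + j5 \<in> env_ideal M" for j1 j2 j3 j4 j5
    by (intro M.J_add M.J_diff)
  have "?j1 - ?j2 - ?j3 + ?j4 + ?j5 * x \<in> env_ideal M"
    by (rule comb[OF ad_ad_gen[OF gen(1,2)] ad_ad_gen[OF gen(1,2)] ad_gen[OF gen(2)] j4 j5])
  then show ?case by (simp add: algebra_simps)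
qed simp

text \<open>The action of \<open>L\<close> on \<open>U M\<close>, in which \<open>M\<close> acts by left multiplication and the constants
  act by derivations, gives a left inverse of the map from \<open>U M\<close> to \<open>Q L\<close>.\<close>

primrec retract_word :: "'a mer list \<Rightarrow> 'a mer free"
  where "retract_word [] = 1"
  | "retract_word (v # w) = fgen (pm v) * retract_word w + ad (ev v) (retract_word w)"

definition retract :: "'a mer free \<Rightarrow> 'a mer free"
  where "retract = lin retract_word"

lemma retract_one [simp]: "retract 1 = 1"
  and retract_zero [simp]: "retract 0 = 0"
  and retract_add: "retract (x + y) = retract x + retract y"
  and retract_fconst: "retract (fconst c * x) = fconst c * retract x"
  by (simp_all add: retract_def lin_add lin_fconst)

lemma retract_diff: "retract (x - y) = retract x - retract y"
  using retract_add[of "x - y" y] by simp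

lemma retract_gen: "retract (fgen v * x) = fgen (pm v) * retract x + ad (ev v) (retract x)"
  by (simp add: retract_def lin_fgen lin_fun_add lin_fun_times lin_comp[of "ad (ev v)"]
      twisted_add twisted_fconst)

lemma retract_mem: "x \<in> free_carrier L \<Longrightarrow> retract x \<in> free_carrier M"
  by (induction x rule: free_carrier_induct)
    (auto simp: retract_add retract_fconst retract_gen)

lemma retract_rel:
  assumes "r \<in> env_rels L" and x: "x \<in> free_carrier L"
  shows "retract (r * x) \<in> env_ideal M"
proof -
  define y where "y = retract x"
  have y: "y \<in> free_carrier M" using x by (simp add: y_def retract_mem)
  show ?thesis
    using assms(1)
  proof (cases rule: env_rels_cases)
    case (add v w)
    have "(fgen (pm v + pm w) - fgen (pm v) - fgen (pm w)) * y
        + (ad (ev v + ev w) y - ad (ev v) y - ad (ev w) y) \<in> env_ideal M"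
      using add y by (intro M.J_add M.J_right M.J_gen_add adj.D_add_left) auto
    then show ?thesis
      unfolding add(3) using add(1,2)
      by (simp add: left_diff_distrib retract_diff retract_add retract_gen pm_add ev_add y_def[symmetric] algebra_simps)
  next
    case (scaleC c v)
    have "(fgen (c *\<^sub>C pm v) - fconst c * fgen (pm v)) * y
        + (ad (c *\<^sub>C ev v) y - fconst c * ad (ev v) y) \<in> env_ideal M"
      using scaleC y by (intro M.J_add M.J_right M.J_gen_scaleC adj.D_scaleC_left) auto
    then show ?thesis
      unfolding scaleC(2) using scaleC(1)
      by (simp add: left_diff_distrib retract_diff mult.assoc retract_fconst retract_gen pm_scaleC
          ev_scaleC y_def[symmetric] algebra_simps)
  next
    case (lie v w)
    define S where "S = lie (pm v) (pm w) + lie (pg v) (pm w)"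
    have comb: "\<lbrakk>a \<in> env_ideal M; b \<in> env_ideal M; c \<in> env_ideal M; d \<in> env_ideal M; e \<in> env_ideal M;
        g \<in> env_ideal M\<rbrakk> \<Longrightarrow> a - b + c + (d - e + g) * y \<in> env_ideal M" for a b c d e g
      using y by (intro M.J_add M.J_diff M.J_right)
    have "(ad (ev v) (fgen (pm w) * y) - (fgen (pm w) * ad (ev v) y + fgen (lie (mconst (ev v)) (pm w)) * y))
      - (ad (ev w) (fgen (pm v) * y) - (fgen (pm v) * ad (ev w) y + fgen (lie (mconst (ev w)) (pm v)) * y))
      + (ad (ev v) (ad (ev w) y) - ad (ev w) (ad (ev v) y) - ad (lie (ev v) (ev w)) y)
      + ((fgen (pm v) * fgen (pm w) - fgen (pm w) * fgen (pm v) - fgen (lie (pm v) (pm w)))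
        - (fgen S - fgen (lie (pm v) (pm w)) - fgen (lie (pg v) (pm w)))
        + (fgen (pm (lie v w) + lie (pg w) (pm v)) - fgen (pm (lie v w)) - fgen (lie (pg w) (pm v)))) * y \<in> env_ideal M"
      unfolding S_def using lie(1,2) y
      by (intro comb ad_gen ad_commutator M.J_gen_lie M.J_gen_add lie_M_right M.lie_mem pm_mem lie_mem pg_mem)
    then show ?thesis
      unfolding lie(3) pm_lie[OF lie(1,2)] S_def[symmetric] using lie(1,2)
      by (simp add: left_diff_distrib retract_diff retract_add mult.assoc retract_gen ev_lie twisted_add
          pg_def[symmetric] y_def[symmetric] algebra_simps)
  qed
qed

lemma retract_J: "x \<in> env_ideal L \<Longrightarrow> retract x \<in> env_ideal M"
proof (induction x rule: env_ideal_induct)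
  case (add x y)
  then show ?case by (auto simp: retract_add)
next
  case (rel x b r)
  have "x \<in> free_carrier L \<Longrightarrow> retract (x * (r * b)) \<in> env_ideal M"
  proof (induction x rule: free_carrier_induct)
    case one
    then show ?case using rel retract_rel by simp
  next
    case (gen v x)
    then show ?case
      by (auto simp: mult.assoc retract_gen intro!: M.J_add M.J_left adj.D_J)
  qed (auto simp: distrib_right retract_add mult.assoc retract_fconst)
  then show ?case using rel by (simp add: mult.assoc)
qed

lemma retract_N: "x \<in> N \<Longrightarrow> retract x \<in> env_ideal M"
proof (induction x rule: aug_null_induct)
  case (add x y)
  then show ?case by (auto simp: retract_add)
next
  case (ideal x)
  then show ?case by (rule retract_J)
next
  case (const x c)
  then show ?case
  proof (induction x rule: free_carrier_induct)
    case one
    have "pm (mconst c) = 0" by (simp add: pm_def pg_def ev_mconst)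
    then show ?case using retract_gen[of "mconst c" 1] M.J_gen_zero by simp
  next
    case (gen v x)
    then show ?case
      by (auto simp: mult.assoc retract_gen intro!: M.J_add M.J_left adj.D_J)
  qed (auto simp: distrib_right retract_add mult.assoc retract_fconst)
qed

lemma retract_M: "x \<in> free_carrier M \<Longrightarrow> retract x - x \<in> env_ideal M"
proof (induction x rule: free_carrier_induct)
  case (add x y)
  from M.J_add[OF add(3,4)] show ?case by (simp add: retract_add algebra_simps)
next
  case (scale c x)
  from M.J_left[OF _ scale(2), of "fconst c"] show ?case by (simp add: retract_fconst algebra_simps)
next
  case (gen v x)
  have "ev v = 0" "pm v = v" using gen(1) by (simp_all add: M_def pm_def pg_def)
  moreover have "retract x \<in> free_carrier M"
    using free_carrier_mono[OF M_subset] gen(2) by (blast intro: retract_mem)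
  then have "fgen v * (retract x - x) + ad 0 (retract x) \<in> env_ideal M"
    using gen by (intro M.J_add M.J_left ad_0) auto
  ultimately show ?case by (simp add: retract_gen algebra_simps)
qed simp

lemma M_inter_N:
  assumes "x \<in> free_carrier M" "x \<in> N"
  shows "x \<in> env_ideal M"
  using M.J_diff[OF retract_N[OF assms(2)] retract_M[OF assms(1)]] by simp

lemma env_ideal_M: "x \<in> env_ideal M \<Longrightarrow> x \<in> env_ideal L"
  using env_ideal_mono[OF M.lie_subalgebra_axioms lie_subalgebra_axioms M_subset] by blast

lemma free_carrier_M: "x \<in> free_carrier M \<Longrightarrow> x \<in> free_carrier L"
  using free_carrier_mono[OF M_subset] by blast

lemma const_times_M: "x \<in> free_carrier M \<Longrightarrow> fgen (mconst c) * x - ad c x \<in> N"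
proof (induction x rule: free_carrier_induct)
  case one
  show ?case using N_const by simp
next
  case (add x y)
  from N_add[OF add(3,4)] show ?case by (simp add: twisted_add algebra_simps)
next
  case (scale k x)
  have "fgen (mconst c) * (fconst k * x) = fconst k * (fgen (mconst c) * x)"
    by (metis fconst_commute mult.assoc)
  then show ?case using N_left[OF _ scale(2), of "fconst k"] by (simp add: twisted_fconst algebra_simps)
next
  case (gen v x)
  have v: "v \<in> L" using gen M_L by blast
  have "(fgen (mconst c) * fgen v - fgen v * fgen (mconst c) - fgen (lie (mconst c) v)) * x \<in> N"
    using gen v free_carrier_M by (intro N_J J_right J_gen_lie) auto
  moreover have "fgen v * (fgen (mconst c) * x - ad c x) \<in> N"
    using gen(3) v by blast
  moreover have "ad c (fgen v * x) - (fgen v * ad c x + fgen (lie (mconst c) v) * x) \<in> N"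
    by (intro N_J env_ideal_M ad_gen gen)
  ultimately have "(fgen (mconst c) * fgen v - fgen v * fgen (mconst c) - fgen (lie (mconst c) v)) * x
    + fgen v * (fgen (mconst c) * x - ad c x)
    - (ad c (fgen v * x) - (fgen v * ad c x + fgen (lie (mconst c) v) * x)) \<in> N"
    by (rule N_diff[OF N_add])
  then show ?case by (simp add: algebra_simps)
qed

lemma ex_M_rep: "y \<in> free_carrier L \<Longrightarrow> \<exists>x\<in>free_carrier M. y - x \<in> N"
proof (induction y rule: free_carrier_induct)
  case one
  show ?case by (intro bexI[of _ 1]) auto
next
  case (add y y')
  then obtain x x' where x: "x \<in> free_carrier M" "x' \<in> free_carrier M" "y - x \<in> N" "y' - x' \<in> N" by blast
  show ?case
    using x(1,2) N_add[OF x(3,4)] by (intro bexI[of _ "x + x'"]) (auto simp: algebra_simps)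
next
  case (scale c y)
  then obtain x where x: "x \<in> free_carrier M" "y - x \<in> N" by blast
  show ?case
    using x N_left[OF _ x(2), of "fconst c"] by (intro bexI[of _ "fconst c * x"]) (auto simp: algebra_simps)
next
  case (gen v y)
  then obtain x where x: "x \<in> free_carrier M" "y - x \<in> N" by blast
  have "fgen v * (y - x) \<in> N" using gen x by blast
  moreover have "(fgen (pm v + pg v) - fgen (pm v) - fgen (pg v)) * x \<in> N"
    using M_L[OF pm_mem[OF gen(1)]] free_carrier_M[OF x(1)] by (intro N_J J_right J_gen_add) auto
  moreover have "fgen (pg v) * x - ad (ev v) x \<in> N"
    unfolding pg_def by (rule const_times_M[OF x(1)])
  ultimately have "fgen v * (y - x) + (fgen (pm v + pg v) - fgen (pm v) - fgen (pg v)) * x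
      + (fgen (pg v) * x - ad (ev v) x) \<in> N"
    by (rule N_add[OF N_add])
  note this[unfolded pg_add_pm]
  then show ?case
    using x gen by (intro bexI[of _ "fgen (pm v) * x + ad (ev v) x"]) (auto simp: algebra_simps)
qed

lemma ident_inj: "inj_on (ident L) (carrier (U M))"
proof (rule inj_onI)
  fix X Y assume "X \<in> carrier (U M)" "Y \<in> carrier (U M)" and eq: "ident L X = ident L Y"
  then obtain x y where xy: "x \<in> free_carrier M" "y \<in> free_carrier M" "X = ucls M x" "Y = ucls M y"
    by (auto simp: M.carrier_U)
  have "x - y \<in> N"
    using eq xy free_carrier_M qcls_eq_iff by (simp add: ident_ucls[OF M.lie_subalgebra_axioms M_subset])
  then have "x - y \<in> env_ideal M" using xy M_inter_N by blast
  then show "X = Y" using xy by (simp add: M.ucls_eq_iff)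
qed

lemma transport_qcls:
  assumes T: "\<And>x. x \<in> free_carrier M \<Longrightarrow> T (ucls M x) = ucls M (t x)"
    and t: "\<And>x y. x \<in> free_carrier L \<Longrightarrow> y \<in> free_carrier L \<Longrightarrow> x - y \<in> N \<Longrightarrow> t x - t y \<in> N"
    and t_mem: "\<And>x. x \<in> free_carrier L \<Longrightarrow> t x \<in> free_carrier L"
    and y: "y \<in> free_carrier L"
  shows "transport L M T (qcls L y) = qcls L (t y)"
proof -
  obtain x where x: "x \<in> free_carrier M" "y - x \<in> N" using ex_M_rep[OF y] by blast
  have "qcls L y = ident L (ucls M x)"
    using x y free_carrier_M qcls_eq_iff by (simp add: ident_ucls[OF M.lie_subalgebra_axioms M_subset])
  then have "the_inv_into (carrier (U M)) (ident L) (qcls L y) = ucls M x"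
    using x by (simp add: the_inv_into_f_f[OF ident_inj])
  then have "transport L M T (qcls L y) = qcls L (t x)"
    by (simp add: transport_def T[OF x(1)] ident_ucls[OF M.lie_subalgebra_axioms M_subset])
  moreover have "t y - t x \<in> N" using t x y free_carrier_M by blast
  then have "qcls L (t y) = qcls L (t x)" using x y t_mem free_carrier_M qcls_eq_iff by blast
  ultimately show ?thesis by simp
qed

lemma transport_eps_qcls:
  assumes p: "polar u a z \<in> M" and y: "y \<in> free_carrier L"
  shows "transport L M (eps M u a z) (qcls L y) = qcls L (fgen (polar u a z) * y)"
proof (rule transport_qcls[OF _ _ _ y])
  show "eps M u a z (ucls M x) = ucls M (fgen (polar u a z) * x)" if "x \<in> free_carrier M" for x
    using that p by (simp add: eps_def ugen_def)
  show "fgen (polar u a z) * x - fgen (polar u a z) * y \<in> N" if "x - y \<in> N" for x y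
    using that p N_left[of "fgen (polar u a z)" "x - y"] by (simp add: M_L right_diff_distrib)
qed (use p in \<open>auto simp: M_L\<close>)

end

section \<open>The operators \<open>\<iota>\<close>\<close>

definition iota_E :: "complex mer \<Rightarrow> cp1 \<Rightarrow> 'a::quadratic_lie_algebra \<Rightarrow> 'a mer \<Rightarrow> 'a mer"
  where "iota_E u z a v = - lie (polar u a z) v + polar u (lie a (mval v z)) z"

definition iota_f :: "cp1 \<Rightarrow> 'a::quadratic_lie_algebra \<Rightarrow> 'a mer \<Rightarrow> complex"
  where "iota_f z a v = - form a (mdiff v z)"

definition iota_m :: "cp1 \<Rightarrow> 'a::quadratic_lie_algebra \<Rightarrow> 'a mer \<Rightarrow> 'a"
  where "iota_m z a v = lie a (mval v z)"

abbreviation iota_free :: "complex mer \<Rightarrow> cp1 \<Rightarrow> 'a::quadratic_lie_algebra \<Rightarrow> 'a mer free \<Rightarrow> 'a mer free"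
  where "iota_free u z \<equiv> twisted (iota_E u z) (iota_f z) (iota_m z)"

lemma is_iota_unique:
  fixes M :: "'a::quadratic_lie_algebra mer set"
  assumes "lie_subalgebra M" and I: "is_iota M u z I" and I': "is_iota M u z I'"
  shows "I = I'"
proof -
  interpret M: lie_subalgebra M by fact
  interpret U: ring "U M" by (rule M.ring_U)
  have mem: "I a X \<in> carrier (U M)" "I' a X \<in> carrier (U M)" if "X \<in> carrier (U M)" for a X
    using I I' that unfolding is_iota_def by (meson PiE_mem)+
  have ext: "I a \<in> carrier (U M) \<rightarrow>\<^sub>E carrier (U M)" for a
    using I unfolding is_iota_def by blast
  have ext': "I' a \<in> carrier (U M) \<rightarrow>\<^sub>E carrier (U M)" for a
    using I' unfolding is_iota_def by blast
  have "I a (ucls M x) = I' a (ucls M x)" if "x \<in> free_carrier M" for a x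
    using that
  proof (induction x arbitrary: a rule: free_carrier_induct)
    case one
    show ?case using I I' unfolding is_iota_def M.one_U[symmetric] by simp
  next
    case (add x y)
    have "I a (ucls M x \<oplus>\<^bsub>U M\<^esub> ucls M y) = I' a (ucls M x \<oplus>\<^bsub>U M\<^esub> ucls M y)"
      using I I' add unfolding is_iota_def by (metis M.ucls_closed)
    then show ?case using add by simp
  next
    case (scale c x)
    have "I a (uconst M c \<otimes>\<^bsub>U M\<^esub> ucls M x) = I' a (uconst M c \<otimes>\<^bsub>U M\<^esub> ucls M x)"
      using I I' scale unfolding is_iota_def by (metis M.ucls_closed)
    then show ?case using scale by (simp add: uconst_def)
  next
    case (gen v x)
    let ?G = "ugen M v" and ?X = "ucls M x"
    have X: "?X \<in> carrier (U M)" and G: "?G \<in> carrier (U M)" using gen by (auto simp: ugen_def)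
    have *: "I a (?G \<otimes>\<^bsub>U M\<^esub> ?X) \<ominus>\<^bsub>U M\<^esub> ?G \<otimes>\<^bsub>U M\<^esub> I a ?X =
      I' a (?G \<otimes>\<^bsub>U M\<^esub> ?X) \<ominus>\<^bsub>U M\<^esub> ?G \<otimes>\<^bsub>U M\<^esub> I' a ?X"
      using I I' gen X unfolding is_iota_def by metis
    have "I a (?G \<otimes>\<^bsub>U M\<^esub> ?X) = I' a (?G \<otimes>\<^bsub>U M\<^esub> ?X)"
      using * gen(3) mem[OF X] mem[OF U.m_closed[OF G X]] G
      by (metis U.add.m_closed U.minus_eq U.add.inv_closed U.add.right_cancel U.m_closed)
    then show ?case using gen by (simp add: ugen_def)
  qed
  then have "I a X = I' a X" if "X \<in> carrier (U M)" for a X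
    using that by (auto simp: M.carrier_U)
  moreover have "I a X = I' a X" if "X \<notin> carrier (U M)" for a X
    using that PiE_arb[OF ext] PiE_arb[OF ext'] by simp
  ultimately show ?thesis by blast
qed

lemma iota_ucls:
  fixes M :: "'a::quadratic_lie_algebra mer set"
  assumes "twisted_derivation M (iota_E u z) (iota_f z) (iota_m z)" and x: "x \<in> free_carrier M"
  shows "iota M u a z (ucls M x) = ucls M (iota_free u z a x)"
proof -
  interpret twisted_derivation M "iota_E u z" "iota_f z" "iota_m z" by fact
  define rep where "rep X = (SOME x. x \<in> free_carrier M \<and> X = ucls M x)" for X
  define I where "I a = (\<lambda>X\<in>carrier (U M). ucls M (D a (rep X)))" for a
  have I: "I a (ucls M x) = ucls M (D a x)" if "x \<in> free_carrier M" for a x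
  proof -
    have rep: "rep (ucls M x) \<in> free_carrier M \<and> ucls M x = ucls M (rep (ucls M x))"
      unfolding rep_def by (rule someI_ex) (use that in blast)
    then have "x - rep (ucls M x) \<in> env_ideal M" using ucls_eq_iff by blast
    then have "ucls M (D a x) = ucls M (D a (rep (ucls M x)))"
      using D_J by (simp add: ucls_eq_iff flip: twisted_diff)
    then show ?thesis using that by (simp add: I_def)
  qed
  have is_iota: "is_iota M u z I"
    unfolding is_iota_def
  proof (intro allI conjI ballI)
    fix a
    show "I a \<in> carrier (U M) \<rightarrow>\<^sub>E carrier (U M)"
      unfolding PiE_def Pi_def by (auto simp: carrier_U I) (simp add: I_def carrier_U)
    show "I a \<one>\<^bsub>U M\<^esub> = \<zero>\<^bsub>U M\<^esub>"
      by (simp add: one_U zero_U I)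
    fix X assume "X \<in> carrier (U M)"
    then obtain x where x: "x \<in> free_carrier M" "X = ucls M x" by (auto simp: carrier_U)
    show "I a (uconst M c \<otimes>\<^bsub>U M\<^esub> X) = uconst M c \<otimes>\<^bsub>U M\<^esub> I a X" for c
      using x by (simp add: uconst_def I twisted_fconst)
    show "I a (X \<oplus>\<^bsub>U M\<^esub> Y) = I a X \<oplus>\<^bsub>U M\<^esub> I a Y" if "Y \<in> carrier (U M)" for Y
      using that x by (auto simp: carrier_U I twisted_add)
    fix v assume v: "v \<in> M"
    have "I a (ugen M v \<otimes>\<^bsub>U M\<^esub> X) \<ominus>\<^bsub>U M\<^esub> ugen M v \<otimes>\<^bsub>U M\<^esub> I a X
        = ucls M (D a (fgen v * x) - fgen v * D a x)"
      using x v by (simp add: ugen_def I)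
    also have "\<dots> = ugen M (iota_E u z a v) \<otimes>\<^bsub>U M\<^esub> X \<ominus>\<^bsub>U M\<^esub> uconst M (- iota_f z a v) \<otimes>\<^bsub>U M\<^esub> X
        \<oplus>\<^bsub>U M\<^esub> I (iota_m z a v) X"
      using x v E_mem[OF v, of a] by (simp add: ugen_def uconst_def I twisted_gen fconst_minus algebra_simps)
    finally show "I a (ugen M v \<otimes>\<^bsub>U M\<^esub> X) \<ominus>\<^bsub>U M\<^esub> ugen M v \<otimes>\<^bsub>U M\<^esub> I a X =
        ugen M (- lie (polar u a z) v + polar u (lie a (mval v z)) z) \<otimes>\<^bsub>U M\<^esub> X
        \<ominus>\<^bsub>U M\<^esub> uconst M (form a (mdiff v z)) \<otimes>\<^bsub>U M\<^esub> X
        \<oplus>\<^bsub>U M\<^esub> I (lie a (mval v z)) X"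
      by (simp add: iota_E_def iota_f_def iota_m_def)
  qed
  have "(THE I. is_iota M u z I) = I"
    using is_iota is_iota_unique[OF lie_subalgebra_axioms _ is_iota] by (rule the_equality)
  then show ?thesis using x by (simp add: iota_def I)
qed

locale const_twisted = const_subalgebra L + twisted_derivation L E f m
  for L :: "'a::complex_lie_algebra mer set" and E :: "'a \<Rightarrow> 'a mer \<Rightarrow> 'a mer" and f m +
  assumes E_const: "E a (mconst c) = 0" and f_const: "f a (mconst c) = 0"
begin

lemma D_N: "x \<in> N \<Longrightarrow> D a x \<in> N"
proof (induction x arbitrary: a rule: aug_null_induct)
  case (add x y)
  then show ?case by (auto simp: twisted_add)
next
  case (ideal x)
  then show ?case by (simp add: N_J D_J)
next
  case (const x c)
  then show ?case
  proof (induction x arbitrary: a rule: free_carrier_induct)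
    case one
    then show ?case
      using twisted_gen[of E f m a "mconst c" 1] N_J[OF J_gen_zero] by (simp add: E_const f_const)
  next
    case (gen v x)
    define y where "y = x * fgen (mconst c)"
    have "y \<in> N" unfolding y_def using gen N_const by blast
    moreover have "D a y \<in> N" for a unfolding y_def using gen by blast
    ultimately have "D a (fgen v * y) \<in> N"
      using gen E_mem[of v] unfolding twisted_gen by (intro N_add N_left) auto
    then show ?case by (simp add: y_def mult.assoc)
  qed (auto simp: distrib_right twisted_add mult.assoc twisted_fconst)
qed

end

lemma transport_iota_qcls:
  fixes L :: "'a::quadratic_lie_algebra mer set"
  assumes "split_algebra L ev" "const_twisted L (iota_E u z) (iota_f z) (iota_m z)"
    "twisted_derivation (split_algebra.M L ev) (iota_E u z) (iota_f z) (iota_m z)"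
    and y: "y \<in> free_carrier L"
  shows "transport L (split_algebra.M L ev) (iota (split_algebra.M L ev) u a z) (qcls L y)
    = qcls L (iota_free u z a y)"
proof -
  interpret split_algebra L ev by fact
  interpret tw: const_twisted L "iota_E u z" "iota_f z" "iota_m z" by fact
  show ?thesis
  proof (rule transport_qcls[OF _ _ _ y])
    show "tw.D a x - tw.D a y \<in> N" if "x - y \<in> N" for x y
      using tw.D_N[OF that] by (simp add: twisted_diff)
  qed (simp_all add: iota_ucls[OF assms(3)])
qed

section \<open>Meromorphic maps\<close>

lemma chart_0 [simp]: "chart x 0 = x"
  by (cases x) auto

lemma inj_chart: "inj (chart x)"
  by (cases x) (auto simp: inj_def split: if_splits)

lemma chart_eq_iff: "chart x w = x \<longleftrightarrow> w = 0"
  using injD[OF inj_chart, of x w 0] by auto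

lemma mer_of_eq_iff: "mer_of f = mer_of g \<longleftrightarrow> finite {x. f x \<noteq> g x}"
  by transfer simp

lemma ex_mer_of: "\<exists>f. F = mer_of f"
proof transfer
  fix F :: "cp1 \<Rightarrow> 'a"
  show "\<exists>f. finite {x. F x \<noteq> f x}" by (rule exI[of _ F]) simp
qed

lemma mer_of_ops:
  "mer_of f + mer_of g = mer_of (\<lambda>x. f x + g x)"
  "mer_of f - mer_of g = mer_of (\<lambda>x. f x - g x)"
  "- mer_of f = mer_of (\<lambda>x. - f x)"
  for f g :: "cp1 \<Rightarrow> 'a::ab_group_add"
  by (transfer, simp)+

lemma mer_of_scaleC: "c *\<^sub>C mer_of f = mer_of (\<lambda>x. c *\<^sub>C f x)"
  for f :: "cp1 \<Rightarrow> 'a::complex_vector"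
  by (transfer, simp)

lemma mer_of_lie: "lie (mer_of f) (mer_of g) = mer_of (\<lambda>x. lie (f x) (g x))"
  for f g :: "cp1 \<Rightarrow> 'a::complex_lie_algebra"
  by (transfer, simp)

lemma mer_of_mscale: "mscale (mer_of f) (mer_of g) = mer_of (\<lambda>x. f x *\<^sub>C g x)"
  by (transfer, simp)

lemma mer_of_inverse: "inverse (mer_of f) = mer_of (\<lambda>x. inverse (f x))"
  by (transfer, simp)

lemma mconst_eq_mer_of: "mconst c = mer_of (\<lambda>_. c)"
  by (transfer, simp)

lemma eventually_chart_eq:
  assumes "mer_of f = mer_of g"
  shows "\<forall>\<^sub>F w in at 0. f (chart x w) = g (chart x w)"
proof -
  have "finite {w. f (chart x w) \<noteq> g (chart x w)}"
    using finite_vimageI[OF assms[unfolded mer_of_eq_iff] inj_chart[of x]] by (simp add: vimage_def)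
  then show ?thesis
    using islimpt_finite[of _ "0 :: complex"] by (force simp: islimpt_iff_eventually)
qed

lemma holo_at_alt: "holo_at h x \<longleftrightarrow> (\<lambda>w. h (chart x w)) analytic_on {0}"
  by (simp add: holo_at_def o_def)

lemma mero_at_alt: "mero_at h x \<longleftrightarrow> (\<lambda>w. h (chart x w)) meromorphic_on {0}"
  by (simp add: mero_at_def o_def)

lemma holo_at_const [simp, intro]: "holo_at (\<lambda>_. c) x"
  and holo_at_mult [intro]: "holo_at f x \<Longrightarrow> holo_at g x \<Longrightarrow> holo_at (\<lambda>y. f y * g y) x"
  by (auto simp: holo_at_alt intro!: analytic_intros)

lemma mero_at_const [simp, intro]: "mero_at (\<lambda>_. c) x"
  and mero_at_mult [intro]: "mero_at f x \<Longrightarrow> mero_at g x \<Longrightarrow> mero_at (\<lambda>y. f y * g y) x"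
  by (auto simp: mero_at_alt intro!: meromorphic_intros)

lemma holo_at_deriv:
  assumes "holo_at h x"
  shows "((\<lambda>w. h (chart x w)) has_field_derivative deriv (h \<circ> chart x) 0) (at 0)"
proof -
  have "(h \<circ> chart x) field_differentiable at 0"
    using assms analytic_on_imp_differentiable_at[of "h \<circ> chart x" "{0}" 0] by (simp add: holo_at_def)
  then show ?thesis
    using DERIV_deriv_iff_field_differentiable by (force simp: o_def)
qed

subsection \<open>Linear functionals\<close>

lemma vector_space_scaleC: "vector_space (scaleC :: complex \<Rightarrow> 'a::complex_vector \<Rightarrow> 'a)"
  by unfold_locales (simp_all add: scaleC_add_right scaleC_add_left scaleC_scaleC scaleC_one)

lemma ex_functional:
  fixes v :: "'a::complex_vector"
  assumes "v \<noteq> 0"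
  obtains \<phi> :: "'a \<Rightarrow> complex" where "\<phi> v \<noteq> 0"
    "\<And>I h a. \<phi> (\<Sum>i\<in>I. h i *\<^sub>C a i) = (\<Sum>i\<in>I. h i * \<phi> (a i))"
proof -
  interpret vector_space_pair "scaleC :: complex \<Rightarrow> 'a \<Rightarrow> 'a" "(*) :: complex \<Rightarrow> complex \<Rightarrow> complex"
    by (intro vector_space_pair.intro vector_space_scaleC, unfold_locales) (simp_all add: algebra_simps)
  have "vs1.independent {v}" using assms vs1.dependent_single by blast
  then obtain g where g: "Vector_Spaces.linear scaleC (*) g" "\<forall>x\<in>{v}. g x = (\<lambda>_. 1 :: complex) x"
    using linear_independent_extend[of "{v}" "\<lambda>_. 1"] by blast
  show thesis
  proof (rule that[of g])
    show "g (\<Sum>i\<in>I. h i *\<^sub>C a i) = (\<Sum>i\<in>I. h i * g (a i))" for I :: "'d set" and h a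
      using g(1) by (simp add: linear_sum linear_scale)
  qed (use g in auto)
qed

subsection \<open>Values and differentials\<close>

definition tens_rep :: "cp1 \<Rightarrow> 'a::complex_vector mer \<Rightarrow> 'a \<Rightarrow> 'a \<Rightarrow> bool"
  where "tens_rep x F v d \<longleftrightarrow> (\<exists>n h a. (\<forall>i<n. holo_at (h i) x) \<and> F = tens n h a \<and>
    v = (\<Sum>i<n. h i x *\<^sub>C a i) \<and> d = (\<Sum>i<n. deriv (h i \<circ> chart x) 0 *\<^sub>C a i))"

lemma tens_repI:
  fixes I :: "'i set" and h :: "'i \<Rightarrow> cp1 \<Rightarrow> complex" and F :: "'a::complex_vector mer"
  assumes "finite I" "\<And>i. i \<in> I \<Longrightarrow> holo_at (h i) x" "F = mer_of (\<lambda>y. \<Sum>i\<in>I. h i y *\<^sub>C a i)"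
    "v = (\<Sum>i\<in>I. h i x *\<^sub>C a i)"
    "\<And>i. i \<in> I \<Longrightarrow> ((\<lambda>w. h i (chart x w)) has_field_derivative h' i) (at 0)"
    "d = (\<Sum>i\<in>I. h' i *\<^sub>C a i)"
  shows "tens_rep x F v d"
proof -
  obtain e where e: "bij_betw e {..<card I} I"
    using ex_bij_betw_nat_finite[OF assms(1)] by (auto simp: lessThan_atLeast0)
  have e': "e i \<in> I" if "i < card I" for i using bij_betwE[OF e] that by blast
  have sum: "(\<Sum>i\<in>I. g i) = (\<Sum>i<card I. g (e i))" for g :: "'i \<Rightarrow> 'a"
    by (rule sum.reindex_bij_betw[OF e, symmetric])
  have "deriv (h i \<circ> chart x) 0 = h' i" if "i \<in> I" for i
    using DERIV_imp_deriv[OF assms(5)[OF that]] by (simp add: o_def)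
  then show ?thesis
    unfolding tens_rep_def
    by (intro exI[of _ "card I"] exI[of _ "h \<circ> e"] exI[of _ "a \<circ> e"])
      (use assms(2-4,6) e' in \<open>auto simp: tens_def sum\<close>)
qed

lemma tens_repE:
  assumes "tens_rep x F v d"
  obtains n :: nat and h a h' where "\<And>i. i < n \<Longrightarrow> holo_at (h i) x" "F = mer_of (\<lambda>y. \<Sum>i<n. h i y *\<^sub>C a i)"
    "v = (\<Sum>i<n. h i x *\<^sub>C a i)"
    "\<And>i. i < n \<Longrightarrow> ((\<lambda>w. h i (chart x w)) has_field_derivative h' i) (at 0)"
    "d = (\<Sum>i<n. h' i *\<^sub>C a i)"
proof -
  obtain n h a where *: "\<forall>i<n. holo_at (h i) x" "F = tens n h a"
    "v = (\<Sum>i<n. h i x *\<^sub>C a i)" "d = (\<Sum>i<n. deriv (h i \<circ> chart x) 0 *\<^sub>C a i)"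
    using assms unfolding tens_rep_def by blast
  show thesis
    by (rule that[of n h a "\<lambda>i. deriv (h i \<circ> chart x) 0"])
      (use * holo_at_deriv in \<open>auto simp: tens_def\<close>)
qed

lemma sum_scaleC_right: "c *\<^sub>C (\<Sum>i\<in>I. f i) = (\<Sum>i\<in>I. c *\<^sub>C (f i :: 'a::complex_vector))"
  by (induction I rule: infinite_finite_induct) (simp_all add: scaleC_add_right)

lemma sum_lie_left: "lie (\<Sum>i\<in>I. f i) y = (\<Sum>i\<in>I. lie (f i) (y :: 'a::complex_lie_algebra))"
  by (induction I rule: infinite_finite_induct) (simp_all add: lie_add_left)

lemma sum_lie_right: "lie y (\<Sum>i\<in>I. f i) = (\<Sum>i\<in>I. lie (y :: 'a::complex_lie_algebra) (f i))"
  by (induction I rule: infinite_finite_induct) (simp_all add: lie_add_right)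

lemma sum_lie:
  "lie (\<Sum>i\<in>I. h i *\<^sub>C a i) (\<Sum>j\<in>J. k j *\<^sub>C b j)
    = (\<Sum>(i, j)\<in>I \<times> J. (h i * k j) *\<^sub>C (lie (a i) (b j) :: 'a::complex_lie_algebra))"
  by (subst sum_lie_left) (simp add: sum_lie_right lie_scaleC_left lie_scaleC_right scaleC_scaleC
      mult.commute sum.cartesian_product)

lemma tens_rep_add:
  assumes "tens_rep x F v d" "tens_rep x G v' d'"
  shows "tens_rep x (F + G) (v + v') (d + d')"
proof -
  obtain n :: nat and h a h' where F: "\<And>i. i < n \<Longrightarrow> holo_at (h i) x" "F = mer_of (\<lambda>y. \<Sum>i<n. h i y *\<^sub>C a i)"
    "v = (\<Sum>i<n. h i x *\<^sub>C a i)"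
    "\<And>i. i < n \<Longrightarrow> ((\<lambda>w. h i (chart x w)) has_field_derivative h' i) (at 0)"
    "d = (\<Sum>i<n. h' i *\<^sub>C a i)"
    using tens_repE[OF assms(1)] by blast
  obtain m :: nat and k b k' where G: "\<And>i. i < m \<Longrightarrow> holo_at (k i) x" "G = mer_of (\<lambda>y. \<Sum>i<m. k i y *\<^sub>C b i)"
    "v' = (\<Sum>i<m. k i x *\<^sub>C b i)"
    "\<And>i. i < m \<Longrightarrow> ((\<lambda>w. k i (chart x w)) has_field_derivative k' i) (at 0)"
    "d' = (\<Sum>i<m. k' i *\<^sub>C b i)"
    using tens_repE[OF assms(2)] by blast
  show ?thesis
    by (rule tens_repI[of "{..<n} <+> {..<m}" "case_sum h k" _ _ "case_sum a b" _ "case_sum h' k'"])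
      (use F G in \<open>auto simp: mer_of_ops sum.Plus\<close>)
qed

lemma tens_rep_scaleC:
  assumes "tens_rep x F v d"
  shows "tens_rep x (c *\<^sub>C F) (c *\<^sub>C v) (c *\<^sub>C d)"
proof -
  obtain n :: nat and h a h' where F: "\<And>i. i < n \<Longrightarrow> holo_at (h i) x" "F = mer_of (\<lambda>y. \<Sum>i<n. h i y *\<^sub>C a i)"
    "v = (\<Sum>i<n. h i x *\<^sub>C a i)"
    "\<And>i. i < n \<Longrightarrow> ((\<lambda>w. h i (chart x w)) has_field_derivative h' i) (at 0)"
    "d = (\<Sum>i<n. h' i *\<^sub>C a i)"
    using tens_repE[OF assms(1)] by blast
  show ?thesis
    by (rule tens_repI[of "{..<n}" h _ _ "\<lambda>i. c *\<^sub>C a i" _ h'])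
      (use F in \<open>auto simp: mer_of_scaleC sum_scaleC_right scaleC_scaleC mult.commute\<close>)
qed

lemma tens_rep_lie:
  assumes "tens_rep x F v d" "tens_rep x G v' d'"
  shows "tens_rep x (lie F G) (lie v v') (lie d v' + lie v d')"
proof -
  obtain n :: nat and h a h' where F: "\<And>i. i < n \<Longrightarrow> holo_at (h i) x" "F = mer_of (\<lambda>y. \<Sum>i<n. h i y *\<^sub>C a i)"
    "v = (\<Sum>i<n. h i x *\<^sub>C a i)"
    "\<And>i. i < n \<Longrightarrow> ((\<lambda>w. h i (chart x w)) has_field_derivative h' i) (at 0)"
    "d = (\<Sum>i<n. h' i *\<^sub>C a i)"
    using tens_repE[OF assms(1)] by blast
  obtain m :: nat and k b k' where G: "\<And>i. i < m \<Longrightarrow> holo_at (k i) x" "G = mer_of (\<lambda>y. \<Sum>i<m. k i y *\<^sub>C b i)"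
    "v' = (\<Sum>i<m. k i x *\<^sub>C b i)"
    "\<And>i. i < m \<Longrightarrow> ((\<lambda>w. k i (chart x w)) has_field_derivative k' i) (at 0)"
    "d' = (\<Sum>i<m. k' i *\<^sub>C b i)"
    using tens_repE[OF assms(2)] by blast
  show ?thesis
  proof (rule tens_repI[of "{..<n} \<times> {..<m}" "\<lambda>(i, j) y. h i y * k j y" _ _ "\<lambda>(i, j). lie (a i) (b j)" _
        "\<lambda>(i, j). h' i * k j x + h i x * k' j"])
    fix p assume p: "p \<in> {..<n} \<times> {..<m}"
    show "holo_at ((\<lambda>(i, j) y. h i y * k j y) p) x" using p F G by auto
    show "((\<lambda>w. (\<lambda>(i, j) y. h i y * k j y) p (chart x w)) has_field_derivative
        (\<lambda>(i, j). h' i * k j x + h i x * k' j) p) (at 0)"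
      using p DERIV_mult[OF F(4) G(4)] by (auto simp: add.commute mult.commute)
  qed (auto simp: F G mer_of_lie sum_lie case_prod_unfold scaleC_add_left sum.distrib)
qed

lemma tens_rep_mconst: "tens_rep x (mconst c) c 0"
  by (rule tens_repI[of "{0 :: nat}" "\<lambda>_ _. 1" _ _ "\<lambda>_. c" _ "\<lambda>_. 0"])
    (auto simp: mconst_eq_mer_of scaleC_one scaleC_0_left)

lemma tens_rep_zero:
  assumes "tens_rep x 0 v d"
  shows "v = 0 \<and> d = 0"
proof -
  obtain n :: nat and h a h' where F: "\<And>i. i < n \<Longrightarrow> holo_at (h i) x" "0 = mer_of (\<lambda>y. \<Sum>i<n. h i y *\<^sub>C a i)"
    "v = (\<Sum>i<n. h i x *\<^sub>C a i)"
    "\<And>i. i < n \<Longrightarrow> ((\<lambda>w. h i (chart x w)) has_field_derivative h' i) (at 0)"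
    "d = (\<Sum>i<n. h' i *\<^sub>C a i)"
    using tens_repE[OF assms] by blast
  have 0: "mer_of (\<lambda>y. \<Sum>i<n. h i y *\<^sub>C a i) = mer_of (\<lambda>_. 0)"
    using F(2) by (simp flip: mconst_eq_mer_of)
  have ev: "\<forall>\<^sub>F w in at 0. (\<Sum>i<n. h i (chart x w) *\<^sub>C a i) = 0"
    using eventually_chart_eq[OF 0] .
  have "\<phi> v = 0 \<and> \<phi> d = 0"
    if \<phi>: "\<And>(I :: nat set) h a. \<phi> (\<Sum>i\<in>I. h i *\<^sub>C a i) = (\<Sum>i\<in>I. h i * \<phi> (a i))"
    for \<phi> :: "'a \<Rightarrow> complex"
  proof -
    define g where "g w = (\<Sum>i<n. h i (chart x w) * \<phi> (a i))" for w
    have g: "(g has_field_derivative (\<Sum>i<n. h' i * \<phi> (a i))) (at 0)"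
      unfolding g_def using F(4) by (auto intro!: DERIV_sum DERIV_cmult_right)
    have \<phi>0: "\<phi> 0 = 0" using \<phi>[where I = "{}"] by simp
    have ev': "\<forall>\<^sub>F w in at 0. g w = 0"
      using ev by eventually_elim (simp add: g_def \<phi>0 flip: \<phi>)
    have "(g \<longlongrightarrow> g 0) (at 0)" using DERIV_isCont[OF g] by (simp add: isCont_def)
    moreover have "(g \<longlongrightarrow> 0) (at 0)" using ev' by (simp add: tendsto_eventually)
    ultimately have g0: "g 0 = 0" using tendsto_unique[of "at 0"] by force
    then have "\<forall>\<^sub>F w in nhds 0. g w = 0"
      using ev' by (auto simp: eventually_nhds_conv_at)
    then have "(g has_field_derivative 0) (at 0)"
      by (subst DERIV_cong_ev[OF refl _ refl, of _ "\<lambda>_. 0"]) auto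
    with g have "(\<Sum>i<n. h' i * \<phi> (a i)) = 0" by (rule DERIV_unique)
    with g0 show ?thesis by (simp add: F(3,5) \<phi> g_def)
  qed
  then show ?thesis using ex_functional by metis
qed

lemma tens_rep_unique:
  assumes "tens_rep x F v d" "tens_rep x F v' d'"
  shows "v = v' \<and> d = d'"
proof -
  have "tens_rep x (F + (-1) *\<^sub>C F) (v + (-1) *\<^sub>C v') (d + (-1) *\<^sub>C d')"
    by (intro tens_rep_add tens_rep_scaleC assms)
  then show ?thesis using tens_rep_zero[of x "v - v'" "d - d'"] by (simp add: scaleC_minus1)
qed

lemma tens_rep_iff: "tens_rep x F v d \<longleftrightarrow> regular F x \<and> v = mval F x \<and> d = mdiff F x"
proof -
  have *: "mval F x = v \<and> mdiff F x = d" if "tens_rep x F v d" for v d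
  proof
    show "mval F x = v"
      unfolding mval_def
    proof (rule the_equality)
      show "\<exists>n h a. (\<forall>i<n. holo_at (h i) x) \<and> F = tens n h a \<and> v = (\<Sum>i<n. h i x *\<^sub>C a i)"
        using that unfolding tens_rep_def by blast
      fix v' assume "\<exists>n h a. (\<forall>i<n. holo_at (h i) x) \<and> F = tens n h a \<and> v' = (\<Sum>i<n. h i x *\<^sub>C a i)"
      then obtain d' where "tens_rep x F v' d'" unfolding tens_rep_def by blast
      then show "v' = v" using tens_rep_unique[OF that] by blast
    qed
    show "mdiff F x = d"
      unfolding mdiff_def
    proof (rule the_equality)
      show "\<exists>n h a. (\<forall>i<n. holo_at (h i) x) \<and> F = tens n h a \<and> d = (\<Sum>i<n. deriv (h i \<circ> chart x) 0 *\<^sub>C a i)"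
        using that unfolding tens_rep_def by blast
      fix d' assume "\<exists>n h a. (\<forall>i<n. holo_at (h i) x) \<and> F = tens n h a \<and>
        d' = (\<Sum>i<n. deriv (h i \<circ> chart x) 0 *\<^sub>C a i)"
      then obtain v' where "tens_rep x F v' d'" unfolding tens_rep_def by blast
      then show "d' = d" using tens_rep_unique[OF that] by blast
    qed
  qed
  have "regular F x \<longleftrightarrow> (\<exists>v d. tens_rep x F v d)"
    unfolding regular_def tens_rep_def by blast
  then show ?thesis using * by blast
qed

lemma tens_rep_regular: "regular F x \<Longrightarrow> tens_rep x F (mval F x) (mdiff F x)"
  by (simp add: tens_rep_iff)

lemma tens_rep_imp:
  assumes "tens_rep x F v d"
  shows "regular F x" "mval F x = v" "mdiff F x = d"
  using assms by (simp_all add: tens_rep_iff)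

lemmas regular_add = tens_rep_imp[OF tens_rep_add[OF tens_rep_regular tens_rep_regular]]
lemmas regular_scaleC = tens_rep_imp[OF tens_rep_scaleC[OF tens_rep_regular]]
lemmas regular_lie = tens_rep_imp[OF tens_rep_lie[OF tens_rep_regular tens_rep_regular]]
lemmas regular_mconst = tens_rep_imp[OF tens_rep_mconst]

lemma meromorphicI:
  fixes I :: "'i set" and h :: "'i \<Rightarrow> cp1 \<Rightarrow> complex" and F :: "'a::complex_vector mer"
  assumes "finite I" "\<And>i x. i \<in> I \<Longrightarrow> mero_at (h i) x" "F = mer_of (\<lambda>y. \<Sum>i\<in>I. h i y *\<^sub>C a i)"
  shows "meromorphic F"
proof -
  obtain e where e: "bij_betw e {..<card I} I"
    using ex_bij_betw_nat_finite[OF assms(1)] by (auto simp: lessThan_atLeast0)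
  have e': "e i \<in> I" if "i < card I" for i using bij_betwE[OF e] that by blast
  have sum: "(\<Sum>i\<in>I. g i) = (\<Sum>i<card I. g (e i))" for g :: "'i \<Rightarrow> 'a"
    by (rule sum.reindex_bij_betw[OF e, symmetric])
  show ?thesis
    unfolding meromorphic_def
    by (intro exI[of _ "card I"] exI[of _ "h \<circ> e"] exI[of _ "a \<circ> e"])
      (use assms(2,3) e' in \<open>auto simp: tens_def sum\<close>)
qed

lemma meromorphicE:
  assumes "meromorphic F"
  obtains n :: nat and h a where "\<And>i x. i < n \<Longrightarrow> mero_at (h i) x" "F = mer_of (\<lambda>y. \<Sum>i<n. h i y *\<^sub>C a i)"
  using assms unfolding meromorphic_def tens_def by blast

lemma meromorphic_add:
  assumes "meromorphic F" "meromorphic G"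
  shows "meromorphic (F + G)"
proof -
  obtain n :: nat and h a where F: "\<And>i x. i < n \<Longrightarrow> mero_at (h i) x" "F = mer_of (\<lambda>y. \<Sum>i<n. h i y *\<^sub>C a i)"
    using meromorphicE[OF assms(1)] by blast
  obtain m :: nat and k b where G: "\<And>i x. i < m \<Longrightarrow> mero_at (k i) x" "G = mer_of (\<lambda>y. \<Sum>i<m. k i y *\<^sub>C b i)"
    using meromorphicE[OF assms(2)] by blast
  show ?thesis
    by (rule meromorphicI[of "{..<n} <+> {..<m}" "case_sum h k" _ "case_sum a b"])
      (use F G in \<open>auto simp: mer_of_ops sum.Plus\<close>)
qed

lemma meromorphic_lie:
  assumes "meromorphic F" "meromorphic G"
  shows "meromorphic (lie F G)"
proof -
  obtain n :: nat and h a where F: "\<And>i x. i < n \<Longrightarrow> mero_at (h i) x" "F = mer_of (\<lambda>y. \<Sum>i<n. h i y *\<^sub>C a i)"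
    using meromorphicE[OF assms(1)] by blast
  obtain m :: nat and k b where G: "\<And>i x. i < m \<Longrightarrow> mero_at (k i) x" "G = mer_of (\<lambda>y. \<Sum>i<m. k i y *\<^sub>C b i)"
    using meromorphicE[OF assms(2)] by blast
  show ?thesis
    by (rule meromorphicI[of "{..<n} \<times> {..<m}" "\<lambda>(i, j) y. h i y * k j y" _ "\<lambda>(i, j). lie (a i) (b j)"])
      (use F G in \<open>auto simp: mer_of_lie sum_lie case_prod_unfold\<close>)
qed

lemma meromorphic_mscale:
  assumes "meromorphic F" "\<And>x. mero_at f x"
  shows "meromorphic (mscale (mer_of f) F)"
proof -
  obtain n :: nat and h a where F: "\<And>i x. i < n \<Longrightarrow> mero_at (h i) x" "F = mer_of (\<lambda>y. \<Sum>i<n. h i y *\<^sub>C a i)"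
    using meromorphicE[OF assms(1)] by blast
  show ?thesis
    by (rule meromorphicI[of "{..<n}" "\<lambda>i y. f y * h i y" _ a])
      (use F assms(2) in \<open>auto simp: mer_of_mscale sum_scaleC_right scaleC_scaleC\<close>)
qed

lemma meromorphic_scaleC: "meromorphic F \<Longrightarrow> meromorphic (c *\<^sub>C F)"
proof -
  assume *: "meromorphic F"
  obtain f where "F = mer_of f" using ex_mer_of by blast
  then have "c *\<^sub>C F = mscale (mer_of (\<lambda>_. c)) F" by (simp add: mer_of_scaleC mer_of_mscale)
  then show ?thesis using meromorphic_mscale[OF *, of "\<lambda>_. c"] by auto
qed

lemma meromorphic_mconst: "meromorphic (mconst c)"
  by (rule meromorphicI[of "{0 :: nat}" "\<lambda>_ _. 1" _ "\<lambda>_. c"])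
    (auto simp: mconst_eq_mer_of scaleC_one)

lemma split_algebra_reg_maps:
  fixes A :: "cp1 set"
  assumes "P \<in> A"
  shows "split_algebra (reg_maps A :: 'a::complex_lie_algebra mer set) (\<lambda>F. mval F P)"
proof
  show "const_maps \<subseteq> (reg_maps A :: 'a mer set)"
    by (auto simp: const_maps_def reg_maps_def meromorphic_mconst regular_mconst)
  show "0 \<in> (reg_maps A :: 'a mer set)"
    using meromorphic_mconst[of "0 :: 'a"] regular_mconst(1)[of "0 :: 'a"] by (auto simp: reg_maps_def)
  fix F G :: "'a mer" and c
  assume F: "F \<in> reg_maps A" and G: "G \<in> reg_maps A"
  show "F + G \<in> reg_maps A"
    using F G unfolding reg_maps_def by (blast intro: meromorphic_add regular_add(1))
  show "lie F G \<in> reg_maps A"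
    using F G unfolding reg_maps_def by (blast intro: meromorphic_lie regular_lie(1))
  have P: "regular F P" "regular G P" using F G assms by (auto simp: reg_maps_def)
  show "mval (F + G) P = mval F P + mval G P" "mval (lie F G) P = lie (mval F P) (mval G P)"
    by (rule regular_add(2) regular_lie(2), (rule P)+)+
next
  fix F :: "'a mer" and c
  assume F: "F \<in> reg_maps A"
  show "c *\<^sub>C F \<in> reg_maps A"
    using F unfolding reg_maps_def by (blast intro: meromorphic_scaleC regular_scaleC(1))
  show "mval (c *\<^sub>C F) P = c *\<^sub>C mval F P"
    using F assms by (auto simp: reg_maps_def intro: regular_scaleC(2))
qed (rule regular_mconst(2))

lemma van_maps_eq:
  "P \<in> A \<Longrightarrow> van_maps A P = split_algebra.M (reg_maps A :: 'a::complex_lie_algebra mer set) (\<lambda>F. mval F P)"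
  by (simp add: van_maps_def split_algebra.M_def[OF split_algebra_reg_maps])

section \<open>Coordinates\<close>

text \<open>Linear forms in the homogeneous coordinates of \<open>cp1\<close>, evaluated at the representatives
  \<open>(x, 1)\<close> and \<open>(1, 0)\<close>. Along \<open>chart Infty\<close> the representative of a point near infinity is
  \<open>(1, w)\<close> up to the factor \<open>w\<close>, which cancels in quotients.\<close>

primrec lform :: "complex \<Rightarrow> complex \<Rightarrow> cp1 \<Rightarrow> complex"
  where "lform a b (Aff x) = a * x + b" | "lform a b Infty = a"

primrec dlform :: "complex \<Rightarrow> complex \<Rightarrow> cp1 \<Rightarrow> complex"
  where "dlform a b (Aff x) = a" | "dlform a b Infty = b"

lemma lform_quotient_chart:
  "lform a b (chart x w) / lform c d (chart x w) =
    (lform a b x + w * dlform a b x) / (lform c d x + w * dlform c d x)"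
proof (cases x)
  case (Aff y)
  then show ?thesis by (simp add: distrib_left mult.commute[of w] add_ac)
next
  case Infty
  show ?thesis
  proof (cases "w = 0")
    case False
    have *: "a / w + b = (a + w * b) / w" for a b using False by (simp add: field_simps)
    show ?thesis using False Infty by (simp add: *)
  qed (simp add: Infty)
qed

lemma lform_wronskian:
  "a * d \<noteq> b * c \<Longrightarrow> dlform a b x * lform c d x \<noteq> lform a b x * dlform c d x"
  by (cases x) (auto simp: algebra_simps)

lemma lform_diff: "lform a b x - w * lform c d x = lform (a - w * c) (b - w * d) x"
  by (cases x) (simp_all add: algebra_simps)

lemma lform_zero_unique:
  assumes "lform a b x = 0" "lform a b y = 0" "a \<noteq> 0 \<or> b \<noteq> 0"
  shows "x = y"
proof (cases x)
  case (Aff p)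
  with assms(1,3) have "a \<noteq> 0" by auto
  then obtain q where q: "y = Aff q" using assms(2) by (cases y) auto
  have "a * p + b = a * q + b" using assms(1,2) Aff q by simp
  then show ?thesis using \<open>a \<noteq> 0\<close> Aff q by simp
next
  case Infty
  then show ?thesis using assms by (cases y) auto
qed

lemma finite_lform_zero:
  assumes "a \<noteq> 0 \<or> b \<noteq> 0"
  shows "finite {x. lform a b x = 0}"
proof (cases "\<exists>x. lform a b x = 0")
  case True
  then obtain x where "lform a b x = 0" by blast
  then have "{x. lform a b x = 0} = {x}" using lform_zero_unique[OF _ _ assms] by blast
  then show ?thesis by simp
qed simp

lemma lform_quotient_deriv:
  assumes "lform c d x \<noteq> 0"
  shows "((\<lambda>w. lform a b (chart x w) / lform c d (chart x w)) has_field_derivative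
    (dlform a b x * lform c d x - lform a b x * dlform c d x) / (lform c d x)\<^sup>2) (at 0)"
  unfolding lform_quotient_chart
  using assms by (auto intro!: derivative_eq_intros simp: power2_eq_square)

lemma holo_at_lform_quotient:
  assumes "lform c d x \<noteq> 0"
  shows "holo_at (\<lambda>y. lform a b y / lform c d y) x"
  unfolding holo_at_alt lform_quotient_chart
  using assms by (auto intro!: analytic_intros)

lemma mero_at_lform_quotient: "mero_at (\<lambda>y. lform a b y / lform c d y) x"
  unfolding mero_at_alt lform_quotient_chart
  by (intro meromorphic_intros analytic_on_imp_meromorphic_on analytic_intros)

lemma tens_rep_scalar:
  assumes "holo_at f x" "((\<lambda>w. f (chart x w)) has_field_derivative d) (at 0)"
  shows "tens_rep x (mer_of f) (f x) d"
  by (rule tens_repI[of "{0 :: nat}" "\<lambda>_. f" _ _ "\<lambda>_. 1" _ "\<lambda>_. d"])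
    (use assms in \<open>auto simp: scaleC_complex_def\<close>)

locale moebius =
  fixes a b c d :: complex and u :: "complex mer"
  assumes det: "a * d \<noteq> b * c"
    and u_def: "u = mer_of (\<lambda>x. lform a b x / lform c d x)"
begin

lemma den_nz: "c \<noteq> 0 \<or> d \<noteq> 0"
  using det by auto

lemma tens_rep_u: "lform c d z \<noteq> 0 \<Longrightarrow> tens_rep z u (lform a b z / lform c d z)
    ((dlform a b z * lform c d z - lform a b z * dlform c d z) / (lform c d z)\<^sup>2)"
  unfolding u_def by (rule tens_rep_scalar holo_at_lform_quotient lform_quotient_deriv | assumption)+

lemmas mval_u = tens_rep_imp(2)[OF tens_rep_u]
lemmas mdiff_u = tens_rep_imp(3)[OF tens_rep_u]

end

locale moebius_at = moebius +
  fixes z :: cp1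
  assumes z: "lform c d z \<noteq> 0"
begin

definition "a' = a - mval u z * c"
definition "b' = b - mval u z * d"

lemma lform_z: "lform a' b' z = 0"
  unfolding a'_def b'_def lform_diff[symmetric] using z by (simp add: mval_u)

lemma det': "c * b' \<noteq> d * a'"
  using det by (simp add: a'_def b'_def algebra_simps)

lemma lform_nz: "x \<noteq> z \<Longrightarrow> lform a' b' x \<noteq> 0"
proof -
  have "a' \<noteq> 0 \<or> b' \<noteq> 0" using det' by auto
  then show "x \<noteq> z \<Longrightarrow> lform a' b' x \<noteq> 0" using lform_zero_unique[OF _ lform_z, of x] by blast
qed

definition kern :: "cp1 \<Rightarrow> complex"
  where "kern x = mdiff u z * (lform c d x / lform a' b' x)"

lemma polar_eq: "polar u v z = mer_of (\<lambda>x. kern x *\<^sub>C v)"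
proof -
  have "finite {x. inverse (lform a b x / lform c d x - mval u z) \<noteq> lform c d x / lform a' b' x}"
  proof (rule finite_subset[OF _ finite_lform_zero[OF den_nz]], rule subsetI, rule CollectI, rule ccontr)
    fix x
    assume x: "x \<in> {x. inverse (lform a b x / lform c d x - mval u z) \<noteq> lform c d x / lform a' b' x}"
      and "lform c d x \<noteq> 0"
    then have "lform a b x / lform c d x - mval u z = lform a' b' x / lform c d x"
      by (simp add: a'_def b'_def diff_divide_distrib flip: lform_diff)
    then show False using x by simp
  qed
  then have "inverse (u - mconst (mval u z)) = mer_of (\<lambda>x. lform c d x / lform a' b' x)"
    by (simp add: u_def mconst_eq_mer_of mer_of_ops mer_of_inverse mer_of_eq_iff)
  then show ?thesis
    by (simp add: polar_def mer_of_mscale mconst_eq_mer_of mer_of_scaleC scaleC_scaleC kern_def)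
qed

lemma holo_at_kern: "x \<noteq> z \<Longrightarrow> holo_at kern x"
  unfolding kern_def[abs_def] using lform_nz by (intro holo_at_mult holo_at_lform_quotient) auto

lemma mero_at_kern: "mero_at kern x"
  unfolding kern_def[abs_def] by (intro mero_at_mult mero_at_lform_quotient mero_at_const)

lemma kern_pole: "lform c d P = 0 \<Longrightarrow> kern P = 0"
  by (simp add: kern_def)

lemma meromorphic_polar: "meromorphic (polar u v z)"
  by (rule meromorphicI[of "{0 :: nat}" "\<lambda>_. kern" _ "\<lambda>_. v"]) (auto simp: polar_eq mero_at_kern)

lemma regular_polar:
  assumes "x \<noteq> z"
  shows "regular (polar u v z) x" "mval (polar u v z) x = kern x *\<^sub>C v"
proof -
  have "tens_rep x (polar u v z) (kern x *\<^sub>C v) (deriv (kern \<circ> chart x) 0 *\<^sub>C v)"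
    by (rule tens_repI[of "{0 :: nat}" "\<lambda>_. kern" _ _ "\<lambda>_. v" _ "\<lambda>_. deriv (kern \<circ> chart x) 0"])
      (use holo_at_kern[OF assms] in \<open>auto simp: polar_eq holo_at_deriv\<close>)
  then show "regular (polar u v z) x" "mval (polar u v z) x = kern x *\<^sub>C v"
    by (auto simp: tens_rep_iff)
qed

lemma polar_mem:
  assumes "P \<in> A" "z \<notin> A" "lform c d P = 0"
  shows "polar u v z \<in> van_maps A P"
proof -
  have ne: "x \<noteq> z" if "x \<in> A" for x using assms that by auto
  have "mval (polar u v z) P = 0"
    using regular_polar(2)[OF ne[OF assms(1)]] kern_pole[OF assms(3)] by (simp add: scaleC_0_left)
  then show ?thesis
    using regular_polar(1)[OF ne] meromorphic_polar by (auto simp: van_maps_def reg_maps_def)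
qed

lemma polar_add: "polar u (v + w) z = polar u v z + polar u w z"
  by (simp add: polar_eq mer_of_ops scaleC_add_right)

lemma polar_scaleC: "polar u (k *\<^sub>C v) z = k *\<^sub>C polar u v z"
  by (simp add: polar_eq mer_of_scaleC scaleC_scaleC mult.commute)

lemma lie_polar_mconst: "lie (polar u v z) (mconst w) = polar u (lie v w) z"
  by (simp add: polar_eq mconst_eq_mer_of mer_of_lie lie_scaleC_left)

lemma ex_holo_difference_quotient:
  assumes "holo_at h z"
  shows "\<exists>g. holo_at g z \<and> (\<forall>x. x \<noteq> z \<longrightarrow> g x = kern x * (h x - h z))"
proof -
  define s where "s = dlform a' b' z"
  have s: "s \<noteq> 0"
    using lform_wronskian[of c b' d a' z] det' lform_z by (auto simp: s_def)
  let ?f = "\<lambda>w. h (chart z w)"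
  define q where "q w = (if w = 0 then deriv ?f 0 else (?f w - ?f 0) / (w - 0))" for w
  obtain r where r: "r > 0" "?f holomorphic_on ball 0 r"
    using assms by (auto simp: holo_at_alt analytic_at_ball)
  have "q holomorphic_on ball 0 r"
    unfolding q_def by (rule pole_lemma) (use r in auto)
  then have q: "q analytic_on {0}" using r(1) by (auto simp: analytic_at_ball)
  define G where "G w = mdiff u z * ((lform c d z + w * dlform c d z) / s) * q w" for w
  have G: "G analytic_on {0}"
    unfolding G_def[abs_def] using q s by (auto intro!: analytic_intros)
  define g where "g x = (if x = z then G 0 else kern x * (h x - h z))" for x
  have "g (chart z w) = G w" for w
    using s by (auto simp: g_def chart_eq_iff kern_def lform_quotient_chart lform_z G_def q_def s_def)
  then have "holo_at g z" using G by (simp add: holo_at_alt)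
  then show ?thesis by (auto simp: g_def)
qed

lemma iota_E_eq:
  fixes v :: "'a::quadratic_lie_algebra"
  assumes "F = mer_of (\<lambda>y. \<Sum>i<n. h i y *\<^sub>C w i)" "mval F z = (\<Sum>i<n. h i z *\<^sub>C w i)"
  shows "iota_E u z v F = mer_of (\<lambda>y. \<Sum>i<n. (kern y * (h i y - h i z)) *\<^sub>C - lie v (w i))"
proof -
  have key: "- (k *\<^sub>C lie v (f *\<^sub>C x)) + k *\<^sub>C lie v (g *\<^sub>C x) = (k * (f - g)) *\<^sub>C - lie v x"
    for k f g and x :: 'a
  proof -
    have "(k * (f - g)) *\<^sub>C - lie v x = - ((k * f) *\<^sub>C lie v x) + (k * g) *\<^sub>C lie v x"
      unfolding right_diff_distrib scaleC_diff_left scaleC_minus_right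
      by (rule trans[OF minus_diff_eq uminus_add_conv_diff[symmetric]])
    then show ?thesis by (simp only: lie_scaleC_right scaleC_scaleC)
  qed
  have *: "- (\<Sum>i<n. k *\<^sub>C lie v (f i *\<^sub>C w i)) + (\<Sum>i<n. k *\<^sub>C lie v (g i *\<^sub>C w i))
      = (\<Sum>i<n. (k * (f i - g i)) *\<^sub>C - lie v (w i))" for k f g
    by (simp only: sum.distrib sum_negf flip: key)
  show ?thesis
    unfolding iota_E_def assms(2) polar_eq unfolding assms(1) mer_of_lie mer_of_ops lie_scaleC_left
    by (simp only: sum_lie_right sum_scaleC_right *)
qed

lemma regular_iota_E:
  assumes "regular F z"
  shows "regular (iota_E u z v F) z"
proof -
  obtain n :: nat and h w where F: "\<And>i. i < n \<Longrightarrow> holo_at (h i) z" "F = mer_of (\<lambda>y. \<Sum>i<n. h i y *\<^sub>C w i)"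
    "mval F z = (\<Sum>i<n. h i z *\<^sub>C w i)"
    using tens_repE[OF tens_rep_regular[OF assms]] by blast
  have "\<forall>i. \<exists>g. i < n \<longrightarrow> holo_at g z \<and> (\<forall>x. x \<noteq> z \<longrightarrow> g x = kern x * (h i x - h i z))"
    using ex_holo_difference_quotient[OF F(1)] by blast
  then obtain g where g: "\<And>i. i < n \<Longrightarrow> holo_at (g i) z"
    "\<And>i x. i < n \<Longrightarrow> x \<noteq> z \<Longrightarrow> g i x = kern x * (h i x - h i z)"
    using choice[of "\<lambda>i g. i < n \<longrightarrow> holo_at g z \<and> (\<forall>x. x \<noteq> z \<longrightarrow> g x = kern x * (h i x - h i z))"]
    by blast
  have eq: "(\<Sum>i<n. (kern x * (h i x - h i z)) *\<^sub>C - lie v (w i)) = (\<Sum>i<n. g i x *\<^sub>C - lie v (w i))"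
    if "x \<noteq> z" for x
    by (rule sum.cong) (use g(2) that in auto)
  have "iota_E u z v F = mer_of (\<lambda>y. \<Sum>i<n. g i y *\<^sub>C - lie v (w i))"
    unfolding iota_E_eq[OF F(2,3)] mer_of_eq_iff
    by (rule finite_subset[of _ "{z}"]) (use eq in auto)
  then have "tens_rep z (iota_E u z v F) (\<Sum>i<n. g i z *\<^sub>C - lie v (w i))
      (\<Sum>i<n. deriv (g i \<circ> chart z) 0 *\<^sub>C - lie v (w i))"
    by (intro tens_repI[of "{..<n}" g _ _ "\<lambda>i. - lie v (w i)" _ "\<lambda>i. deriv (g i \<circ> chart z) 0"])
      (auto simp: g(1) holo_at_deriv)
  then show ?thesis by (rule tens_rep_imp)
qed

lemma iota_E_alt: "iota_E u z v F = (-1) *\<^sub>C lie (polar u v z) F + polar u (lie v (mval F z)) z"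
  by (simp add: iota_E_def scaleC_minus1)

lemma iota_E_mem:
  assumes F: "F \<in> reg_maps A" and A: "z \<in> A" "P \<in> A" "lform c d P = 0"
  shows "iota_E u z v F \<in> van_maps A P"
proof -
  have reg: "regular (iota_E u z v F) x" if "x \<in> A" for x
  proof (cases "x = z")
    case False
    then show ?thesis unfolding iota_E_alt
      using that F regular_polar(1)[OF False]
      by (intro regular_add(1) regular_scaleC(1) regular_lie(1)) (auto simp: reg_maps_def)
  qed (use F A regular_iota_E in \<open>auto simp: reg_maps_def\<close>)
  have "meromorphic (iota_E u z v F)"
    unfolding iota_E_alt using F
    by (intro meromorphic_add meromorphic_scaleC meromorphic_lie meromorphic_polar) (auto simp: reg_maps_def)
  moreover have "mval (iota_E u z v F) P = 0"
  proof -
    have "P \<noteq> z" using A z by auto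
    then have *: "tens_rep P (polar u w z) 0 (mdiff (polar u w z) P)" for w
      using regular_polar[of P w] kern_pole[OF A(3)] by (simp add: tens_rep_iff scaleC_0_left)
    have "tens_rep P F (mval F P) (mdiff F P)" using F A by (auto simp: tens_rep_iff reg_maps_def)
    from tens_rep_add[OF tens_rep_scaleC[OF tens_rep_lie[OF *[of v] this], of "-1"] *[of "lie v (mval F z)"]]
    show ?thesis unfolding iota_E_alt by (simp add: tens_rep_iff)
  qed
  ultimately show ?thesis using reg by (auto simp: van_maps_def reg_maps_def)
qed

lemma twisted_derivation_iota:
  fixes S :: "'g::quadratic_lie_algebra mer set"
  assumes S: "lie_subalgebra S" "\<And>F. F \<in> S \<Longrightarrow> regular F z"
    "\<And>v F. F \<in> S \<Longrightarrow> iota_E u z v F \<in> S"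
  shows "twisted_derivation S (iota_E u z) (iota_f z) (iota_m z)"
proof -
  have eqs: "mval (F + G) z = mval F z + mval G z" "mdiff (F + G) z = mdiff F z + mdiff G z"
    "mval (lie F G) z = lie (mval F z) (mval G z)"
    "mdiff (lie F G) z = lie (mdiff F z) (mval G z) + lie (mval F z) (mdiff G z)"
    "mval (k *\<^sub>C F) z = k *\<^sub>C mval F z" "mdiff (k *\<^sub>C F) z = k *\<^sub>C mdiff F z"
    if "F \<in> S" "G \<in> S" for F G k
    using regular_add[OF S(2) S(2)] regular_lie[OF S(2) S(2)] regular_scaleC[OF S(2)] that by auto
  have E_lie: "iota_E u z v (lie F G) + iota_E u z (iota_m z v G) F =
      lie (iota_E u z v F) G + lie F (iota_E u z v G) + iota_E u z (iota_m z v F) G"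
    if "F \<in> S" "G \<in> S" for v F G
  proof -
    have "polar u (lie (lie v (mval F z)) (mval G z)) z =
        polar u (lie v (lie (mval F z) (mval G z))) z + polar u (lie (lie v (mval G z)) (mval F z)) z"
      unfolding polar_add[symmetric]
      using lie_lie[of v "mval F z" "mval G z"] lie_antisym[of "mval F z" "lie v (mval G z)"]
      by simp
    moreover have "lie (polar u v z) (lie F G) = lie (lie (polar u v z) F) G + lie F (lie (polar u v z) G)"
      by (rule lie_lie)
    moreover have "lie F (polar u w z) = - lie (polar u w z) F" for w by (rule lie_antisym)
    ultimately show ?thesis
      by (simp add: iota_E_def iota_m_def eqs[OF that] lie_add_left lie_add_right lie_minus_left
          lie_minus_right lie_diff_left lie_diff_right)
  qed
  have f_lie: "iota_f z v (lie F G) = iota_f z (iota_m z v F) G - iota_f z (iota_m z v G) F"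
    if "F \<in> S" "G \<in> S" for v F G
    using lie_antisym[of "mdiff F z" "mval G z"]
    by (simp add: iota_f_def iota_m_def eqs[OF that] form_add_right form_diff_right form_minus_right form_invariant)
  have m_lie: "iota_m z v (lie F G) + iota_m z (iota_m z v G) F = iota_m z (iota_m z v F) G"
    if "F \<in> S" "G \<in> S" for v F G
    using lie_lie[of v "mval F z" "mval G z"] lie_antisym[of "mval F z" "lie v (mval G z)"]
    by (simp add: iota_m_def eqs[OF that])
  interpret lie_subalgebra S by (rule S)
  show ?thesis
    by unfold_locales
      (use S(3) E_lie f_lie m_lie in \<open>simp_all add: iota_E_def iota_f_def iota_m_def eqs polar_add polar_scaleC lie_add_left
       lie_add_right lie_scaleC_left lie_scaleC_right form_add_left form_add_right form_scaleC_left
       form_scaleC_right scaleC_diff_right\<close>)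
qed

end

section \<open>Coordinates are Moebius transformations\<close>

lemma chart_chart:
  "\<exists>\<tau>. \<tau> analytic_on {0} \<and> \<tau> 0 = w \<and> (\<forall>\<^sub>F t in nhds 0. chart (chart x w) t = chart x (\<tau> t))"
proof (cases "x = Infty \<and> w \<noteq> 0")
  case True
  define \<tau> where "\<tau> t = 1 / (1 / w + t)" for t
  have "\<forall>\<^sub>F t in nhds (0 :: complex). t \<in> - {- 1 / w}"
    using True by (intro eventually_nhds_in_open) auto
  then have "\<forall>\<^sub>F t in nhds 0. chart (chart x w) t = chart x (\<tau> t)"
  proof eventually_elim
    case (elim t)
    then have "1 / w + t \<noteq> 0" by (simp add: eq_neg_iff_add_eq_0 add.commute)
    then show ?case using True by (simp add: \<tau>_def)
  qed
  moreover have "\<tau> analytic_on {0}"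
    unfolding \<tau>_def[abs_def] using True by (auto intro!: analytic_intros)
  ultimately show ?thesis by (intro exI[of _ \<tau>]) (auto simp: \<tau>_def)
next
  case False
  then have "chart (chart x w) t = chart x (w + t)" for t
    by (cases x) (auto simp: add.assoc)
  then show ?thesis
    by (intro exI[of _ "\<lambda>t. w + t"]) (auto intro!: analytic_intros)
qed

lemma holo_at_compose:
  assumes "holo_at h y" "\<tau> analytic_on {s}" "\<tau> s = 0" "\<forall>\<^sub>F t in nhds s. g t = h (chart y (\<tau> t))"
  shows "g analytic_on {s}"
proof -
  have "(\<lambda>w. h (chart y w)) \<circ> \<tau> analytic_on {s}"
    using assms by (intro analytic_on_compose) (auto simp: holo_at_alt)
  then show ?thesis
    using analytic_at_cong[OF assms(4) refl] by (simp add: o_def)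
qed

lemma holo_at_chart:
  assumes "(\<lambda>w. h (chart x w)) analytic_on {w}"
  shows "holo_at h (chart x w)"
proof -
  obtain \<tau> where \<tau>: "\<tau> analytic_on {0}" "\<tau> 0 = w" "\<forall>\<^sub>F t in nhds 0. chart (chart x w) t = chart x (\<tau> t)"
    using chart_chart by blast
  have "(\<lambda>w. h (chart x w)) \<circ> \<tau> analytic_on {0}"
    using assms \<tau> by (intro analytic_on_compose) auto
  moreover have ev: "\<forall>\<^sub>F t in nhds 0. h (chart (chart x w) t) = ((\<lambda>w. h (chart x w)) \<circ> \<tau>) t"
    using \<tau>(3) by eventually_elim simp
  ultimately show ?thesis unfolding holo_at_alt analytic_at_cong[OF ev refl] by blast
qed

lemma eventually_holo_at:
  assumes "holo_at h x"
  shows "\<forall>\<^sub>F w in nhds 0. holo_at h (chart x w)"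
proof -
  obtain r where r: "r > 0" "(\<lambda>w. h (chart x w)) holomorphic_on ball 0 r"
    using assms by (auto simp: holo_at_alt analytic_at_ball)
  then have "(\<lambda>w. h (chart x w)) analytic_on ball 0 r"
    by (simp add: analytic_on_open)
  then have "holo_at h (chart x w)" if "w \<in> ball 0 r" for w
    using that by (intro holo_at_chart) (auto intro: analytic_on_subset)
  moreover have "\<forall>\<^sub>F w in nhds 0. w \<in> ball (0 :: complex) r"
    using r(1) by (intro eventually_nhds_in_open) auto
  ultimately show ?thesis by (auto elim: eventually_mono)
qed

lemma eventually_mero_at:
  assumes "mero_at h x"
  shows "\<forall>\<^sub>F w in at 0. holo_at h (chart x w)"
proof -
  have "\<not> 0 islimpt {w. \<not> (\<lambda>w. h (chart x w)) analytic_on {w}}"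
    using meromorphic_on_imp_not_islimpt_singularities assms by (force simp: mero_at_alt)
  then have "\<forall>\<^sub>F w in at 0. (\<lambda>w. h (chart x w)) analytic_on {w}"
    by (simp add: islimpt_iff_eventually)
  then show ?thesis by eventually_elim (rule holo_at_chart)
qed

lemma mer_of_eqI:
  assumes "\<And>x. \<forall>\<^sub>F w in at 0. f (chart x w) = g (chart x w)"
  shows "mer_of f = mer_of g"
proof -
  define S where "S = {y. f (Aff y) \<noteq> g (Aff y)}"
  have "\<not> y islimpt S" for y
  proof -
    have "\<forall>\<^sub>F w in at 0. w + y \<notin> S" using assms[of "Aff y"] by (simp add: S_def add.commute)
    then have "\<forall>\<^sub>F w in at y. w \<notin> S"
      unfolding at_to_0[of y] eventually_filtermap .
    then show ?thesis by (simp add: islimpt_iff_eventually)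
  qed
  moreover obtain r where r: "r > 0" "\<And>w. w \<noteq> 0 \<Longrightarrow> norm w < r \<Longrightarrow> f (chart Infty w) = g (chart Infty w)"
    using assms[of Infty] by (auto simp: eventually_at dist_norm)
  have "norm y \<le> 1 / r" if "y \<in> S" for y
  proof (rule ccontr)
    assume *: "\<not> norm y \<le> 1 / r"
    then have "y \<noteq> 0" using r(1) by auto
    moreover have "norm (1 / y) < r" using * r(1) \<open>y \<noteq> 0\<close> by (simp add: norm_divide field_simps)
    ultimately have "f (chart Infty (1 / y)) = g (chart Infty (1 / y))" by (intro r(2)) auto
    then show False using \<open>y \<noteq> 0\<close> that by (simp add: S_def)
  qed
  then have "cball 0 (1 / r) \<inter> S = S" by auto
  ultimately have "finite S"
    using finite_not_islimpt_in_compact[of "cball 0 (1 / r)" S] by auto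
  moreover have "{x. f x \<noteq> g x} \<subseteq> insert Infty (Aff ` S)"
  proof
    fix x assume "x \<in> {x. f x \<noteq> g x}"
    then show "x \<in> insert Infty (Aff ` S)" by (cases x) (auto simp: S_def)
  qed
  ultimately show ?thesis unfolding mer_of_eq_iff using finite_subset by blast
qed

lemma mval_mer_of: "holo_at h x \<Longrightarrow> mval (mer_of h) x = h x"
  by (rule tens_rep_imp(2)[OF tens_rep_scalar[OF _ holo_at_deriv]])

lemma meromorphic_scalar:
  fixes u :: "complex mer"
  assumes "meromorphic u"
  obtains h where "\<And>x. mero_at h x" "u = mer_of h"
proof -
  obtain n h a where F: "\<forall>i<n. \<forall>x. mero_at (h i) x" "u = tens n h a"
    using assms unfolding meromorphic_def by blast
  show thesis
  proof (rule that)
    show "mero_at (\<lambda>y. \<Sum>i<n. h i y * a i) x" for x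
      unfolding mero_at_alt using F(1)
      by (intro meromorphic_on_sum meromorphic_on_mult meromorphic_on_const) (simp add: mero_at_alt)
  qed (use F(2) in \<open>simp add: tens_def scaleC_complex_def\<close>)
qed

lemma regular_scalar:
  fixes u :: "complex mer"
  assumes "regular u x"
  obtains h where "holo_at h x" "u = mer_of h"
proof -
  obtain n h a where F: "\<forall>i<n. holo_at (h i) x" "u = tens n h a"
    using assms unfolding regular_def by blast
  show thesis
  proof (rule that)
    show "holo_at (\<lambda>y. \<Sum>i<n. h i y * a i) x"
      unfolding holo_at_alt using F(1)
      by (intro analytic_on_sum analytic_on_mult analytic_on_const) (simp add: holo_at_alt)
  qed (use F(2) in \<open>simp add: tens_def scaleC_complex_def\<close>)
qed

lemma mer_of_mval:
  fixes u :: "complex mer"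
  assumes "meromorphic u"
  shows "u = mer_of (mval u)"
proof -
  obtain h where h: "\<And>x. mero_at h x" "u = mer_of h" using meromorphic_scalar[OF assms] by blast
  have "mer_of h = mer_of (mval (mer_of h))"
  proof (rule mer_of_eqI)
    show "\<forall>\<^sub>F w in at 0. h (chart x w) = mval (mer_of h) (chart x w)" for x
      using eventually_mero_at[OF h(1)[of x]] by eventually_elim (simp add: mval_mer_of)
  qed
  then show ?thesis by (simp only: h(2))
qed

lemma holo_at_mval:
  fixes u :: "complex mer"
  assumes "regular u x"
  shows "holo_at (mval u) x"
proof -
  obtain h where h: "holo_at h x" "u = mer_of h" using regular_scalar[OF assms] by blast
  have ev: "\<forall>\<^sub>F w in nhds 0. mval u (chart x w) = h (chart x w)"
    using eventually_holo_at[OF h(1)] by eventually_elim (simp add: h(2) mval_mer_of)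
  show ?thesis using h(1) unfolding holo_at_alt analytic_at_cong[OF ev refl] .
qed

definition cochart :: "cp1 \<Rightarrow> complex \<Rightarrow> cp1"
  where "cochart P y = (if y = 0 then case P of Aff _ \<Rightarrow> Infty | Infty \<Rightarrow> Aff 0 else chart P (1 / y))"

lemma cochart_neq: "cochart P y \<noteq> P"
  by (cases P) (auto simp: cochart_def)

lemma analytic_cochart:
  assumes h: "holo_at h (cochart P y)"
  shows "(\<lambda>t. h (cochart P t)) analytic_on {y}"
proof (cases P)
  case P: (Aff p)
  show ?thesis
  proof (cases "y = 0")
    case y: True
    have "((\<lambda>t. 1 + p * t) \<longlongrightarrow> 1 + p * 0) (nhds 0)"
      by (intro tendsto_add tendsto_mult tendsto_const filterlim_ident)
    then have "\<forall>\<^sub>F t in nhds 0. 1 + p * t \<noteq> 0"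
      by (rule tendsto_imp_eventually_ne) simp
    then have ev: "\<forall>\<^sub>F t in nhds 0. h (cochart P t) = h (chart Infty (t / (1 + p * t)))"
    proof eventually_elim
      case nz: (elim t)
      have "cochart P t = chart Infty (t / (1 + p * t))"
        using P nz by (simp add: cochart_def add_divide_distrib)
      then show ?case by simp
    qed
    have an: "(\<lambda>t. t / (1 + p * t)) analytic_on {0}"
      by (intro analytic_on_divide analytic_on_ident analytic_on_add analytic_on_mult analytic_on_const) simp
    have "holo_at h Infty" using h by (simp add: P y cochart_def)
    from holo_at_compose[OF this an _ ev] show ?thesis unfolding y by simp
  next
    case y: False
    have "\<forall>\<^sub>F t in nhds y. t \<in> - {0}"
      using y by (intro eventually_nhds_in_open) auto
    then have ev: "\<forall>\<^sub>F t in nhds y. h (cochart P t) = h (chart (cochart P y) (1 / t - 1 / y))"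
    proof eventually_elim
      case (elim t)
      then show ?case using y by (simp add: P cochart_def)
    qed
    have "(\<lambda>t. 1 / t - 1 / y) analytic_on {y}"
      using y by (intro analytic_on_divide analytic_on_ident analytic_on_diff analytic_on_const) simp_all
    then show ?thesis by (rule holo_at_compose[OF h _ _ ev]) simp
  qed
next
  case P: Infty
  have *: "cochart P t = Aff t" for t by (simp add: P cochart_def)
  have ev: "\<forall>\<^sub>F t in nhds y. h (cochart P t) = h (chart (cochart P y) (t - y))"
    by (simp add: *)
  have "(\<lambda>t. t - y) analytic_on {y}"
    by (intro analytic_on_ident analytic_on_diff analytic_on_const)
  then show ?thesis by (rule holo_at_compose[OF h _ _ ev]) simp
qed

lemma cochart_surj:
  assumes "x \<noteq> P"
  obtains y where "x = cochart P y" "e0 + e1 * y =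
    (case P of Aff p \<Rightarrow> lform e0 (e1 - e0 * p) x / lform 1 (- p) x | Infty \<Rightarrow> lform e1 e0 x / lform 0 1 x)"
proof (cases P)
  case P: (Aff p)
  show thesis
  proof (cases x)
    case x: (Aff t)
    with assms P have t: "t - p \<noteq> 0" by auto
    have "e0 * t + (e1 - e0 * p) = e0 * (t - p) + e1" by (simp add: right_diff_distrib)
    then have eq: "(e0 * t + (e1 - e0 * p)) / (t - p) = e0 + e1 * (1 / (t - p))"
      using t by (simp only: add_divide_distrib) simp
    have "x = cochart P (1 / (t - p))" using x P t by (simp add: cochart_def)
    then show thesis by (rule that) (use eq in \<open>simp add: x P\<close>)
  next
    case Infty
    then show thesis by (intro that[of 0]) (simp_all add: P cochart_def)
  qed
next
  case P: Infty
  then obtain t where "x = Aff t" using assms by (cases x) auto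
  then show thesis by (intro that[of t]) (simp_all add: P cochart_def add.commute)
qed

lemma simple_pole_bound:
  fixes F :: "complex \<Rightarrow> complex"
  assumes "F holomorphic_on ball 0 r - {0}" "r > 0" "is_pole F 0" "zorder F 0 = -1"
  obtains \<rho> B where "0 < \<rho>" "\<rho> < r" "\<And>w. w \<noteq> 0 \<Longrightarrow> norm w \<le> \<rho> \<Longrightarrow> norm (F w) \<le> B / norm w"
proof -
  define g where "g = zor_poly F 0"
  have "0 \<in> ball 0 r" using assms(2) by simp
  note pole = conjunct2[OF conjunct2[OF zorder_exist_pole[OF assms(1) open_ball this assms(3), folded g_def]]]
  show thesis
  proof (rule exE[OF pole], elim conjE)
    fix \<rho> assume \<rho>: "\<rho> > 0" "cball (0 :: complex) \<rho> \<subseteq> ball 0 r" "g holomorphic_on cball 0 \<rho>"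
      and g: "\<forall>w\<in>cball 0 \<rho> - {0}. F w = g w / (w - 0) ^ nat (- zorder F 0) \<and> g w \<noteq> 0"
    have "bounded (g ` cball 0 \<rho>)"
      by (rule compact_imp_bounded[OF compact_continuous_image[OF holomorphic_on_imp_continuous_on[OF \<rho>(3)] compact_cball]])
    then obtain B where B: "\<forall>x\<in>g ` cball 0 \<rho>. norm x \<le> B" unfolding bounded_iff ..
    show thesis
    proof (rule that[OF \<rho>(1)])
      have "of_real \<rho> \<in> cball (0 :: complex) \<rho>" using \<rho>(1) by simp
      then have "(of_real \<rho> :: complex) \<in> ball 0 r" by (rule subsetD[OF \<rho>(2)])
      then show "\<rho> < r" using \<rho>(1) by simp
      fix w :: complex assume w: "w \<noteq> 0" "norm w \<le> \<rho>"
      have "F w = g w / w" using bspec[OF g, of w] w assms(4) by simp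
      moreover have "norm (g w) \<le> B" using bspec[OF B, of "g w"] w by simp
      ultimately show "norm (F w) \<le> B / norm w" by (simp add: norm_divide divide_right_mono)
    qed
  qed
qed

lemma coordinate_moebius:
  assumes u: "coordinate u" and P: "\<not> regular u P"
  shows "\<exists>a b c d. moebius a b c d u \<and> lform c d P = 0"
proof -
  obtain Q where mer: "meromorphic u" and Q: "simple_pole u Q" and reg: "\<And>x. x \<noteq> Q \<Longrightarrow> regular u x"
    using u unfolding coordinate_def by blast
  have "Q = P" using P reg[of P] by blast
  then have "simple_pole u P" using Q by simp
  then obtain f where f: "u = mer_of f" "is_pole (f \<circ> chart P) 0" "zorder (f \<circ> chart P) 0 = -1"
    unfolding simple_pole_def by blast
  have u_eq: "u = mer_of (mval u)" by (rule mer_of_mval[OF mer])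
  have holo: "holo_at (mval u) x" if "x \<noteq> P" for x using that reg \<open>Q = P\<close> by (intro holo_at_mval) simp
  define E where "E y = mval u (cochart P y)" for y
  have Ean: "E analytic_on {y}" for y
    unfolding E_def[abs_def] by (intro analytic_cochart holo cochart_neq)
  have E: "E holomorphic_on UNIV"
    by (rule analytic_imp_holomorphic, rule iffD2[OF analytic_on_analytic_at]) (simp add: Ean)
  have "\<forall>\<^sub>F w in at 0. f (chart P w) = mval u (chart P w)"
    by (rule eventually_chart_eq[OF trans[OF f(1)[symmetric] u_eq]])
  then obtain r where r: "r > 0" "\<And>w. w \<noteq> 0 \<Longrightarrow> norm w < r \<Longrightarrow> f (chart P w) = mval u (chart P w)"
    by (auto simp: eventually_at dist_norm)
  have "(\<lambda>w. mval u (chart P w)) holomorphic_on ball 0 r - {0}"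
  proof (rule analytic_imp_holomorphic, subst analytic_on_analytic_at, rule ballI)
    fix w assume w: "w \<in> ball 0 r - {0 :: complex}"
    have "\<forall>\<^sub>F t in nhds w. t \<in> - {0}" using w by (intro eventually_nhds_in_open) auto
    then have ev: "\<forall>\<^sub>F t in nhds w. mval u (chart P t) = E (1 / t)"
      by eventually_elim (simp add: E_def cochart_def)
    have "E \<circ> (\<lambda>t. 1 / t) analytic_on {w}"
      by (rule analytic_on_compose) (use w Ean in \<open>auto intro!: analytic_on_divide\<close>)
    then have "(\<lambda>t. E (1 / t)) analytic_on {w}" by (simp add: o_def)
    then show "(\<lambda>w. mval u (chart P w)) analytic_on {w}" unfolding analytic_at_cong[OF ev refl] .
  qed
  then have "f \<circ> chart P holomorphic_on ball 0 r - {0}"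
    by (rule holomorphic_transform) (use r(2) in auto)
  from simple_pole_bound[OF this r(1) f(2,3)] obtain \<rho> B where \<rho>: "0 < \<rho>" "\<rho> < r" "\<And>w. w \<noteq> 0 \<Longrightarrow> norm w \<le> \<rho> \<Longrightarrow> norm ((f \<circ> chart P) w) \<le> B / norm w"
    by blast
  have growth: "norm (E y) \<le> B * norm y ^ 1" if "1 / \<rho> \<le> norm y" for y
  proof -
    have y: "y \<noteq> 0" using that \<rho>(1) by auto
    have w: "norm (1 / y) \<le> \<rho>"
      using that y \<rho>(1) by (simp add: norm_divide divide_le_eq mult.commute)
    have "E y = f (chart P (1 / y))"
      using r(2)[of "1 / y"] w y \<rho>(2) by (simp add: E_def cochart_def)
    then show ?thesis using \<rho>(3)[OF _ w] y by (simp add: norm_divide)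
  qed
  define e0 e1 where "e0 = E 0" and "e1 = deriv E 0"
  have E_eq: "E y = e0 + e1 * y" for y
    using Liouville_polynomial[of E "1 / \<rho>" B 1 y, OF E growth] by (simp add: e0_def e1_def)
  have e1: "e1 \<noteq> 0"
  proof
    assume "e1 = 0"
    have "mval u x = e0" if x: "x \<noteq> P" for x
    proof (rule cochart_surj[OF x, of e0 e1])
      fix y assume "x = cochart P y"
      then show ?thesis using E_eq[of y] \<open>e1 = 0\<close> by (simp add: E_def)
    qed
    then have fin: "finite {x. mval u x \<noteq> e0}" by (intro rev_finite_subset[of "{P}", OF finite.insertI[OF finite.emptyI]]) auto
    then have "u = mconst e0"
      unfolding mconst_eq_mer_of by (intro trans[OF u_eq]) (simp only: mer_of_eq_iff)
    then have "regular u P" by (simp only: regular_mconst(1))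
    then show False using P by (rule notE[rotated])
  qed
  define a b c d :: complex where "a = (case P of Aff p \<Rightarrow> e0 | Infty \<Rightarrow> e1)" and "b = (case P of Aff p \<Rightarrow> e1 - e0 * p | Infty \<Rightarrow> e0)"
    and "c = (case P of Aff p \<Rightarrow> 1 | Infty \<Rightarrow> 0)" and "d = (case P of Aff p \<Rightarrow> - p | Infty \<Rightarrow> 1)"
  have "mval u x = lform a b x / lform c d x" if x: "x \<noteq> P" for x
  proof (rule cochart_surj[OF x, of e0 e1])
    fix y assume "x = cochart P y" "e0 + e1 * y =
        (case P of Aff p \<Rightarrow> lform e0 (e1 - e0 * p) x / lform 1 (- p) x | Infty \<Rightarrow> lform e1 e0 x / lform 0 1 x)"
    then show ?thesis
      using E_eq[of y] by (cases P) (simp_all add: E_def a_def b_def c_def d_def)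
  qed
  then have fin: "finite {x. mval u x \<noteq> lform a b x / lform c d x}" by (intro rev_finite_subset[of "{P}", OF finite.insertI[OF finite.emptyI]]) auto
  then have "u = mer_of (\<lambda>x. lform a b x / lform c d x)"
    by (intro trans[OF u_eq]) (simp only: mer_of_eq_iff)
  moreover have "a * d - b * c = - e1 \<or> a * d - b * c = e1"
    by (cases P) (simp_all add: a_def b_def c_def d_def)
  then have "a * d \<noteq> b * c" using e1 by auto
  moreover have "lform c d P = 0"
    by (cases P) (simp_all add: c_def d_def)
  ultimately show ?thesis unfolding moebius_def by blast
qed

section \<open>Comparison of the two sets of fields\<close>

lemma const_subalgebra_reg_maps:
  "P \<in> A \<Longrightarrow> const_subalgebra (reg_maps A :: 'a::complex_lie_algebra mer set)"
  using split_algebra_reg_maps split_algebra.axioms(1) by blast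

lemma reg_maps_antimono: "A \<subseteq> B \<Longrightarrow> reg_maps B \<subseteq> reg_maps A"
  by (auto simp: reg_maps_def)

context moebius_at
begin

lemma epsQ_qcls:
  fixes v :: "'g::quadratic_lie_algebra"
  assumes "P \<in> A" "z \<notin> A" "lform c d P = 0" "y \<in> free_carrier (reg_maps A)"
  shows "epsQ A P u v z (qcls (reg_maps A) y) = qcls (reg_maps A) (fgen (polar u v z) * y)"
  unfolding epsQ_def van_maps_eq[OF assms(1)]
  by (rule split_algebra.transport_eps_qcls[OF split_algebra_reg_maps[OF assms(1)] _ assms(4)])
    (use polar_mem[OF assms(1-3)] van_maps_eq[OF assms(1)] in blast)

lemma polar_reg:
  "P \<in> A \<Longrightarrow> z \<notin> A \<Longrightarrow> lform c d P = 0 \<Longrightarrow> polar u v z \<in> reg_maps A"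
  using polar_mem by (auto simp: van_maps_def)

lemma const_twisted_iota:
  assumes A: "P \<in> A" "z \<in> A" "lform c d P = 0"
  shows "const_twisted (reg_maps A :: 'g::quadratic_lie_algebra mer set) (iota_E u z) (iota_f z) (iota_m z)"
proof -
  interpret const_subalgebra "reg_maps A :: 'g mer set" by (rule const_subalgebra_reg_maps[OF A(1)])
  interpret twisted_derivation "reg_maps A :: 'g mer set" "iota_E u z" "iota_f z" "iota_m z"
    by (rule twisted_derivation_iota[OF lie_subalgebra_axioms])
      (use A iota_E_mem[of _ A P] in \<open>auto simp: reg_maps_def van_maps_def\<close>)
  show ?thesis
  proof
    fix v w :: 'g
    show "iota_E u z v (mconst w) = 0"
      by (simp add: iota_E_def lie_polar_mconst regular_mconst(2))
    show "iota_f z v (mconst w) = 0"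
      using form_scaleC_right[of v 0 0] by (simp add: iota_f_def regular_mconst(3))
  qed
qed

lemma iotaQ_qcls:
  fixes v :: "'g::quadratic_lie_algebra"
  assumes A: "P \<in> A" "z \<in> A" "lform c d P = 0" and y: "y \<in> free_carrier (reg_maps A)"
  shows "iotaQ A P u v z (qcls (reg_maps A) y) = qcls (reg_maps A) (iota_free u z v y)"
proof -
  interpret split_algebra "reg_maps A :: 'g mer set" "\<lambda>F. mval F P"
    by (rule split_algebra_reg_maps[OF A(1)])
  have "twisted_derivation M (iota_E u z :: 'g \<Rightarrow> _) (iota_f z) (iota_m z)"
  proof (rule twisted_derivation_iota[OF M.lie_subalgebra_axioms])
    fix F :: "'g mer" and v :: 'g
    assume "F \<in> M"
    then have F: "F \<in> reg_maps A" by (rule M_L)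
    then show "regular F z" using A(2) by (simp add: reg_maps_def)
    show "iota_E u z v F \<in> M"
      using iota_E_mem[OF F A(2,1,3)] unfolding van_maps_eq[OF A(1)] .
  qed
  then show ?thesis
    unfolding iotaQ_def van_maps_eq[OF A(1)]
    by (intro transport_iota_qcls split_algebra_axioms const_twisted_iota[OF A] y)
qed

lemma iota_free_mem:
  fixes v :: "'g::quadratic_lie_algebra"
  assumes A: "P \<in> A" "z \<in> A" "lform c d P = 0" and y: "y \<in> free_carrier (reg_maps A)"
  shows "iota_free u z v y \<in> free_carrier (reg_maps A)"
proof -
  interpret const_twisted "reg_maps A :: 'g mer set" "iota_E u z" "iota_f z" "iota_m z"
    by (rule const_twisted_iota[OF A])
  show ?thesis using y by simp
qed

end

lemma restricts_toI:
  fixes K L :: "'a::complex_lie_algebra mer set"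
  assumes "const_subalgebra K" "const_subalgebra L" "K \<subseteq> L"
    and T: "\<And>y. y \<in> free_carrier K \<Longrightarrow> T (qcls K y) = qcls K (t y)"
    and T': "\<And>y. y \<in> free_carrier L \<Longrightarrow> T' (qcls L y) = qcls L (t y)"
    and t: "\<And>y. y \<in> free_carrier K \<Longrightarrow> t y \<in> free_carrier K"
  shows "restricts_to K L T' T"
proof -
  interpret K: const_subalgebra K by fact
  interpret L: const_subalgebra L by fact
  have "T X \<in> carrier (Q K) \<and> qincl L (T X) = T' (qincl L X)" if X: "X \<in> carrier (Q K)" for X
  proof -
    obtain y where y: "y \<in> free_carrier K" "X = qcls K y" using X by (auto simp: K.carrier_Q)
    moreover have "y \<in> free_carrier L" using y free_carrier_mono[OF assms(3)] by blast
    ultimately show ?thesis using t by (simp add: T T' L.qincl_qcls[OF assms(1,3)])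
  qed
  then show ?thesis by (auto simp: restricts_to_def)
qed

locale inverse_coordinates = moebius_at a b c d u z + inv: moebius_at c d a b u' z for a b c d u z u'
begin

definition \<theta> :: complex where "\<theta> = mdiff u' z / mval u' z"

lemma kern_inverse:
  assumes "x \<noteq> z"
  shows "inv.kern x = kern x - \<theta>"
proof -
  define w where "w = mval u z"
  have w: "w \<noteq> 0" using z inv.z by (simp add: w_def mval_u)
  have mval': "mval u' z = 1 / w" using z inv.z by (simp add: w_def mval_u inv.mval_u)
  have mdiff': "mdiff u' z = - mdiff u z / w\<^sup>2"
    using z inv.z by (simp add: w_def mval_u mdiff_u inv.mdiff_u divide_simps)
  define l where "l = lform a' b' x"
  have l: "l \<noteq> 0" using lform_nz[OF assms] by (simp add: l_def)
  have ab: "lform a b x = l + w * lform c d x"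
    by (simp add: l_def a'_def b'_def w_def flip: lform_diff)
  have l': "lform inv.a' inv.b' x = - l / w"
    unfolding inv.a'_def inv.b'_def lform_diff[symmetric] mval' ab using w by (simp add: field_simps)
  have "inv.kern x = - mdiff u z / w\<^sup>2 * ((l + w * lform c d x) / (- l / w))"
    unfolding inv.kern_def mdiff' l' ab ..
  also have "\<dots> = mdiff u z * (lform c d x / l) - (- mdiff u z / w\<^sup>2) / (1 / w)"
    using w l by (simp add: field_simps power2_eq_square)
  finally show ?thesis by (simp add: kern_def \<theta>_def mval' mdiff' l_def)
qed

lemma polar_inverse: "polar u v z = polar u' v z + \<theta> *\<^sub>C mconst v"
proof -
  have "kern x *\<^sub>C v = inv.kern x *\<^sub>C v + \<theta> *\<^sub>C v" if "x \<noteq> z" for x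
    unfolding scaleC_add_left[symmetric] kern_inverse[OF that] by simp
  then have "mer_of (\<lambda>x. kern x *\<^sub>C v) = mer_of (\<lambda>x. inv.kern x *\<^sub>C v + \<theta> *\<^sub>C v)"
    unfolding mer_of_eq_iff by (intro rev_finite_subset[of "{z}", OF finite.insertI[OF finite.emptyI]]) auto
  then show ?thesis
    by (simp add: polar_eq inv.polar_eq mconst_eq_mer_of mer_of_scaleC mer_of_ops)
qed

lemma iota_E_inverse:
  "iota_E u z v F + lie (\<theta> *\<^sub>C mconst v) F = iota_E u' z v F + \<theta> *\<^sub>C mconst (lie v (mval F z))"
  by (simp add: iota_E_def polar_inverse lie_add_left)

lemma eps_inverse:
  fixes v :: "'g::quadratic_lie_algebra"
  assumes "P \<in> A" "P' \<in> A" "z \<notin> A" "lform c d P = 0" "lform a b P' = 0" and y: "y \<in> free_carrier (reg_maps A)"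
  shows "fgen (polar u' v z) * y - (fgen (polar u v z) * y - fgen (\<theta> *\<^sub>C mconst v) * y) \<in> aug_null (reg_maps A)"
proof -
  interpret const_subalgebra "reg_maps A :: 'g mer set" by (rule const_subalgebra_reg_maps[OF assms(1)])
  have "fgen (polar u' v z + \<theta> *\<^sub>C mconst v) - fgen (polar u' v z) - fgen (\<theta> *\<^sub>C mconst v)
      \<in> env_ideal (reg_maps A)"
    by (intro J_gen_add inv.polar_reg[OF assms(2,3,5)] scaleC_mem mconst_mem)
  from N_J[OF J_uminus[OF J_right[OF y this]]] show ?thesis
    by (simp add: polar_inverse algebra_simps)
qed

lemma iota_inverse:
  fixes v :: "'g::quadratic_lie_algebra"
  assumes A: "P \<in> A" "P' \<in> A" "z \<in> A" "lform c d P = 0" "lform a b P' = 0"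
    and y: "y \<in> free_carrier (reg_maps A)"
  shows "iota_free u' z v y - (iota_free u z v y + fgen (\<theta> *\<^sub>C mconst v) * y) \<in> aug_null (reg_maps A)"
proof -
  interpret const_twisted "reg_maps A :: 'g mer set" "iota_E u z" "iota_f z" "iota_m z"
    by (rule const_twisted_iota[OF A(1,3,4)])
  interpret inv: const_twisted "reg_maps A :: 'g mer set" "iota_E u' z" "iota_f z" "iota_m z"
    by (rule inv.const_twisted_iota[OF A(2,3,5)])
  show ?thesis
    using y
  proof (induction y arbitrary: v rule: free_carrier_induct)
    case one
    show ?case using N_uminus[OF N_const[of "\<theta> *\<^sub>C v"]] by (simp add: mconst_scaleC)
  next
    case (add x y)
    from N_add[OF add(3,4)] show ?case by (simp add: twisted_add algebra_simps)
  next
    case (scale k x)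
    have "fgen (\<theta> *\<^sub>C mconst v) * (fconst k * x) = fconst k * (fgen (\<theta> *\<^sub>C mconst v) * x)"
      by (metis fconst_commute mult.assoc)
    then show ?case
      using N_left[OF _ scale(2)[of v], of "fconst k"] by (simp add: twisted_fconst algebra_simps)
  next
    case (gen F y)
    let ?c = "\<theta> *\<^sub>C mconst v" and ?c' = "\<theta> *\<^sub>C mconst (lie v (mval F z))"
    have m: "iota_m z v F = lie v (mval F z)" by (simp add: iota_m_def)
    define S where "S = iota_E u z v F + lie ?c F"
    have S': "S = iota_E u' z v F + ?c'" by (simp add: S_def iota_E_inverse)
    have c: "?c \<in> reg_maps A" "?c' \<in> reg_maps A" by auto
    have s1: "fgen S - fgen (iota_E u z v F) - fgen (lie ?c F) \<in> env_ideal (reg_maps A)"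
      unfolding S_def by (intro J_gen_add E_mem lie_mem c gen)
    have s2: "fgen S - fgen (iota_E u' z v F) - fgen ?c' \<in> env_ideal (reg_maps A)"
      unfolding S' by (intro J_gen_add inv.E_mem c gen)
    have s3: "fgen ?c * fgen F - fgen F * fgen ?c - fgen (lie ?c F) \<in> env_ideal (reg_maps A)"
      by (intro J_gen_lie c gen)
    have "fgen F * (iota_free u' z v y - (iota_free u z v y + fgen ?c * y)) \<in> N"
      by (intro N_left gen free_carrier_fgen)
    moreover have "iota_free u' z (lie v (mval F z)) y - (iota_free u z (lie v (mval F z)) y + fgen ?c' * y) \<in> N"
      by (rule gen(3))
    moreover from N_J[OF J_right[OF gen(2) J_diff[OF J_diff[OF s1 s2] s3]]]
    have "((fgen S - fgen (iota_E u z v F) - fgen (lie ?c F))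
        - (fgen S - fgen (iota_E u' z v F) - fgen ?c')
        - (fgen ?c * fgen F - fgen F * fgen ?c - fgen (lie ?c F))) * y \<in> N" .
    ultimately have "fgen F * (iota_free u' z v y - (iota_free u z v y + fgen ?c * y))
      + (iota_free u' z (lie v (mval F z)) y - (iota_free u z (lie v (mval F z)) y + fgen ?c' * y))
      + ((fgen S - fgen (iota_E u z v F) - fgen (lie ?c F))
        - (fgen S - fgen (iota_E u' z v F) - fgen ?c')
        - (fgen ?c * fgen F - fgen F * fgen ?c - fgen (lie ?c F))) * y \<in> N"
      by (rule N_add[OF N_add])
    then show ?case
      by (simp add: twisted_gen m algebra_simps)
  qed
qed

end

theorem theorem11p6:
  fixes P P' z :: cp1
    and u u' :: "complex mer"
    and \<nu> :: "'g::quadratic_lie_algebra mer"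
  assumes "P \<noteq> P'"
    and "coordinate u" and "mval u P' = 0" and "\<not> regular u P"
    and "u' = inverse u"
    and "meromorphic \<nu>"
    and "z \<noteq> P" and "z \<noteq> P'" and "regular \<nu> z"
  defines "\<nu>z \<equiv> mval \<nu> z"
    and "L \<equiv> (reg_maps {P, P'} :: 'g mer set)"
    and "Lz \<equiv> (reg_maps {P, P', z} :: 'g mer set)"
    and "\<theta> \<equiv> mdiff u' z / mval u' z"
  shows "restricts_to L (reg_maps {P}) (epsQ {P} P u \<nu>z z) (epsQ {P, P'} P u \<nu>z z)
    \<and> restricts_to L (reg_maps {P'}) (epsQ {P'} P' u' \<nu>z z) (epsQ {P, P'} P' u' \<nu>z z)
    \<and> (\<forall>X\<in>carrier (Q L).
         epsQ {P, P'} P' u' \<nu>z z X =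
         epsQ {P, P'} P u \<nu>z z X \<ominus>\<^bsub>Q L\<^esub> ugen L (\<theta> *\<^sub>C mconst \<nu>z) \<odot>\<^bsub>Q L\<^esub> X)
    \<and> restricts_to Lz (reg_maps {P, z}) (iotaQ {P, z} P u \<nu>z z) (iotaQ {P, P', z} P u \<nu>z z)
    \<and> restricts_to Lz (reg_maps {P', z}) (iotaQ {P', z} P' u' \<nu>z z) (iotaQ {P, P', z} P' u' \<nu>z z)
    \<and> (\<forall>X\<in>carrier (Q Lz).
         iotaQ {P, P', z} P' u' \<nu>z z X =
         iotaQ {P, P', z} P u \<nu>z z X \<oplus>\<^bsub>Q Lz\<^esub> ugen Lz (\<theta> *\<^sub>C mconst \<nu>z) \<odot>\<^bsub>Q Lz\<^esub> X)
    \<and> (\<forall>X\<in>carrier (Q Lz). jQ {P, P'} P' u' \<nu>z z X = jQ {P, P'} P u \<nu>z z X)"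
proof -
  obtain a b c d where mo: "moebius a b c d u" and P: "lform c d P = 0"
    using coordinate_moebius[OF assms(2,4)] by blast
  interpret moebius a b c d u by (rule mo)
  have cd: "lform c d x \<noteq> 0" if "x \<noteq> P" for x
    using lform_zero_unique[OF _ P den_nz] that by blast
  have P': "lform a b P' = 0"
    using assms(1,3) cd[of P'] by (simp add: mval_u)
  have u': "u' = mer_of (\<lambda>x. lform c d x / lform a b x)"
    by (simp add: assms(5) u_def mer_of_inverse)
  have mo': "moebius c d a b u'"
    using det u' by (simp add: moebius_def mult.commute)
  interpret inv: moebius c d a b u' by (rule mo')
  have ab: "lform a b x \<noteq> 0" if "x \<noteq> P'" for x
    using lform_zero_unique[OF _ P' inv.den_nz] that by blast
  interpret inverse_coordinates a b c d u z u'
    by (intro inverse_coordinates.intro moebius_at.intro mo mo' moebius_at_axioms.intro cd ab assms(7,8))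
  have \<theta>: "mdiff u' z / mval u' z = local.\<theta>" by (simp add: \<theta>_def)
  note not_in = \<open>z \<noteq> P\<close> \<open>z \<noteq> P'\<close>
  interpret L: const_subalgebra "reg_maps {P, P'} :: 'g mer set" by (rule const_subalgebra_reg_maps[of P]) simp
  interpret Lz: const_subalgebra "reg_maps {P, P', z} :: 'g mer set" by (rule const_subalgebra_reg_maps[of P]) simp
  let ?L = "reg_maps {P, P'} :: 'g mer set" and ?Lz = "reg_maps {P, P', z} :: 'g mer set"
  let ?a = "mval \<nu> z"
  let ?p = "fgen (polar u ?a z)" and ?p' = "fgen (polar u' ?a z)" and ?c = "fgen (local.\<theta> *\<^sub>C mconst ?a)"
  let ?i = "iota_free u z ?a" and ?i' = "iota_free u' z ?a"
  have p: "polar u ?a z \<in> ?L" and p': "polar u' ?a z \<in> ?L"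
    using not_in P P' by (auto intro!: polar_reg[of P] inv.polar_reg[of P'])
  have c: "local.\<theta> *\<^sub>C mconst ?a \<in> ?L" "local.\<theta> *\<^sub>C mconst ?a \<in> ?Lz" by auto
  have eps: "epsQ {P, P'} P u ?a z (qcls ?L y) = qcls ?L (?p * y)"
    "epsQ {P, P'} P' u' ?a z (qcls ?L y) = qcls ?L (?p' * y)" if "y \<in> free_carrier ?L" for y
    using not_in that P P' by (simp_all add: epsQ_qcls inv.epsQ_qcls)
  have iota: "iotaQ {P, P', z} P u ?a z (qcls ?Lz y) = qcls ?Lz (?i y)"
    "iotaQ {P, P', z} P' u' ?a z (qcls ?Lz y) = qcls ?Lz (?i' y)" if "y \<in> free_carrier ?Lz" for y
    using that P P' by (simp_all add: iotaQ_qcls inv.iotaQ_qcls)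
  have i: "?i y \<in> free_carrier ?Lz" "?i' y \<in> free_carrier ?Lz" if "y \<in> free_carrier ?Lz" for y
    using that by (auto intro!: iota_free_mem[of P] P inv.iota_free_mem[of P'] P')
  have sub: "?Lz \<subseteq> ?L" by (rule reg_maps_antimono) auto
  have eps_eq: "?p' * y - (?p * y - ?c * y) \<in> aug_null ?L" if "y \<in> free_carrier ?L" for y
    using not_in P P' that by (intro eps_inverse[of P _ P']) auto
  have iota_eq: "?i' y - (?i y + ?c * y) \<in> aug_null ?Lz" if "y \<in> free_carrier ?Lz" for y
    using P P' that by (intro iota_inverse[of P _ P']) auto
  have 1: "restricts_to ?L (reg_maps {P}) (epsQ {P} P u ?a z) (epsQ {P, P'} P u ?a z)"
    by (rule restricts_toI[where t = "\<lambda>y. ?p * y"])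
      (use not_in p in \<open>simp_all add: const_subalgebra_reg_maps[of P] reg_maps_antimono epsQ_qcls P\<close>)
  have 2: "restricts_to ?L (reg_maps {P'}) (epsQ {P'} P' u' ?a z) (epsQ {P, P'} P' u' ?a z)"
    by (rule restricts_toI[where t = "\<lambda>y. ?p' * y"])
      (use not_in p' in \<open>simp_all add: const_subalgebra_reg_maps[of P'] reg_maps_antimono inv.epsQ_qcls P'\<close>)
  have 3: "epsQ {P, P'} P' u' ?a z X =
      epsQ {P, P'} P u ?a z X \<ominus>\<^bsub>Q ?L\<^esub> ugen ?L (local.\<theta> *\<^sub>C mconst ?a) \<odot>\<^bsub>Q ?L\<^esub> X"
    if X: "X \<in> carrier (Q ?L)" for X
  proof -
    obtain y where y: "y \<in> free_carrier ?L" "X = qcls ?L y" using X by (auto simp: L.carrier_Q)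
    show ?thesis
      using eps_eq[OF y(1)] y(1) p p' c
      by (simp add: y(2) eps[OF y(1)] ugen_def L.qcls_eq_iff)
  qed
  have 4: "restricts_to ?Lz (reg_maps {P, z}) (iotaQ {P, z} P u ?a z) (iotaQ {P, P', z} P u ?a z)"
    by (rule restricts_toI[where t = ?i])
      (use i in \<open>simp_all add: const_subalgebra_reg_maps[of P] reg_maps_antimono iotaQ_qcls P\<close>)
  have 5: "restricts_to ?Lz (reg_maps {P', z}) (iotaQ {P', z} P' u' ?a z) (iotaQ {P, P', z} P' u' ?a z)"
    by (rule restricts_toI[where t = ?i'])
      (use i in \<open>simp_all add: const_subalgebra_reg_maps[of P'] reg_maps_antimono inv.iotaQ_qcls P'\<close>)
  have 6: "iotaQ {P, P', z} P' u' ?a z X =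
      iotaQ {P, P', z} P u ?a z X \<oplus>\<^bsub>Q ?Lz\<^esub> ugen ?Lz (local.\<theta> *\<^sub>C mconst ?a) \<odot>\<^bsub>Q ?Lz\<^esub> X"
    if X: "X \<in> carrier (Q ?Lz)" for X
  proof -
    obtain y where y: "y \<in> free_carrier ?Lz" "X = qcls ?Lz y" using X by (auto simp: Lz.carrier_Q)
    show ?thesis
      using iota_eq[OF y(1)] y(1) i[OF y(1)] c
      by (simp add: y(2) iota[OF y(1)] ugen_def Lz.qcls_eq_iff)
  qed
  have 7: "jQ {P, P'} P' u' ?a z X = jQ {P, P'} P u ?a z X" if X: "X \<in> carrier (Q ?Lz)" for X
  proof -
    obtain y where y: "y \<in> free_carrier ?Lz" "X = qcls ?Lz y" using X by (auto simp: Lz.carrier_Q)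
    have ins: "insert z {P, P'} = {P, P', z}" by auto
    have mem: "w \<in> free_carrier ?L" if "w \<in> free_carrier ?Lz" for w
      using free_carrier_mono[OF sub] that by blast
    note q = L.qincl_qcls[OF Lz.const_subalgebra_axioms sub]
    have yL: "y \<in> free_carrier ?L" by (rule mem[OF y(1)])
    have "?i' y - (?i y + ?c * y) \<in> aug_null ?L"
      using L.aug_null_mono[OF Lz.const_subalgebra_axioms sub] iota_eq[OF y(1)] by blast
    from L.N_add[OF eps_eq[OF yL] this]
    have "?p' * y + ?i' y - (?p * y + ?i y) \<in> aug_null ?L" by (simp add: algebra_simps)
    then show ?thesis
      using p p' yL mem[OF i(1)[OF y(1)]] mem[OF i(2)[OF y(1)]]
      by (simp add: jQ_def ins y(2) iota[OF y(1)] q[OF y(1)] q[OF i(1)[OF y(1)]] q[OF i(2)[OF y(1)]]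
          eps[OF yL] L.qcls_eq_iff)
  qed
  show ?thesis
    unfolding assms(10-13) \<theta>
    by (intro conjI ballI 1 2 3 4 5 6 7)
qed

end
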